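(* Let $X$ and $Y=Y_1\times\dots\times Y_n$ be separable Hilbert spaces, and for all $i\in\{1,\dots,n\}$ let $A_i:X\to Y_i$ be a bounded linear operator and let $f_i:Y_i\to\mathbb{R}\cup\{+\infty\}$ and $g:X\to\mathbb{R}\cup\{+\infty\}$ be proper, convex and lower semi-continuous. Assume that the set of saddle-points $\mathcal{C}$ is non-empty and that the sampling is proper, i.e. $p_i>0$ for all $i\in\{1,\dots,n\}$. Let $(x^k,y^k)_{k\in\mathbb{N}}$ be the iterates of the A-SPDHG algorithm with step-sizes $\tau^k$, $\sigma_i^k$. Suppose that: (i) the step-size sequences $(\tau^{k+1})_{k\in\mathbb{N}}$ and $(\sigma_i^{k+1})_{k\in\mathbb{N}}$, $i\in\{1,\dots,n\}$, are $(\mathcal{F}^k)_{k\in\mathbb{N}}$-adapted; (ii) there exists $\beta\in(0,1)$ such that for all $i\in\{1,\dots,n\}$ and $k\in\mathbb{N}$, $$\tau^k\sigma_i^k\frac{\|A_i\|^2}{p_i}\le\beta<1;$$ (iii) the initial step-sizes $\tau^0$ and $\sigma_i^0$, $i\in\{1,\dots,n\}$, are positive, and the step-size sequences $(\tau^k)_{k\in\mathbb{N}}$ and $(\sigma_i^k)_{k\in\mathbb{N}}$, $i\in\{1,\dots,n\}$, are uniformly almost surely quasi-increasing. Then the sequence of iterates $(x^k,y^k)_{k\in\mathbb{N}}$ converges almost surely to an element of $\mathcal{C}$.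
   Context: $A:X\to Y$ is $Ax=(A_1x,\dots,A_nx)$, so $A^*y=\sum_{i=1}^nA_i^*y_i$ for $y=(y_1,\dots,y_n)$. $f_i^*$ is the Fenchel conjugate of $f_i$. Saddle-points: $\mathcal{C}\subset X\times Y$ is the set of solutions of $\min_{x\in X}\sup_{y\in Y}\sum_{i=1}^n\left(\langle A_ix,y_i\rangle-f_i^*(y_i)\right)+g(x)$, i.e. the set of $(x^*,y^* )$ with $A_ix^*\in\partial f_i^*(y_i^* )$ for all $i$ and $-\sum_{i=1}^nA_i^*y_i^*\in\partial g(x^* )$. A-SPDHG algorithm (serial sampling): the inputs are initial points $x^0\in X$, $y^0\in Y$, initial step-sizes $\tau^0,\sigma_1^0,\dots,\sigma_n^0$, probabilities $(p_i)_{1\le i\le n}$, and a step-size update rule. Set $\bar y^0=y^0$. For $k=0,1,2,\dots$: 1. determine $\tau^{k+1}$ and $(\sigma_i^{k+1})_{1\le i\le n}$ by the update rule, from the values of $\tau^l$, $(\sigma_i^l)_i$, $x^l$, $y^l$, $0\le l\le k$; 2. $x^{k+1}=\mathrm{prox}_{\tau^{k+1}g}(x^k-\tau^{k+1}A^*\bar y^k)$; 3. randomly pick $i\in\{1,\dots,n\}$ with probability $p_i$; 4. $y_i^{k+1}=\mathrm{prox}_{\sigma_i^{k+1}f_i^*}(y_i^k+\sigma_i^{k+1}A_ix^{k+1})$ and $y_j^{k+1}=y_j^k$ for $j\ne i$; 5. $\bar y_i^{k+1}=y_i^{k+1}+\frac1{p_i}(y_i^{k+1}-y_i^k)$ and $\bar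 y_j^{k+1}=y_j^k$ for $j\neq i$. Here $\mathrm{prox}_{h}(u)=\arg\min_v\frac12\|v-u\|^2+h(v)$. The iterates and step-sizes are in general random. $\mathcal{F}^k$ is the $\sigma$-algebra generated by $(x^l,y^l)$, $0\le l\le k$. A sequence $(u^k)_{k\in\mathbb{N}}$ is $(\mathcal{F}^k)_{k\in\mathbb{N}}$-adapted if $u^k$ is $\mathcal{F}^k$-measurable for all $k\in\mathbb N$. A random positive real sequence $(u^k)_{k\in\mathbb{N}}$ is uniformly almost surely quasi-increasing if there is a deterministic sequence $(\eta^k)_{k\in\mathbb{N}}$ with values in $[0,1)$ such that $\sum_k\eta^k<\infty$ and, almost surely, $u^{k+1}\ge(1-\eta^k)u^k$ for all $k\in\mathbb{N}$.
   Formalization: Convergence of the iterates is weak convergence in the Hilbert space X×Y (ordinary convergence in finite dimension); norm convergence fails in general, e.g. for A=0 and constant step-sizes by Güler's proximal point example. *)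

theory Defs
  imports "HOL-Probability.Probability"
begin

text \<open>
  The real Hilbert space $X$ is a type. The factors $Y_1, \dots, Y_n$ are allowed to be different
  spaces, so they are closed subspaces \<open>Y i\<close> of one separable Hilbert space type; this
  is no restriction, since finitely many separable Hilbert spaces embed isometrically into their
  direct sum. The index set $\{1, \dots, n\}$ is a finite type, and an element
  of $Y = Y_1 \times \dots \times Y_n$ is a vector \<open>y\<close> with \<open>y $ i \<in> Y i\<close>
  for all \<open>i\<close>. Notions for functions on a Hilbert space are relative to a carrier
  \<open>S\<close>; the values outside of \<open>S\<close> are irrelevant.
\<close>

definition proper_on :: "'a set \<Rightarrow> ('a \<Rightarrow> ereal) \<Rightarrow> bool" where
  "proper_on S h \<longleftrightarrow> (\<forall>u\<in>S. h u \<noteq> -\<infinity>) \<and> (\<exists>u\<in>S. h u \<noteq> \<infinity>)"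

definition ereal_convex_on :: "'a::real_vector set \<Rightarrow> ('a \<Rightarrow> ereal) \<Rightarrow> bool" where
  "ereal_convex_on S h \<longleftrightarrow>
    (\<forall>u\<in>S. \<forall>v\<in>S. \<forall>t\<in>{0<..<1}.
      h ((1 - t) *\<^sub>R u + t *\<^sub>R v) \<le> ereal (1 - t) * h u + ereal t * h v)"

definition lsc_on :: "'a::topological_space set \<Rightarrow> ('a \<Rightarrow> ereal) \<Rightarrow> bool" where
  "lsc_on S h \<longleftrightarrow> (\<forall>u\<in>S. h u \<le> Liminf (at u within S) h)"

definition fenchel_conjugate :: "'a::real_inner set \<Rightarrow> ('a \<Rightarrow> ereal) \<Rightarrow> 'a \<Rightarrow> ereal" where
  "fenchel_conjugate S h w = (SUP u\<in>S. ereal (inner u w) - h u)"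

definition subdifferential :: "'a::real_inner set \<Rightarrow> ('a \<Rightarrow> ereal) \<Rightarrow> 'a \<Rightarrow> 'a set" where
  "subdifferential S h u = {w \<in> S. \<forall>v\<in>S. h u + ereal (inner w (v - u)) \<le> h v}"

definition prox :: "'a::real_inner set \<Rightarrow> ('a \<Rightarrow> ereal) \<Rightarrow> 'a \<Rightarrow> 'a" where
  "prox S h u = (ARG_MIN (\<lambda>v. ereal (1 / 2 * (norm (v - u))\<^sup>2) + h v) v. v \<in> S)"

text \<open>
  Convergence of the iterates is weak convergence. The norm topology is not available in infinite
  dimension: for $A = 0$ and constant step-sizes the $x$-iterates are those of the proximal point
  method, which need not converge strongly. In finite dimension the two notions coincide.
\<close>

definition weakly_convergent_to :: "(nat \<Rightarrow> 'a::real_inner) \<Rightarrow> 'a \<Rightarrow> bool" where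
  "weakly_convergent_to z l \<longleftrightarrow> (\<forall>v. (\<lambda>k. inner (z k) v) \<longlonglongrightarrow> inner l v)"

definition stacked_adjoint ::
  "('n::finite \<Rightarrow> 'x::real_inner \<Rightarrow> 'y::real_inner) \<Rightarrow> 'y ^ 'n \<Rightarrow> 'x" where
  "stacked_adjoint A y = (\<Sum>i\<in>UNIV. adjoint (A i) (y $ i))"

definition saddle_points ::
  "('n::finite \<Rightarrow> 'y::real_inner set) \<Rightarrow> ('n \<Rightarrow> 'x::real_inner \<Rightarrow> 'y) \<Rightarrow>
   ('n \<Rightarrow> 'y \<Rightarrow> ereal) \<Rightarrow> ('x \<Rightarrow> ereal) \<Rightarrow> ('x \<times> ('y ^ 'n)) set" where
  "saddle_points Y A f g =
    {(x, y). (\<forall>i. y $ i \<in> Y i) \<and>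
      (\<forall>i. A i x \<in> subdifferential (Y i) (fenchel_conjugate (Y i) (f i)) (y $ i)) \<and>
      - stacked_adjoint A y \<in> subdifferential UNIV g x}"

text \<open>
  One run of the algorithm, for a given sequence \<open>pick\<close> of sampled indices. At step \<open>k\<close>
  the step-size rule sees the past only through the restrictions to \<open>{..k}\<close>.
\<close>

definition aspdhg_run ::
  "('n::finite \<Rightarrow> 'y::real_inner set) \<Rightarrow> ('n \<Rightarrow> 'x::real_inner \<Rightarrow> 'y) \<Rightarrow>
   ('n \<Rightarrow> 'y \<Rightarrow> ereal) \<Rightarrow> ('x \<Rightarrow> ereal) \<Rightarrow> ('n \<Rightarrow> real) \<Rightarrow>
   (nat \<Rightarrow> (nat \<Rightarrow> real) \<Rightarrow> (nat \<Rightarrow> 'n \<Rightarrow> real) \<Rightarrow> (nat \<Rightarrow> 'x) \<Rightarrow> (nat \<Rightarrow> 'y ^ 'n)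
      \<Rightarrow> real \<times> ('n \<Rightarrow> real)) \<Rightarrow>
   'x \<Rightarrow> 'y ^ 'n \<Rightarrow> real \<Rightarrow> ('n \<Rightarrow> real) \<Rightarrow> (nat \<Rightarrow> 'n) \<Rightarrow>
   (nat \<Rightarrow> real) \<Rightarrow> (nat \<Rightarrow> 'n \<Rightarrow> real) \<Rightarrow> (nat \<Rightarrow> 'x) \<Rightarrow> (nat \<Rightarrow> 'y ^ 'n) \<Rightarrow>
   (nat \<Rightarrow> 'y ^ 'n) \<Rightarrow> bool" where
  "aspdhg_run Y A f g p rule x0 y0 \<tau>0 \<sigma>0 pick \<tau> \<sigma> x y ybar \<longleftrightarrow>
    x 0 = x0 \<and> y 0 = y0 \<and> ybar 0 = y0 \<and> \<tau> 0 = \<tau>0 \<and> \<sigma> 0 = \<sigma>0 \<and>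
    (\<forall>k.
      (\<tau> (Suc k), \<sigma> (Suc k)) =
        rule k (restrict \<tau> {..k}) (restrict \<sigma> {..k}) (restrict x {..k}) (restrict y {..k}) \<and>
      x (Suc k) =
        prox UNIV (\<lambda>u. ereal (\<tau> (Suc k)) * g u)
          (x k - \<tau> (Suc k) *\<^sub>R stacked_adjoint A (ybar k)) \<and>
      (\<forall>i. y (Suc k) $ i =
        (if i = pick k
         then prox (Y i) (\<lambda>v. ereal (\<sigma> (Suc k) i) * fenchel_conjugate (Y i) (f i) v)
                (y k $ i + \<sigma> (Suc k) i *\<^sub>R A i (x (Suc k)))
         else y k $ i)) \<and>
      (\<forall>i. ybar (Suc k) $ i =
        (if i = pick k
         then y (Suc k) $ i + (1 / p i) *\<^sub>R (y (Suc k) $ i - y k $ i)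
         else y k $ i)))"

definition serial_sampling ::
  "'w measure \<Rightarrow> ('n::finite \<Rightarrow> real) \<Rightarrow> (nat \<Rightarrow> 'w \<Rightarrow> 'n) \<Rightarrow> bool" where
  "serial_sampling M p pick \<longleftrightarrow>
    prob_space.indep_vars M (\<lambda>_. count_space UNIV) pick UNIV \<and>
    (\<forall>k i. measure M {\<omega> \<in> space M. pick k \<omega> = i} = p i)"

definition natural_filtration ::
  "'w measure \<Rightarrow> (nat \<Rightarrow> 'w \<Rightarrow> 'z::topological_space) \<Rightarrow> nat \<Rightarrow> 'w measure" where
  "natural_filtration M z k =
    sigma (space M) (\<Union>l\<in>{..k}. {z l -` B \<inter> space M | B. B \<in> sets borel})"

definition adapted_seq :: "(nat \<Rightarrow> 'w measure) \<Rightarrow> (nat \<Rightarrow> 'w \<Rightarrow> real) \<Rightarrow> bool" where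
  "adapted_seq F u \<longleftrightarrow> (\<forall>k. u k \<in> borel_measurable (F k))"

definition as_quasi_increasing :: "'w measure \<Rightarrow> (nat \<Rightarrow> 'w \<Rightarrow> real) \<Rightarrow> bool" where
  "as_quasi_increasing M u \<longleftrightarrow>
    (\<forall>k. u k \<in> borel_measurable M) \<and> (AE \<omega> in M. \<forall>k. 0 < u k \<omega>) \<and>
    (\<exists>\<eta>::nat \<Rightarrow> real. (\<forall>k. \<eta> k \<in> {0..<1}) \<and> summable \<eta> \<and>
      (AE \<omega> in M. \<forall>k. (1 - \<eta> k) * u k \<omega> \<le> u (Suc k) \<omega>))"

end

theory Submission
  imports Defs "HOL-Library.Diagonal_Subsequence"
begin

text \<open>
  A realisation is a function of the sampled indices, so at time \<open>k\<close> everything takes finitely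
  many values and independence turns conditional expectations given the past into finite sums over
  the next index. For a saddle point \<open>z\<close> the weighted squared distance to \<open>z\<close>, corrected by
  the coupling with the last dual increment, is a nonnegative supermartingale up to summable factors
  that come from the quasi-monotone step-sizes; the step-size condition makes the coupling
  term absorbable. Hence almost surely this quantity converges and the increments vanish.
  Applied to a countable dense set of saddle points, and combined with the fact that weak cluster
  points are saddle points (Minty's argument), this allows Opial's argument in the limiting metric.
\<close>

section \<open>Proximal points and subdifferentials\<close>

text \<open>Serial sampling moves one dual block per step, so the coupling term has a single nonzero
  summand, and the step-size bound controls it by \<open>sqrt \<beta>\<close> times the squares of
  the primal distance and of the last dual increment. The distance to \<open>z\<close> does not
  contain that increment, so its square is added with a weight \<open>\<kappa>\<close>. A new
  increment is paid for by the unit coefficient in the dual prox inequality, which leaves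
  \<open>1 - \<kappa>\<close>; an old one must absorb the coupling, which leaves
  \<open>\<kappa> - sqrt \<beta>\<close>. The midpoint makes both equal to \<open>\<delta>\<close>.

  Opial's argument is run in one fixed metric, hence needs positive limits of the weights.
  Quasi-monotonicity makes \<open>1 / \<tau>\<close> and \<open>1 / \<sigma> i\<close> converge, but
  possibly to 0. The step-size condition keeps the product of the two away from 0 only if
  \<open>A i\<close> is nonzero; a step-size that no operator couples to the others may grow without
  bound. Its prox inequality then has no coupling term and may be multiplied by any positive factor,
  so its weight can be set to 1.\<close>

lemma lsc_onD:
  assumes "lsc_on S h" "u \<in> S" "c < h u"
  shows "\<forall>\<^sub>F v in nhds u. v \<in> S \<longrightarrow> c < h v"
proof -
  have "\<forall>\<^sub>F v in at u within S. c < h v"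
    using assms unfolding lsc_on_def le_Liminf_iff by blast
  \<comment> \<open>The limit inferior runs over a punctured neighbourhood; the point
    \<open>u\<close> itself is covered by \<open>c < h u\<close>.\<close>
  then show ?thesis
    using assms(3) by (auto simp: eventually_at_filter elim!: eventually_mono)
qed

lemma lsc_onI:
  assumes "\<And>u c. u \<in> S \<Longrightarrow> c < h u \<Longrightarrow> \<forall>\<^sub>F v in nhds u. v \<in> S \<longrightarrow> c < h v"
  shows "lsc_on S h"
  unfolding lsc_on_def le_Liminf_iff eventually_at_filter
  by (intro ballI allI impI eventually_mono[OF assms]) auto

lemma ereal_convex_onD:
  assumes "ereal_convex_on S h" "u \<in> S" "v \<in> S" "0 < t" "t < 1" "h u = ereal a" "h v = ereal b"
  shows "h ((1 - t) *\<^sub>R u + t *\<^sub>R v) \<le> ereal ((1 - t) * a + t * b)"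
  using assms unfolding ereal_convex_on_def by fastforce

text \<open>Near a point \<open>w\<close> of finite value, lower semicontinuity bounds
  \<open>h\<close> below by \<open>c - 1\<close>. A far point is pulled back along the segment
  towards \<open>w\<close> into this ball, and convexity turns the bound there into one that
  decreases at most linearly with the distance. The quadratic term of the prox objective dominates
  such a decrease.\<close>

lemma convex_lsc_lower_growth:
  fixes S :: "'a::real_normed_vector set"
  assumes S: "convex S"
    and h: "proper_on S h" "ereal_convex_on S h" "lsc_on S h"
  obtains a b where "0 \<le> b" "\<And>v. v \<in> S \<Longrightarrow> ereal (a - b * norm (v - u)) \<le> h v"
proof -
  obtain w where w: "w \<in> S" "h w \<noteq> \<infinity>" "h w \<noteq> -\<infinity>"
    using h(1) unfolding proper_on_def by blast
  then obtain c where c: "h w = ereal c"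
    by (cases "h w") auto
  have "ereal (c - 1) < h w" by (simp add: c)
  from lsc_onD[OF h(3) w(1) this] obtain r where r: "0 < r"
      and ball: "\<And>v. dist v w < r \<Longrightarrow> v \<in> S \<Longrightarrow> ereal (c - 1) < h v"
    unfolding eventually_nhds_metric by blast
  have far: "ereal (c - 1 - 2 / r * norm (v - w)) \<le> h v" if v: "v \<in> S" for v
  proof (cases "dist v w < r")
    case True
    then show ?thesis
      using ball[OF True v] r by (intro order.trans[OF _ less_imp_le[OF ball[OF True v]]]) simp
  next
    case False
    then have d: "norm (v - w) \<ge> r" by (simp add: dist_norm)
    \<comment> \<open>This \<open>t\<close> puts the point \<open>z\<close> of the segment at
      distance \<open>r / 2\<close> from \<open>w\<close>, inside the ball.\<close>
    define t where "t = r / (2 * norm (v - w))"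
    have pos: "0 < norm (v - w)" using d r by linarith
    then have t: "0 < t" "t < 1" using d r by (auto simp del: zero_less_norm_iff simp: t_def field_simps)
    define z where "z = (1 - t) *\<^sub>R w + t *\<^sub>R v"
    have "z - w = t *\<^sub>R (v - w)" by (simp add: z_def algebra_simps)
    then have "dist z w = r / 2"
      using pos r by (auto simp: dist_norm t_def)
    moreover have "z \<in> S"
      unfolding z_def using S w(1) v t by (intro convexD_alt) auto
    ultimately have z: "ereal (c - 1) < h z" using ball r by simp
    show ?thesis
    proof (cases "h v")
      case (real b)
      have "ereal (c - 1) < ereal ((1 - t) * c + t * b)"
        using z ereal_convex_onD[OF h(2) w(1) v t c real] unfolding z_def by (rule order.strict_trans2)
      then have "t * (c - b) < 1" by (simp add: algebra_simps)
      then have "c - b < 1 / t" using t by (simp add: field_simps)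
      also have "1 / t = 2 / r * norm (v - w)" by (simp add: t_def)
      finally show ?thesis by (simp add: real)
    next
      case MInf
      then show ?thesis using h(1) v by (auto simp: proper_on_def)
    qed simp
  qed
  show thesis
  proof (rule that)
    show "0 \<le> 2 / r" using r by simp
    show "ereal ((c - 1 - 2 / r * norm (u - w)) - 2 / r * norm (v - u)) \<le> h v" if "v \<in> S" for v
    proof (rule order.trans[OF _ far[OF that]])
      have "2 / r * norm (v - w) \<le> 2 / r * (norm (v - u) + norm (u - w))"
        using r norm_triangle_ineq[of "v - u" "u - w"] by (intro mult_left_mono) auto
      then show "ereal (c - 1 - 2 / r * norm (u - w) - 2 / r * norm (v - u))
        \<le> ereal (c - 1 - 2 / r * norm (v - w))" by (simp add: algebra_simps)
    qed
  qed
qed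

lemma parallelogram_identity:
  fixes a b :: "'a::real_inner"
  shows "(norm (a + b))\<^sup>2 + (norm (a - b))\<^sup>2 = 2 * (norm a)\<^sup>2 + 2 * (norm b)\<^sup>2"
  by (simp add: power2_norm_eq_inner inner_add inner_diff inner_commute)

text \<open>Direct method: the quadratic term makes the objective strongly convex, so a minimizing
  sequence is Cauchy in norm, and lower semicontinuity passes to its limit.\<close>

lemma prox_objective_minimizer:
  fixes S :: "'a::{real_inner, complete_space} set" and h :: "'a \<Rightarrow> ereal"
  assumes S: "convex S" "closed S"
    and h: "proper_on S h" "ereal_convex_on S h" "lsc_on S h"
  obtains q where "is_arg_min (\<lambda>v. ereal (1 / 2 * (norm (v - u))\<^sup>2) + h v) (\<lambda>v. v \<in> S) q"
proof -
  define dom where "dom = {v \<in> S. h v \<noteq> \<infinity>}"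
  define H where "H v = real_of_ereal (h v)" for v
  have hH: "h v = ereal (H v)" if "v \<in> dom" for v
    using that h(1) by (auto simp: dom_def H_def proper_on_def ereal_real)
  define \<phi> where "\<phi> v = 1 / 2 * (norm (v - u))\<^sup>2 + H v" for v
  obtain a b where b: "0 \<le> b" and growth: "\<And>v. v \<in> S \<Longrightarrow> ereal (a - b * norm (v - u)) \<le> h v"
    using convex_lsc_lower_growth[OF S(1) h] by blast
  \<comment> \<open>Completing the square in \<open>norm (v - u)\<close> absorbs the linear decrease
    of \<open>h\<close>.\<close>
  have "a - b\<^sup>2 / 2 \<le> \<phi> v" if "v \<in> dom" for v
  proof -
    have "a - b * norm (v - u) \<le> H v"
      using growth[of v] hH[OF that] that by (simp add: dom_def)
    moreover have "0 \<le> (norm (v - u) - b)\<^sup>2" by simp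
    ultimately show ?thesis by (simp add: \<phi>_def power2_diff algebra_simps)
  qed
  then have bdd: "bdd_below (\<phi> ` dom)" by (intro bdd_belowI2)
  have ne: "dom \<noteq> {}" using h(1) by (auto simp: dom_def proper_on_def)
  define m where "m = Inf (\<phi> ` dom)"
  have m: "m \<le> \<phi> v" if "v \<in> dom" for v
    unfolding m_def using bdd that by (rule cINF_lower)
  have "\<exists>v\<in>dom. \<phi> v < m + 1 / Suc n" for n
    using cINF_less_iff[OF ne bdd, of "m + 1 / Suc n"] by (simp add: m_def)
  then obtain v where v: "\<And>n. v n \<in> dom" "\<And>n. \<phi> (v n) < m + 1 / Suc n"
    by metis
  \<comment> \<open>The midpoint \<open>z\<close> has value at least \<open>m\<close>; the
    parallelogram identity turns this into a bound on the distance by the excesses over the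
    infimum.\<close>
  have par: "(norm (x - y))\<^sup>2 \<le> 4 * ((\<phi> x - m) + (\<phi> y - m))" if "x \<in> dom" "y \<in> dom" for x y
  proof -
    define z where "z = (1 - 1 / 2) *\<^sub>R x + (1 / 2 :: real) *\<^sub>R y"
    have hz: "h z \<le> ereal ((1 - 1 / 2) * H x + 1 / 2 * H y)"
      unfolding z_def using that
      by (intro ereal_convex_onD[OF h(2) _ _ _ _ hH hH]) (simp_all add: dom_def)
    have zS: "z \<in> S" unfolding z_def using S(1) that by (intro convexD_alt) (auto simp: dom_def)
    have "h z \<noteq> \<infinity>" using hz by auto
    then have z: "z \<in> dom" using zS by (simp add: dom_def)
    have "H z \<le> (H x + H y) / 2" using hz hH[OF z] by simp
    moreover have "4 * (norm (z - u))\<^sup>2 + (norm (x - y))\<^sup>2 = 2 * (norm (x - u))\<^sup>2 + 2 * (norm (y - u))\<^sup>2"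
    proof -
      have "(x - u) + (y - u) = 2 *\<^sub>R (z - u)" by (simp add: z_def algebra_simps scaleR_2)
      moreover have "(x - u) - (y - u) = x - y" by simp
      ultimately show ?thesis
        using parallelogram_identity[of "x - u" "y - u"] by (simp add: power_mult_distrib)
    qed
    moreover have "m \<le> \<phi> z" using m[OF z] .
    ultimately show ?thesis unfolding \<phi>_def by argo
  qed
  have "Cauchy v"
  proof (rule metric_CauchyI)
    fix e :: real assume e: "0 < e"
    obtain N where N: "1 / real (Suc N) < e\<^sup>2 / 8"
      using nat_approx_posE[of "e\<^sup>2 / 8"] e by auto
    have "dist (v i) (v j) < e" if ij: "i \<ge> N" "j \<ge> N" for i j
    proof -
      have "1 / real (Suc i) \<le> 1 / real (Suc N)" "1 / real (Suc j) \<le> 1 / real (Suc N)"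
        using ij by (auto simp: field_simps)
      then have "4 * ((\<phi> (v i) - m) + (\<phi> (v j) - m)) < e\<^sup>2"
        using v(2)[of i] v(2)[of j] N by argo
      then have "(dist (v i) (v j))\<^sup>2 < e\<^sup>2"
        using par[OF v(1) v(1), of i j] by (simp add: dist_norm)
      then show ?thesis using e by (simp add: power_less_imp_less_base)
    qed
    then show "\<exists>M. \<forall>i\<ge>M. \<forall>j\<ge>M. dist (v i) (v j) < e" by blast
  qed
  then obtain q where q: "v \<longlonglongrightarrow> q" using Cauchy_convergent convergent_def by blast
  have qS: "q \<in> S"
    using closed_sequentially[OF S(2) _ q] v(1) by (auto simp: dom_def)
  have le: "ereal (1 / 2 * (norm (q - u))\<^sup>2) + h q \<le> ereal m"
  proof -
    have "h q \<le> ereal (m - 1 / 2 * (norm (q - u))\<^sup>2)"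
    \<comment> \<open>\<open>h q\<close> is not yet known to be finite, so it is approached through
      levels \<open>c\<close> below it.\<close>
    proof (rule dense_le)
      fix c :: ereal assume c: "c < h q"
      show "c \<le> ereal (m - 1 / 2 * (norm (q - u))\<^sup>2)"
      proof (cases c)
        case (real d)
        have "\<forall>\<^sub>F n in sequentially. v n \<in> S \<longrightarrow> c < h (v n)"
          using lsc_onD[OF h(3) qS c] q unfolding filterlim_iff by blast
        then have ev: "\<forall>\<^sub>F n in sequentially. 1 / 2 * (norm (v n - u))\<^sup>2 + d \<le> m + 1 / Suc n"
        proof (rule eventually_mono)
          fix n assume "v n \<in> S \<longrightarrow> c < h (v n)"
          then have "d < H (v n)" using v(1)[of n] hH[OF v(1)[of n]] by (simp add: dom_def real)
          then show "1 / 2 * (norm (v n - u))\<^sup>2 + d \<le> m + 1 / Suc n"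
            using v(2)[of n] unfolding \<phi>_def by linarith
        qed
        have l1: "(\<lambda>n. 1 / 2 * (norm (v n - u))\<^sup>2 + d) \<longlonglongrightarrow> 1 / 2 * (norm (q - u))\<^sup>2 + d"
          by (intro tendsto_intros q)
        have l2: "(\<lambda>n. m + 1 / Suc n) \<longlonglongrightarrow> m + 0"
          by (intro tendsto_intros LIMSEQ_Suc[OF lim_1_over_n])
        have "1 / 2 * (norm (q - u))\<^sup>2 + d \<le> m + 0"
          by (rule tendsto_le[OF _ l2 l1 ev]) simp
        then show ?thesis by (simp add: real)
      qed (use c in auto)
    qed
    then have "ereal (1 / 2 * (norm (q - u))\<^sup>2) + h q \<le>
        ereal (1 / 2 * (norm (q - u))\<^sup>2) + ereal (m - 1 / 2 * (norm (q - u))\<^sup>2)"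
      by (rule add_left_mono)
    then show ?thesis by simp
  qed
  have "ereal m \<le> ereal (1 / 2 * (norm (w - u))\<^sup>2) + h w" if w: "w \<in> S" for w
  proof (cases "w \<in> dom")
    case True
    then show ?thesis using m[OF True] hH[OF True] by (simp add: \<phi>_def)
  next
    case False
    then show ?thesis using w by (simp add: dom_def)
  qed
  then have "is_arg_min (\<lambda>v. ereal (1 / 2 * (norm (v - u))\<^sup>2) + h v) (\<lambda>v. v \<in> S) q"
    using qS le unfolding is_arg_min_def by (meson leD order.trans)
  then show thesis by (rule that)
qed

text \<open>First-order condition: the objective at \<open>q\<close> is compared with its value at a
  point of the segment from \<open>q\<close> to \<open>v\<close>, at parameter \<open>s\<close>; the
  difference is divided by \<open>s\<close>, and \<open>s\<close> tends to 0. Existence of a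
  minimizer is what turns the choice made by \<open>ARG_MIN\<close> into one.\<close>

lemma prox_variational:
  fixes S :: "'a::{real_inner, complete_space} set" and h :: "'a \<Rightarrow> ereal"
  assumes S: "convex S" "closed S"
    and h: "proper_on S h" "ereal_convex_on S h" "lsc_on S h"
  shows "prox S h u \<in> S" "\<bar>h (prox S h u)\<bar> \<noteq> \<infinity>"
    "v \<in> S \<Longrightarrow> h (prox S h u) + ereal (inner (u - prox S h u) (v - prox S h u)) \<le> h v"
proof -
  let ?\<phi> = "\<lambda>v. ereal (1 / 2 * (norm (v - u))\<^sup>2) + h v"
  define q where "q = prox S h u"
  obtain q' where "is_arg_min ?\<phi> (\<lambda>v. v \<in> S) q'"
    using prox_objective_minimizer[OF S h] .
  then have q: "is_arg_min ?\<phi> (\<lambda>v. v \<in> S) q"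
    unfolding q_def prox_def arg_min_def by (rule someI)
  then show qS: "prox S h u \<in> S" by (simp add: is_arg_min_def q_def)
  have min: "?\<phi> q \<le> ?\<phi> w" if "w \<in> S" for w
    using q that unfolding is_arg_min_def by (meson not_le)
  obtain w where w: "w \<in> S" "h w \<noteq> \<infinity>" using h(1) unfolding proper_on_def by blast
  have "h q \<noteq> \<infinity>" using min[OF w(1)] w(2) by auto
  moreover have "h q \<noteq> -\<infinity>" using h(1) qS by (auto simp: proper_on_def q_def)
  ultimately show "\<bar>h (prox S h u)\<bar> \<noteq> \<infinity>" by (auto simp: q_def)
  then obtain c where c: "h q = ereal c" by (auto simp: q_def)
  show "h (prox S h u) + ereal (inner (u - prox S h u) (v - prox S h u)) \<le> h v" if v: "v \<in> S"
  proof (cases "h v")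
    case (real b)
    \<comment> \<open>The right-hand side is the second-order part of the squared norm, after
      division by \<open>s\<close>.\<close>
    have le: "c - b + inner (u - q) (v - q) \<le> s / 2 * (norm (v - q))\<^sup>2" if s: "0 < s" "s < 1" for s
    proof -
      have "(1 - s) *\<^sub>R q + s *\<^sub>R v \<in> S"
        using S(1) qS v s by (intro convexD_alt) (auto simp: q_def)
      note min[OF this]
      also have "?\<phi> ((1 - s) *\<^sub>R q + s *\<^sub>R v)
          \<le> ereal (1 / 2 * (norm ((1 - s) *\<^sub>R q + s *\<^sub>R v - u))\<^sup>2) + ereal ((1 - s) * c + s * b)"
        by (intro add_left_mono ereal_convex_onD[OF h(2)]) (use qS v s c real in \<open>auto simp: q_def\<close>)
      finally have *: "1 / 2 * (norm (q - u))\<^sup>2 + c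
          \<le> 1 / 2 * (norm ((1 - s) *\<^sub>R q + s *\<^sub>R v - u))\<^sup>2 + ((1 - s) * c + s * b)"
        by (simp add: c)
      have "(1 - s) *\<^sub>R q + s *\<^sub>R v - u = (q - u) + s *\<^sub>R (v - q)"
        by (simp add: algebra_simps)
      then have "(norm ((1 - s) *\<^sub>R q + s *\<^sub>R v - u))\<^sup>2
          = (norm (q - u))\<^sup>2 + 2 * s * inner (q - u) (v - q) + s\<^sup>2 * (norm (v - q))\<^sup>2"
        by (simp only: power2_norm_eq_inner)
          (simp add: inner_add inner_commute power2_eq_square)
      moreover have "inner (q - u) (v - q) = - inner (u - q) (v - q)"
        by (simp add: inner_diff_left)
      ultimately have "s * (c - b + inner (u - q) (v - q)) \<le> s * (s / 2 * (norm (v - q))\<^sup>2)"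
        using * by (simp add: algebra_simps power2_eq_square)
      then show ?thesis using s(1) by (simp only: mult_le_cancel_left_pos)
    qed
    have "c - b + inner (u - q) (v - q) \<le> 0 / 2 * (norm (v - q))\<^sup>2"
    proof (rule tendsto_le[where F = "at_right (0::real)"])
      show "((\<lambda>s. s / 2 * (norm (v - q))\<^sup>2) \<longlongrightarrow> 0 / 2 * (norm (v - q))\<^sup>2) (at_right 0)"
        by (intro tendsto_intros) simp
      show "((\<lambda>s. c - b + inner (u - q) (v - q)) \<longlongrightarrow> c - b + inner (u - q) (v - q)) (at_right 0)"
        by simp
      show "\<forall>\<^sub>F s in at_right 0. c - b + inner (u - q) (v - q) \<le> s / 2 * (norm (v - q))\<^sup>2"
        unfolding eventually_at_right_field using le by (intro exI[of _ 1]) auto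
    qed simp
    then show ?thesis using c real by (simp add: q_def)
  next
    case MInf
    then show ?thesis using h(1) v by (auto simp: proper_on_def)
  qed simp
qed

lemma ereal_cmult_proper_convex_lsc:
  assumes t: "0 < t" and h: "proper_on S h" "ereal_convex_on S h" "lsc_on S h"
  shows "proper_on S (\<lambda>u. ereal t * h u)" "ereal_convex_on S (\<lambda>u. ereal t * h u)"
    "lsc_on S (\<lambda>u. ereal t * h u)"
proof -
  show "proper_on S (\<lambda>u. ereal t * h u)"
    using h(1) t unfolding proper_on_def by (auto simp: ereal_mult_eq_MInfty ereal_mult_eq_PInfty)
  show "ereal_convex_on S (\<lambda>u. ereal t * h u)"
    unfolding ereal_convex_on_def
  proof (intro ballI)
    fix u v s assume uv: "u \<in> S" "v \<in> S" "s \<in> {0<..<1::real}"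
    then have nm: "h u \<noteq> -\<infinity>" "h v \<noteq> -\<infinity>" using h(1) by (auto simp: proper_on_def)
    have "h ((1 - s) *\<^sub>R u + s *\<^sub>R v) \<le> ereal (1 - s) * h u + ereal s * h v"
      using h(2) uv unfolding ereal_convex_on_def by blast
    then have "ereal t * h ((1 - s) *\<^sub>R u + s *\<^sub>R v) \<le> ereal t * (ereal (1 - s) * h u + ereal s * h v)"
      using t by (intro ereal_mult_left_mono) auto
    also have "\<dots> = ereal (1 - s) * (ereal t * h u) + ereal s * (ereal t * h v)"
      using nm uv t by (cases "h u"; cases "h v") (auto simp: algebra_simps)
    finally show "ereal t * h ((1 - s) *\<^sub>R u + s *\<^sub>R v)
      \<le> ereal (1 - s) * (ereal t * h u) + ereal s * (ereal t * h v)" .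
  qed
  show "lsc_on S (\<lambda>u. ereal t * h u)"
  proof (rule lsc_onI)
    have iff: "c < ereal t * z \<longleftrightarrow> c / ereal t < z" for c z
      using t by (subst ereal_divide_less_iff) (auto simp: mult.commute)
    fix u c assume "u \<in> S" "c < ereal t * h u"
    then show "\<forall>\<^sub>F v in nhds u. v \<in> S \<longrightarrow> c < ereal t * h v"
      unfolding iff by (intro lsc_onD[OF h(3)])
  qed
qed

text \<open>This is \<open>prox_variational\<close> for the scaled function, divided by
  \<open>t\<close>. The subspace structure puts the vector in \<open>S\<close>, as
  \<open>subdifferential\<close> demands of its elements.\<close>

lemma prox_subdifferential:
  fixes S :: "'a::{real_inner, complete_space} set" and h :: "'a \<Rightarrow> ereal"
  assumes S: "subspace S" "closed S"
    and h: "proper_on S h" "ereal_convex_on S h" "lsc_on S h"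
    and t: "0 < t" and u: "u \<in> S"
  defines "q \<equiv> prox S (\<lambda>v. ereal t * h v) u"
  shows "q \<in> S" "(1 / t) *\<^sub>R (u - q) \<in> subdifferential S h q"
proof -
  note th = ereal_cmult_proper_convex_lsc[OF t h]
  note P = prox_variational[OF subspace_imp_convex[OF S(1)] S(2) th, where u = u, folded q_def]
  show qS: "q \<in> S" by (rule P(1))
  obtain c where c: "h q = ereal c"
    using P(2) t by (cases "h q") auto
  have "h q + ereal (inner ((1 / t) *\<^sub>R (u - q)) (v - q)) \<le> h v" if v: "v \<in> S" for v
  proof (cases "h v")
    case (real b)
    show ?thesis
    proof -
      have "t * (c + inner (u - q) (v - q) / t) \<le> t * b"
        using P(3)[OF v] t by (simp add: c real distrib_left)
      then have "c + inner (u - q) (v - q) / t \<le> b"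
        using t by (simp only: mult_le_cancel_left_pos)
      then show ?thesis by (simp add: c real)
    qed
  next
    case MInf
    then show ?thesis using h(1) v by (auto simp: proper_on_def)
  qed simp
  then show "(1 / t) *\<^sub>R (u - q) \<in> subdifferential S h q"
    unfolding subdifferential_def using S(1) u qS by (auto intro: subspace_diff subspace_scale)
qed

lemma subdifferential_mono:
  assumes h: "proper_on S h" and q: "q1 \<in> S" "q2 \<in> S"
    and w: "w1 \<in> subdifferential S h q1" "w2 \<in> subdifferential S h q2"
  shows "0 \<le> inner (w1 - w2) (q1 - q2)"
proof -
  obtain z where z: "z \<in> S" "h z \<noteq> \<infinity>" using h unfolding proper_on_def by blast
  \<comment> \<open>A point with a subgradient has a finite value, by comparison with
    \<open>z\<close>; only then may the two subgradient inequalities be added and cancelled.\<close>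
  have fin: "\<bar>h q\<bar> \<noteq> \<infinity>" if "q \<in> S" "w \<in> subdifferential S h q" for q w
    using that z h unfolding subdifferential_def proper_on_def by (cases "h q") force+
  obtain a b where ab: "h q1 = ereal a" "h q2 = ereal b"
    using fin[OF q(1) w(1)] fin[OF q(2) w(2)] by auto
  have "h q1 + ereal (inner w1 (q2 - q1)) \<le> h q2" "h q2 + ereal (inner w2 (q1 - q2)) \<le> h q1"
    using q w unfolding subdifferential_def by auto
  then show ?thesis by (simp add: ab inner_diff_left inner_diff_right)
qed

text \<open>Convexity and lower semicontinuity are inherited from the affine functions under the
  supremum. A finite value amounts to an affine minorant of \<open>h\<close>, and any subgradient
  provides one; the proximal point of 0 has a subgradient.\<close>

lemma fenchel_conjugate_proper_convex_lsc:
  fixes S :: "'a::{real_inner, complete_space} set" and h :: "'a \<Rightarrow> ereal"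
  assumes S: "subspace S" "closed S"
    and h: "proper_on S h" "ereal_convex_on S h" "lsc_on S h"
  shows "proper_on S (fenchel_conjugate S h)" "ereal_convex_on S (fenchel_conjugate S h)"
    "lsc_on S (fenchel_conjugate S h)"
proof -
  let ?F = "fenchel_conjugate S h"
  have nm: "h u \<noteq> -\<infinity>" if "u \<in> S" for u using h(1) that by (simp add: proper_on_def)
  obtain z where z: "z \<in> S" "h z \<noteq> \<infinity>" using h(1) unfolding proper_on_def by blast
  have "?F w \<noteq> -\<infinity>" for w
  proof -
    have "ereal (inner z w) - h z \<le> ?F w"
      unfolding fenchel_conjugate_def using z(1) by (intro SUP_upper)
    then show ?thesis using z nm[OF z(1)] by (cases "h z") auto
  qed
  \<comment> \<open>Conjugation at a subgradient \<open>w\<close> of \<open>h\<close> at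
    \<open>q\<close>: the supremum does not exceed its term at \<open>q\<close>.\<close>
  moreover have "\<exists>w\<in>S. ?F w \<noteq> \<infinity>"
  proof -
    define q where "q = prox S (\<lambda>v. ereal 1 * h v) 0"
    note P = prox_subdifferential[OF S h zero_less_one subspace_0[OF S(1)], folded q_def]
    define w where "w = (1 / 1) *\<^sub>R (0 - q)"
    have w: "w \<in> S" "\<And>v. v \<in> S \<Longrightarrow> h q + ereal (inner w (v - q)) \<le> h v"
      using P(2) by (auto simp: subdifferential_def w_def)
    have "h q \<noteq> \<infinity>" using w(2)[OF z(1)] z(2) by auto
    then obtain c where c: "h q = ereal c" using nm[OF P(1)] by (cases "h q") auto
    have "?F w \<le> ereal (inner w q - c)"
      unfolding fenchel_conjugate_def
    proof (rule SUP_least)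
      fix v assume v: "v \<in> S"
      show "ereal (inner v w) - h v \<le> ereal (inner w q - c)"
        using w(2)[OF v] nm[OF v] c
        by (cases "h v") (auto simp: inner_diff_right inner_commute algebra_simps)
    qed
    then show ?thesis using w(1) by (intro bexI[of _ w]) auto
  qed
  ultimately show "proper_on S ?F" unfolding proper_on_def by blast
  show "ereal_convex_on S ?F"
    unfolding ereal_convex_on_def
  proof (intro ballI)
    fix u v t assume uv: "u \<in> S" "v \<in> S" "t \<in> {0<..<1::real}"
    show "?F ((1 - t) *\<^sub>R u + t *\<^sub>R v) \<le> ereal (1 - t) * ?F u + ereal t * ?F v"
      unfolding fenchel_conjugate_def[of S h "_ + _"]
    proof (rule SUP_least)
      fix w assume w: "w \<in> S"
      have *: "ereal (inner w x) - h w \<le> ?F x" for x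
        unfolding fenchel_conjugate_def using w by (intro SUP_upper)
      have "ereal (inner w ((1 - t) *\<^sub>R u + t *\<^sub>R v)) - h w
          = ereal (1 - t) * (ereal (inner w u) - h w) + ereal t * (ereal (inner w v) - h w)"
        using uv nm[OF w] by (cases "h w") (auto simp: inner_add_right algebra_simps)
      also have "\<dots> \<le> ereal (1 - t) * ?F u + ereal t * ?F v"
        using uv by (intro add_mono ereal_mult_left_mono *) auto
      finally show "ereal (inner w ((1 - t) *\<^sub>R u + t *\<^sub>R v)) - h w
        \<le> ereal (1 - t) * ?F u + ereal t * ?F v" .
    qed
  qed
  show "lsc_on S ?F"
  proof (rule lsc_onI)
    fix u c assume "u \<in> S" "c < ?F u"
    then obtain w where w: "w \<in> S" "c < ereal (inner w u) - h w"
      unfolding fenchel_conjugate_def less_SUP_iff by blast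
    have le: "ereal (inner w v) - h w \<le> ?F v" for v
      unfolding fenchel_conjugate_def using w(1) by (intro SUP_upper)
    have "((\<lambda>v. ereal (inner w v) - h w) \<longlongrightarrow> ereal (inner w u) - h w) (nhds u)"
    proof (cases "h w")
      case (real b)
      have "((\<lambda>v. inner w v - b) \<longlongrightarrow> inner w u - b) (nhds u)"
        by (intro tendsto_intros filterlim_ident)
      then show ?thesis by (simp add: real)
    qed (use w nm in auto)
    then have "\<forall>\<^sub>F v in nhds u. c < ereal (inner w v) - h w"
      using w(2) by (rule order_tendstoD)
    then show "\<forall>\<^sub>F v in nhds u. v \<in> S \<longrightarrow> c < ?F v"
      by (rule eventually_mono) (use le in \<open>auto intro: order.strict_trans2\<close>)
  qed
qed

section \<open>Weak convergence\<close>

text \<open>The representing vector is the proximal point at 0 of the functional \<open>- \<phi>\<close>.\<close>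

lemma riesz_representation:
  fixes \<phi> :: "'a::{real_inner, complete_space} \<Rightarrow> real"
  assumes "bounded_linear \<phi>"
  obtains w where "\<And>v. \<phi> v = inner v w"
proof -
  interpret \<phi>: bounded_linear \<phi> by fact
  define h where "h v = ereal (- \<phi> v)" for v
  have 1: "proper_on UNIV h" by (auto simp: proper_on_def h_def)
  have 2: "ereal_convex_on UNIV h"
    by (auto simp: ereal_convex_on_def h_def \<phi>.add \<phi>.diff \<phi>.scaleR algebra_simps)
  have 3: "lsc_on UNIV h"
  proof (rule lsc_onI)
    fix u c assume "c < h u"
    moreover have "(h \<longlongrightarrow> h u) (nhds u)"
      unfolding h_def by (intro tendsto_intros \<phi>.tendsto filterlim_ident)
    ultimately show "\<forall>\<^sub>F v in nhds u. v \<in> UNIV \<longrightarrow> c < h v"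
      by (auto intro: order_tendstoD)
  qed
  define q where "q = prox UNIV h 0"
  have le: "\<phi> v \<le> inner v q" for v
  proof -
    have "h q + ereal (inner (0 - q) ((q + v) - q)) \<le> h (q + v)"
      unfolding q_def by (rule prox_variational(3)[OF _ _ 1 2 3]) auto
    then show ?thesis by (simp add: h_def \<phi>.add inner_commute)
  qed
  show thesis
  proof (rule that)
    show "\<phi> v = inner v q" for v
      using le[of v] le[of "- v"] by (simp add: \<phi>.neg)
  qed
qed

text \<open>\<open>adjoint\<close> is a choice of an operator with this property, so it suffices
  that some operator has it; Riesz supplies the values pointwise.\<close>

lemma adjoint_works_hilbert:
  fixes B :: "'a::{real_inner, complete_space} \<Rightarrow> 'b::real_inner"
  assumes "bounded_linear B"
  shows "inner (B x) y = inner x (adjoint B y)"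
proof -
  have "\<exists>w. \<forall>x. inner (B x) y = inner x w" for y
  proof -
    have "bounded_linear (\<lambda>x. inner (B x) y)"
      using assms by (rule bounded_linear_compose[OF bounded_linear_inner_left])
    from riesz_representation[OF this] show ?thesis by metis
  qed
  then have "\<exists>B'. \<forall>x y. inner (B x) y = inner x (B' y)" by metis
  then have "\<forall>x y. inner (B x) y = inner x (adjoint B y)" unfolding adjoint_def by (rule someI_ex)
  then show ?thesis by blast
qed

text \<open>The prox of the zero function projects \<open>l\<close> onto \<open>S\<close>. The
  residual \<open>l - q\<close> is orthogonal to \<open>S\<close>, hence to all \<open>z k\<close>,
  and testing the weak limit with it forces it to vanish.\<close>

lemma weak_limit_in_closed_subspace:
  fixes S :: "'a::{real_inner, complete_space} set"
  assumes S: "subspace S" "closed S" and z: "\<And>k. z k \<in> S" and lim: "weakly_convergent_to z l"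
  shows "l \<in> S"
proof -
  define h :: "'a \<Rightarrow> ereal" where "h v = 0" for v
  have h: "proper_on S h" "ereal_convex_on S h" "lsc_on S h"
    using subspace_0[OF S(1)] by (auto simp: proper_on_def ereal_convex_on_def h_def intro!: lsc_onI)
  define q where "q = prox S h l"
  note P = prox_variational[OF subspace_imp_convex[OF S(1)] S(2) h, where u = l, folded q_def]
  have le: "inner (l - q) v \<le> 0" if "v \<in> S" for v
    using P(3)[OF subspace_add[OF S(1) P(1) that]] by (simp add: h_def)
  have orth: "inner (l - q) v = 0" if "v \<in> S" for v
    using le[OF that] le[OF subspace_neg[OF S(1) that]] by simp
  have "(\<lambda>k. inner (z k) (l - q)) \<longlonglongrightarrow> inner l (l - q)"
    using lim by (simp add: weakly_convergent_to_def)
  then have "inner (l - q) l = 0"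
    using orth[OF z] by (simp add: inner_commute LIMSEQ_const_iff)
  then have "inner (l - q) (l - q) = 0"
    using orth[OF P(1)] by (simp add: inner_diff_right)
  then show ?thesis using P(1) by simp
qed

text \<open>A three-epsilon argument. It serves twice to extend convergence from a dense set: of
  test vectors in the weak compactness below, and of saddle points in
  \<open>pathwise_convergence\<close>.\<close>

lemma closed_convergent_inner:
  fixes w :: "nat \<Rightarrow> 'a::real_inner"
  assumes w: "bounded (range w)"
  shows "closed {v. convergent (\<lambda>k. inner (w k) v)}"
  unfolding closed_sequential_limits
proof (intro allI impI, elim conjE)
  fix v l assume v: "\<forall>n. v n \<in> {v. convergent (\<lambda>k. inner (w k) v)}" and l: "v \<longlonglongrightarrow> l"
  obtain b where b: "0 < b" "\<And>k. norm (w k) \<le> b"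
    using w unfolding bounded_pos by auto
  have "Cauchy (\<lambda>k. inner (w k) l)"
  proof (rule metric_CauchyI)
    fix e :: real assume e: "0 < e"
    obtain n where n: "norm (v n - l) < e / (3 * b)"
      using LIMSEQ_D[OF l, of "e / (3 * b)"] e b(1) by auto
    have small: "\<bar>inner (w k) (v n - l)\<bar> < e / 3" for k
    proof -
      have "\<bar>inner (w k) (v n - l)\<bar> \<le> norm (w k) * norm (v n - l)" by (rule Cauchy_Schwarz_ineq2)
      also have "\<dots> \<le> b * norm (v n - l)" using b by (intro mult_right_mono) auto
      also have "\<dots> < b * (e / (3 * b))" using n b(1) by (intro mult_strict_left_mono)
      finally show ?thesis using b(1) by simp
    qed
    have "Cauchy (\<lambda>k. inner (w k) (v n))"
      using v by (auto intro: convergent_Cauchy)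
    then obtain N where N: "\<And>i j. i \<ge> N \<Longrightarrow> j \<ge> N \<Longrightarrow> dist (inner (w i) (v n)) (inner (w j) (v n)) < e / 3"
      using metric_CauchyD[of _ "e / 3"] e by (metis zero_less_divide_iff zero_less_numeral)
    have "dist (inner (w i) l) (inner (w j) l) < e" if "i \<ge> N" "j \<ge> N" for i j
      using N[OF that] small[of i] small[of j] unfolding dist_real_def inner_diff_right by linarith
    then show "\<exists>N. \<forall>i\<ge>N. \<forall>j\<ge>N. dist (inner (w i) l) (inner (w j) l) < e" by blast
  qed
  then show "l \<in> {v. convergent (\<lambda>k. inner (w k) v)}" by (simp add: Cauchy_convergent)
qed

text \<open>Sequential weak compactness in a separable space: a diagonal subsequence converges
  against a countable dense set of test vectors, hence against all, and Riesz represents the limit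
  functional.\<close>

lemma bounded_imp_weakly_convergent_subseq:
  fixes w :: "nat \<Rightarrow> 'a::{real_inner, complete_space, second_countable_topology}"
  assumes w: "bounded (range w)"
  obtains r l where "strict_mono r" "weakly_convergent_to (w \<circ> r) l"
proof -
  obtain b where b: "0 < b" "\<And>k. norm (w k) \<le> b"
    using w unfolding bounded_pos by auto
  obtain D :: "'a set" where D: "countable D" "\<And>X. open X \<Longrightarrow> X \<noteq> {} \<Longrightarrow> \<exists>d\<in>D. d \<in> X"
    using countable_dense_setE by blast
  then have "D \<noteq> {}" using open_UNIV by blast
  define d where "d = from_nat_into D"
  have d: "range d = D"
    unfolding d_def using \<open>D \<noteq> {}\<close> D(1) by (rule range_from_nat_into)
  interpret subseqs "\<lambda>n s. convergent (\<lambda>k. inner (w (s k)) (d n))"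
  proof
    fix n and s :: "nat \<Rightarrow> nat"
    have "\<bar>inner (w (s k)) (d n)\<bar> \<le> b * norm (d n)" for k
      using Cauchy_Schwarz_ineq2[of "w (s k)" "d n"] mult_right_mono[OF b(2)[of "s k"] norm_ge_zero[of "d n"]]
      by linarith
    then have "bounded (range (\<lambda>k. inner (w (s k)) (d n)))"
      by (auto intro!: boundedI)
    then obtain c r where r: "strict_mono (r :: nat \<Rightarrow> nat)" "((\<lambda>k. inner (w (s k)) (d n)) \<circ> r) \<longlonglongrightarrow> c"
      using bounded_imp_convergent_subsequence by blast
    then have "convergent (\<lambda>k. inner (w ((s \<circ> r) k)) (d n))"
      by (auto simp: o_def convergent_def)
    with r(1) show "\<exists>r'. strict_mono r' \<and> convergent (\<lambda>k. inner (w ((s \<circ> r') k)) (d n))" by blast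
  qed
  define r where "r = diagseq"
  have r: "strict_mono r" unfolding r_def by (rule subseq_diagseq)
  \<comment> \<open>Only after its first \<open>Suc n\<close> terms is the diagonal sequence known
    to be a subsequence of the one selected for \<open>d n\<close>; the finite initial segment is
    removed next.\<close>
  have shifted: "convergent (\<lambda>k. inner (w ((r \<circ> (+) (Suc n)) k)) (d n))" for n
    unfolding r_def
  proof (rule diagseq_holds)
    fix r s :: "nat \<Rightarrow> nat" and n
    assume "strict_mono r" "convergent (\<lambda>k. inner (w (s k)) (d n))"
    then show "convergent (\<lambda>k. inner (w ((s \<circ> r) k)) (d n))"
      using convergent_subseq_convergent[of "\<lambda>k. inner (w (s k)) (d n)" r] by (simp add: o_def)
  qed
  have "convergent (\<lambda>k. inner (w (r (k + Suc n))) (d n))" for n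
    using shifted[of n] by (simp add: o_def add.commute)
  then have conv_d: "convergent (\<lambda>k. inner (w (r k)) (d n))" for n
    using convergent_ignore_initial_segment[of "\<lambda>k. inner (w (r k)) (d n)" "Suc n"] by blast
  have "bounded (range (w \<circ> r))"
    using w by (rule bounded_subset) auto
  then have "closed {v. convergent (\<lambda>k. inner ((w \<circ> r) k) v)}" by (rule closed_convergent_inner)
  moreover have "D \<subseteq> {v. convergent (\<lambda>k. inner ((w \<circ> r) k) v)}"
    unfolding d[symmetric] using conv_d by auto
  moreover have "closure D = UNIV"
    using D(2)[of "- closure D"] closure_subset[of D] by auto
  ultimately have conv: "convergent (\<lambda>k. inner (w (r k)) v)" for v
    using closure_minimal[of D "{v. convergent (\<lambda>k. inner ((w \<circ> r) k) v)}"] by auto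
  define \<phi> where "\<phi> v = lim (\<lambda>k. inner (w (r k)) v)" for v
  have \<phi>: "(\<lambda>k. inner (w (r k)) v) \<longlonglongrightarrow> \<phi> v" for v
    using conv[of v] by (simp add: \<phi>_def convergent_LIMSEQ_iff)
  have "bounded_linear \<phi>"
  proof (rule bounded_linear_intro)
    show "\<phi> (u + v) = \<phi> u + \<phi> v" for u v
      using tendsto_add[OF \<phi>[of u] \<phi>[of v]]
      by (intro LIMSEQ_unique[OF \<phi>]) (simp add: inner_add_right)
    show "\<phi> (c *\<^sub>R v) = c *\<^sub>R \<phi> v" for c v
      using tendsto_mult_left[OF \<phi>[of v], of c]
      by (intro LIMSEQ_unique[OF \<phi>]) simp
    have "\<bar>inner (w (r k)) v\<bar> \<le> norm v * b" for k v
      using Cauchy_Schwarz_ineq2[of "w (r k)" v] mult_right_mono[OF b(2)[of "r k"] norm_ge_zero[of v]]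
      by (simp add: mult.commute)
    then show "norm (\<phi> v) \<le> norm v * b" for v
      by (intro tendsto_upperbound[OF tendsto_norm[OF \<phi>[of v]]]) auto
  qed
  from riesz_representation[OF this] obtain l where "\<And>v. \<phi> v = inner v l" by blast
  then have "weakly_convergent_to (w \<circ> r) l"
    using \<phi> by (simp add: weakly_convergent_to_def inner_commute)
  with r show thesis by (rule that)
qed

text \<open>\<open>W\<close> is the metric in which distances to points of \<open>C\<close> converge; their
  differences are affine in the base point, whence the form of the last hypothesis.\<close>

lemma opial:
  fixes w :: "nat \<Rightarrow> 'a::{real_inner, complete_space, second_countable_topology}"
  assumes w: "bounded (range w)"
    and cluster: "\<And>r l. strict_mono r \<Longrightarrow> weakly_convergent_to (w \<circ> r) l \<Longrightarrow> l \<in> C"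
    and W: "\<And>v. v \<noteq> 0 \<Longrightarrow> inner v (W v) \<noteq> 0"
    and conv: "\<And>z z'. z \<in> C \<Longrightarrow> z' \<in> C \<Longrightarrow> convergent (\<lambda>k. inner (w k) (W (z - z')))"
  obtains z where "z \<in> C" "weakly_convergent_to w z"
proof -
  \<comment> \<open>Testing with \<open>W (l - l')\<close> has one limit along the whole sequence,
    so it cannot tell the two cluster points apart, and \<open>l - l'\<close> has vanishing
    quadratic form.\<close>
  have unique: "l = l'" if r: "strict_mono r" "weakly_convergent_to (w \<circ> r) l"
    and r': "strict_mono r'" "weakly_convergent_to (w \<circ> r') l'" for r r' l l'
  proof -
    obtain c where c: "(\<lambda>k. inner (w k) (W (l - l'))) \<longlonglongrightarrow> c"
      using conv[OF cluster[OF r] cluster[OF r']] unfolding convergent_def by blast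
    have "inner l (W (l - l')) = c"
      using r(2) LIMSEQ_subseq_LIMSEQ[OF c r(1)] LIMSEQ_unique
      unfolding weakly_convergent_to_def o_def by blast
    moreover have "inner l' (W (l - l')) = c"
      using r'(2) LIMSEQ_subseq_LIMSEQ[OF c r'(1)] LIMSEQ_unique
      unfolding weakly_convergent_to_def o_def by blast
    ultimately have "inner (l - l') (W (l - l')) = 0" by (simp add: inner_diff_left)
    then show ?thesis using W[of "l - l'"] by auto
  qed
  obtain r z where r: "strict_mono r" "weakly_convergent_to (w \<circ> r) z"
    using bounded_imp_weakly_convergent_subseq[OF w] .
  have "(\<lambda>k. inner (w k) v) \<longlonglongrightarrow> inner z v" for v
  \<comment> \<open>A subsequence that stays \<open>e\<close> away when tested with \<open>v\<close>
    would still have a weak cluster point, and that point must be \<open>z\<close>.\<close>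
  proof (rule ccontr)
    assume "\<not> ?thesis"
    then obtain e where e: "0 < e" "\<exists>\<^sub>F k in sequentially. e \<le> dist (inner (w k) v) (inner z v)"
      unfolding tendsto_iff frequently_def by (auto simp: not_less not_le)
    then have "infinite {k. e \<le> dist (inner (w k) v) (inner z v)}"
      by (simp add: INFM_nat frequently_cofinite[symmetric] cofinite_eq_sequentially)
    then obtain s where s: "strict_mono (s :: nat \<Rightarrow> nat)" "\<And>k. e \<le> dist (inner (w (s k)) v) (inner z v)"
      using infinite_enumerate[of "{k. e \<le> dist (inner (w k) v) (inner z v)}"] by auto
    have "bounded (range (w \<circ> s))" using w by (rule bounded_subset) auto
    then obtain s' z' where s': "strict_mono s'" "weakly_convergent_to (w \<circ> s \<circ> s') z'"
      by (rule bounded_imp_weakly_convergent_subseq)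
    have "z' = z"
      by (rule unique[OF strict_mono_o[OF s(1) s'(1)] _ r]) (use s'(2) in \<open>simp add: o_assoc\<close>)
    then have "(\<lambda>k. inner (w (s (s' k))) v) \<longlonglongrightarrow> inner z v"
      using s'(2) by (simp add: weakly_convergent_to_def)
    then have "\<forall>\<^sub>F k in sequentially. dist (inner (w (s (s' k))) v) (inner z v) < e"
      using e(1) by (rule tendstoD)
    then show False using s(2) by (auto simp: eventually_sequentially not_less[symmetric])
  qed
  then have "weakly_convergent_to w z" by (simp add: weakly_convergent_to_def)
  with cluster[OF r] show thesis by (rule that)
qed

section \<open>Nonnegative supermartingales\<close>

text \<open>The flag says whether the sequence, having been below \<open>a\<close>, is now to reach
  \<open>b\<close>; the number counts the completed upcrossings.\<close>

fun upcrossing_state :: "real \<Rightarrow> real \<Rightarrow> (nat \<Rightarrow> real) \<Rightarrow> nat \<Rightarrow> bool \<times> nat" where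
  "upcrossing_state a b v 0 = (v 0 \<le> a, 0)"
| "upcrossing_state a b v (Suc n) = (case upcrossing_state a b v n of (rising, c) \<Rightarrow>
     if rising then (if b \<le> v (Suc n) then (False, Suc c) else (True, c)) else (v (Suc n) \<le> a, c))"

lemma upcrossing_count_mono:
  "m \<le> n \<Longrightarrow> snd (upcrossing_state a b v m) \<le> snd (upcrossing_state a b v n)"
  by (induction n rule: dec_induct) (auto split: prod.splits)

text \<open>From any time on, a value at most \<open>a\<close> raises the flag; it then stays up
  until \<open>b\<close> is reached, which adds one to the count.\<close>

lemma upcrossing_count_unbounded:
  assumes low: "\<exists>\<^sub>F n in sequentially. v n \<le> a" and high: "\<exists>\<^sub>F n in sequentially. b \<le> v n"
  shows "\<exists>n. m \<le> snd (upcrossing_state a b v n)"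
proof (induction m)
  case (Suc m)
  let ?s = "upcrossing_state a b v"
  obtain n where n: "m \<le> snd (?s n)" using Suc by blast
  have "\<exists>k\<ge>n. fst (?s k)"
  proof (rule ccontr)
    assume no: "\<not> ?thesis"
    obtain k where k: "k \<ge> Suc n" "v k \<le> a"
      using low unfolding frequently_sequentially by blast
    then obtain j where j: "k = Suc j" "n \<le> j" by (cases k) auto
    have "\<not> fst (?s j)" using no j by blast
    then have "fst (?s (Suc j))" using k j by (auto split: prod.splits)
    then show False using no j(2) le_SucI by blast
  qed
  then obtain k where k: "n \<le> k" "fst (?s k)" by blast
  show ?case
  proof (rule ccontr)
    assume no: "\<not> ?thesis"
    have stay: "fst (?s j)" if "k \<le> j" for j
      using that
    proof (induction j rule: dec_induct)
      case (step j)
      have "m \<le> snd (?s j)"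
        using n upcrossing_count_mono[of n j a b v] k step by linarith
      then have "\<not> b \<le> v (Suc j)"
        using no[unfolded not_ex, rule_format, of "Suc j"] step by (auto split: prod.splits if_splits)
      then show ?case using step by (auto split: prod.splits)
    qed (use k in simp)
    obtain i where i: "i \<ge> Suc k" "b \<le> v i"
      using high unfolding frequently_sequentially by blast
    then obtain j where j: "i = Suc j" "k \<le> j" by (cases i) auto
    have "\<not> fst (?s i)" using i j stay[OF j(2)] by (auto split: prod.splits)
    then show False using stay[of i] i by simp
  qed
qed simp

text \<open>Levels are rational so that countably many almost sure statements provide
  \<open>osc\<close>. Finiteness of the limit inferior excludes divergence to infinity.\<close>

lemma no_oscillation_imp_convergent:
  fixes v :: "nat \<Rightarrow> real"
  assumes nonneg: "\<And>n. 0 \<le> v n"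
    and osc: "\<And>a b. a \<in> \<rat> \<Longrightarrow> b \<in> \<rat> \<Longrightarrow> 0 < a \<Longrightarrow> a < b \<Longrightarrow>
      \<not> ((\<exists>\<^sub>F n in sequentially. v n \<le> a) \<and> (\<exists>\<^sub>F n in sequentially. b \<le> v n))"
    and fin: "liminf (\<lambda>n. ennreal (v n)) < \<infinity>"
  shows "convergent v"
proof -
  \<comment> \<open>The sequence is infinitely often below \<open>B\<close>. Not oscillating between
    the rationals \<open>B1 < B2\<close> above \<open>B\<close>, it is eventually below
    \<open>B2\<close>, hence bounded.\<close>
  obtain B where B: "0 < B" "\<exists>\<^sub>F n in sequentially. v n \<le> B"
  proof -
    obtain L where L: "0 \<le> L" "liminf (\<lambda>n. ennreal (v n)) = ennreal L"
      using fin by (cases "liminf (\<lambda>n. ennreal (v n))") auto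
    define B where "B = L + 1"
    have B: "liminf (\<lambda>n. ennreal (v n)) < ennreal B" "0 < B"
      using L by (auto simp: B_def intro!: ennreal_lessI)
    have "\<exists>\<^sub>F n in sequentially. v n \<le> B"
    proof (rule ccontr)
      assume "\<not> ?thesis"
      then have "\<forall>\<^sub>F n in sequentially. ennreal B \<le> ennreal (v n)"
        unfolding not_frequently by (auto elim!: eventually_mono intro!: ennreal_leI)
      then have "ennreal B \<le> liminf (\<lambda>n. ennreal (v n))" by (rule Liminf_bounded)
      with B(1) show False by simp
    qed
    with B(2) show thesis by (rule that)
  qed
  obtain B1 where B1: "B1 \<in> \<rat>" "B < B1" using Rats_dense_in_real[of B "B + 1"] by auto
  obtain B2 where B2: "B2 \<in> \<rat>" "B1 < B2" using Rats_dense_in_real[of B1 "B1 + 1"] by auto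
  have "\<exists>\<^sub>F n in sequentially. v n \<le> B1"
    using B(2) B1(2) by (auto elim!: frequently_elim1)
  then have "\<not> (\<exists>\<^sub>F n in sequentially. B2 \<le> v n)"
    using osc[OF B1(1) B2(1)] B(1) B1(2) B2(2) by auto
  then have "\<forall>\<^sub>F n in sequentially. norm (v n) \<le> B2"
    unfolding not_frequently using nonneg by (auto elim!: eventually_mono)
  then have "Bseq v" using B(1) B1(2) B2(2) by (intro BfunI)
  then have bdd: "bounded (range v)" by (simp add: Bseq_eq_bounded)
  then obtain l r where r: "strict_mono r" "(v \<circ> r) \<longlonglongrightarrow> l"
    using bounded_imp_convergent_subsequence by blast
  have l0: "0 \<le> l" using r(2) nonneg by (intro LIMSEQ_le_const[OF r(2)]) auto
  have freq: "\<exists>\<^sub>F n in sequentially. P (v n)" if "\<forall>\<^sub>F n in sequentially. P (v (r n))" for P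
  proof -
    have "\<exists>n\<ge>N. P (v n)" for N
    proof -
      obtain K where "\<And>n. n \<ge> K \<Longrightarrow> P (v (r n))" using \<open>\<forall>\<^sub>F n in sequentially. P (v (r n))\<close>
        unfolding eventually_sequentially by blast
      then have "P (v (r (max K N)))" by simp
      moreover have "N \<le> r (max K N)" using seq_suble[OF r(1), of "max K N"] by linarith
      ultimately show ?thesis by blast
    qed
    then show ?thesis unfolding frequently_sequentially by blast
  qed
  have "v \<longlonglongrightarrow> l"
  proof (rule order_tendstoI)
    fix c assume "l < c"
    obtain a where a: "a \<in> \<rat>" "l < a" "a < c" using Rats_dense_in_real[OF \<open>l < c\<close>] by blast
    obtain b where b: "b \<in> \<rat>" "a < b" "b < c" using Rats_dense_in_real[OF a(3)] by blast
    have "\<exists>\<^sub>F n in sequentially. v n \<le> a"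
      using order_tendstoD(2)[OF r(2) a(2)] by (intro freq) (auto elim!: eventually_mono)
    then have "\<forall>\<^sub>F n in sequentially. v n < b"
      using osc[OF a(1) b(1)] a b l0 by (auto simp: not_frequently not_le)
    then show "\<forall>\<^sub>F n in sequentially. v n < c" using b by (auto elim!: eventually_mono)
  next
    fix c assume "c < l"
    show "\<forall>\<^sub>F n in sequentially. c < v n"
    \<comment> \<open>\<open>osc\<close> asks for positive levels. A negative \<open>c\<close> is
      handled by nonnegativity of \<open>v\<close>; otherwise the level \<open>a\<close> above
      \<open>c\<close> is positive.\<close>
    proof (cases "c < 0")
      case True
      then show ?thesis using nonneg by (auto intro!: always_eventually order.strict_trans2[OF True])
    next
      case False
      obtain b where b: "b \<in> \<rat>" "c < b" "b < l" using Rats_dense_in_real[OF \<open>c < l\<close>] by blast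
      obtain a where a: "a \<in> \<rat>" "c < a" "a < b" using Rats_dense_in_real[OF b(2)] by blast
      have "\<exists>\<^sub>F n in sequentially. b \<le> v n"
        using order_tendstoD(1)[OF r(2) b(3)] by (intro freq) (auto elim!: eventually_mono)
      then have "\<forall>\<^sub>F n in sequentially. a < v n"
        using osc[OF a(1) b(1)] a b False by (auto simp: not_frequently not_le)
      then show ?thesis using a by (auto elim!: eventually_mono)
    qed
  qed
  then show ?thesis by (rule convergentI)
qed

text \<open>The conditional inequality is stated through integrals over events of
  \<open>F n\<close>, the form in which upcrossings use it and in which finite sums over the next
  index deliver it.\<close>

locale nonneg_supermartingale = prob_space M for M :: "'a measure" +
  fixes F :: "nat \<Rightarrow> 'a measure" and V :: "nat \<Rightarrow> 'a \<Rightarrow> real"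
  assumes subalg: "\<And>n. subalgebra M (F n)"
    and sets_mono: "\<And>n. sets (F n) \<subseteq> sets (F (Suc n))"
    and adapted[measurable]: "\<And>n. V n \<in> borel_measurable (F n)"
    and integrable: "\<And>n. integrable M (V n)"
    and nonneg: "\<And>n. AE \<omega> in M. 0 \<le> V n \<omega>"
    and decreasing: "\<And>n B. B \<in> sets (F n) \<Longrightarrow>
      (\<integral>\<omega>. indicator B \<omega> * V (Suc n) \<omega> \<partial>M) \<le> (\<integral>\<omega>. indicator B \<omega> * V n \<omega> \<partial>M)"
begin

lemma measurable_filtration_mono:
  "f \<in> F n \<rightarrow>\<^sub>M N \<Longrightarrow> f \<in> F (Suc n) \<rightarrow>\<^sub>M N"
  using sets_mono[of n] subalg unfolding measurable_def subalgebra_def by auto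

lemma upcrossing_state_measurable:
  "(\<lambda>\<omega>. upcrossing_state a b (\<lambda>k. V k \<omega>) n) \<in> F n \<rightarrow>\<^sub>M count_space UNIV"
proof (induction n)
  case (Suc n)
  note [measurable] = measurable_filtration_mono[OF Suc]
  have "(\<lambda>\<omega>. (\<lambda>(rising, c). if rising then (if b \<le> V (Suc n) \<omega> then (False, Suc c) else (True, c))
      else (V (Suc n) \<omega> \<le> a, c)) (upcrossing_state a b (\<lambda>k. V k \<omega>) n)) \<in> F (Suc n) \<rightarrow>\<^sub>M count_space UNIV"
    by (rule measurable_compose_countable[where f = "\<lambda>s \<omega>. (\<lambda>(rising, c).
        if rising then (if b \<le> V (Suc n) \<omega> then (False, Suc c) else (True, c))
        else (V (Suc n) \<omega> \<le> a, c)) s", OF _ measurable_filtration_mono[OF Suc]])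
      (auto split: prod.splits)
  then show ?case by (simp only: upcrossing_state.simps)
qed simp

text \<open>Doob's upcrossing estimate: holding one unit during each climb from \<open>a\<close> to
  \<open>b\<close> cannot have positive expected gain. Nonnegativity of \<open>V\<close> limits the
  loss of an unfinished climb to \<open>a\<close>, so the bound does not depend on
  \<open>n\<close>.\<close>

lemma expected_upcrossings:
  assumes ab: "0 \<le> a" "a < b"
  shows "integrable M (\<lambda>\<omega>. real (snd (upcrossing_state a b (\<lambda>k. V k \<omega>) n)))"
    "(\<integral>\<omega>. (b - a) * snd (upcrossing_state a b (\<lambda>k. V k \<omega>) n) \<partial>M) \<le> a"
proof -
  let ?s = "\<lambda>n \<omega>. upcrossing_state a b (\<lambda>k. V k \<omega>) n"
  define C where "C n \<omega> = real (snd (?s n \<omega>))" for n \<omega>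
  define U where "U n = {\<omega> \<in> space M. fst (?s n \<omega>)}" for n
  have space: "space (F n) = space M" for n using subalg by (simp add: subalgebra_def)
  have UF: "U n \<in> sets (F n)" for n
  proof -
    have "?s n -` {s. fst s} \<inter> space (F n) \<in> sets (F n)"
      by (rule measurable_sets[OF upcrossing_state_measurable]) simp
    also have "?s n -` {s. fst s} \<inter> space (F n) = U n" by (auto simp: U_def space)
    finally show ?thesis .
  qed
  then have UM[measurable]: "U n \<in> sets M" for n
    using subalg by (auto simp: subalgebra_def)
  have sM: "?s n \<in> M \<rightarrow>\<^sub>M count_space UNIV" for n
    by (rule measurable_from_subalg[OF subalg upcrossing_state_measurable])
  have CM[measurable]: "C n \<in> borel_measurable M" for n
    unfolding C_def by (rule measurable_compose[OF sM]) simp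
  have bound: "snd (?s n \<omega>) \<le> n" for n \<omega>
    by (induction n) (auto split: prod.splits)
  have C: "integrable M (C n)" for n
    by (rule integrable_const_bound[where B = "real n"]) (use bound[of _ n] in \<open>auto simp: C_def\<close>)
  then show "integrable M (\<lambda>\<omega>. real (snd (?s n \<omega>)))" by (simp add: C_def[abs_def])
  \<comment> \<open>\<open>W\<close> books a completed climb as \<open>b - a\<close> and a running
    one as \<open>V n - a\<close>. Climbs start at or below \<open>a\<close> and end at or above
    \<open>b\<close>, so a step of \<open>W\<close> is at most the gain from the unit held during
    that step.\<close>
  define W where "W n \<omega> = (b - a) * C n \<omega> + indicator (U n) \<omega> * (V n \<omega> - a)" for n \<omega>
  have iU: "integrable M (\<lambda>\<omega>. indicator (U n) \<omega> * V m \<omega>)" for n m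
    using integrable by (intro integrable_mult_indicator[where 'b = real, simplified]) auto
  have iUc: "integrable M (\<lambda>\<omega>. indicator (U n) \<omega> * a)" for n
    by (intro integrable_mult_left integrable_real_indicator) (auto simp: emeasure_eq_measure)
  have W: "integrable M (W n)" for n
    unfolding W_def right_diff_distrib using C iU iUc by auto
  have step: "W (Suc n) \<omega> \<le> W n \<omega> + indicator (U n) \<omega> * V (Suc n) \<omega> - indicator (U n) \<omega> * V n \<omega>"
    if \<omega>: "\<omega> \<in> space M" for n \<omega>
    using \<omega> ab by (auto simp: W_def C_def U_def indicator_def algebra_simps split: prod.splits if_splits)
  have "(\<integral>\<omega>. W n \<omega> \<partial>M) \<le> 0" for n
  proof (induction n)
    case 0
    have "W 0 \<omega> \<le> 0" for \<omega> by (auto simp: W_def C_def U_def indicator_def)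
    then have "(\<integral>\<omega>. W 0 \<omega> \<partial>M) \<le> (\<integral>\<omega>. 0 \<partial>M)" by (intro integral_mono[OF W]) simp_all
    then show ?case by simp
  next
    case (Suc n)
    have "(\<integral>\<omega>. W (Suc n) \<omega> \<partial>M)
        \<le> (\<integral>\<omega>. W n \<omega> + indicator (U n) \<omega> * V (Suc n) \<omega> - indicator (U n) \<omega> * V n \<omega> \<partial>M)"
      by (rule integral_mono) (use W iU step in auto)
    also have "\<dots> = (\<integral>\<omega>. W n \<omega> \<partial>M) + (\<integral>\<omega>. indicator (U n) \<omega> * V (Suc n) \<omega> \<partial>M)
        - (\<integral>\<omega>. indicator (U n) \<omega> * V n \<omega> \<partial>M)"
      using W iU by simp
    also have "\<dots> \<le> 0" using Suc decreasing[OF UF, of n] by linarith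
    finally show ?case .
  qed
  moreover have "(\<integral>\<omega>. (b - a) * C n \<omega> \<partial>M) \<le> (\<integral>\<omega>. W n \<omega> + a \<partial>M)"
  proof (rule integral_mono_AE)
    show "AE \<omega> in M. (b - a) * C n \<omega> \<le> W n \<omega> + a"
      using nonneg[of n] by eventually_elim (use ab in \<open>auto simp: W_def indicator_def\<close>)
  qed (use C W in auto)
  moreover have "(\<integral>\<omega>. W n \<omega> + a \<partial>M) = (\<integral>\<omega>. W n \<omega> \<partial>M) + a"
    using W by (simp add: prob_space)
  ultimately show "(\<integral>\<omega>. (b - a) * snd (?s n \<omega>) \<partial>M) \<le> a"
    unfolding C_def by (smt (verit))
qed

text \<open>By monotone convergence the total number of upcrossings has finite mean, so it is almost
  surely finite.\<close>

lemma AE_no_oscillation: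
  assumes ab: "0 \<le> a" "a < b"
  shows "AE \<omega> in M. \<not> ((\<exists>\<^sub>F n in sequentially. V n \<omega> \<le> a) \<and> (\<exists>\<^sub>F n in sequentially. b \<le> V n \<omega>))"
proof -
  define C where "C n \<omega> = snd (upcrossing_state a b (\<lambda>k. V k \<omega>) n)" for n \<omega>
  have mono: "C m \<omega> \<le> C n \<omega>" if "m \<le> n" for m n \<omega>
    unfolding C_def using that by (rule upcrossing_count_mono)
  have int: "integrable M (\<lambda>\<omega>. real (C n \<omega>))" for n
    unfolding C_def by (rule expected_upcrossings(1)[OF ab])
  have E: "(\<integral>\<omega>. real (C n \<omega>) \<partial>M) \<le> a / (b - a)" for n
    using expected_upcrossings(2)[OF ab, of n] ab(2) by (simp add: C_def pos_le_divide_eq mult.commute)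
  note [measurable] = borel_measurable_integrable[OF int]
  have "(\<integral>\<^sup>+\<omega>. (SUP n. ennreal (C n \<omega>)) \<partial>M) = (SUP n. \<integral>\<^sup>+\<omega>. ennreal (C n \<omega>) \<partial>M)"
    by (rule nn_integral_monotone_convergence_SUP)
      (auto simp: incseq_def le_fun_def intro!: mono ennreal_leI)
  also have "\<dots> \<le> ennreal (a / (b - a))"
    using E by (intro SUP_least) (simp add: nn_integral_eq_integral[OF int] ennreal_leI)
  finally have "(\<integral>\<^sup>+\<omega>. (SUP n. ennreal (C n \<omega>)) \<partial>M) \<noteq> \<infinity>"
    by (auto simp: top_unique)
  then have "AE \<omega> in M. (SUP n. ennreal (C n \<omega>)) \<noteq> \<infinity>"
    by (intro nn_integral_noteq_infinite) auto
  then show ?thesis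
  proof eventually_elim
    case (elim \<omega>)
    show ?case
    proof
      assume "(\<exists>\<^sub>F n in sequentially. V n \<omega> \<le> a) \<and> (\<exists>\<^sub>F n in sequentially. b \<le> V n \<omega>)"
      then have unb: "\<exists>n. m \<le> C n \<omega>" for m
        unfolding C_def using upcrossing_count_unbounded[of "\<lambda>k. V k \<omega>"] by blast
      have "of_nat m \<le> (SUP n. ennreal (C n \<omega>))" for m
      proof -
        obtain n where "m \<le> C n \<omega>" using unb by blast
        then have "of_nat m \<le> ennreal (C n \<omega>)"
          by (simp flip: ennreal_of_nat_eq_real_of_nat)
        also have "\<dots> \<le> (SUP n. ennreal (C n \<omega>))" by (rule SUP_upper) simp
        finally show ?thesis .
      qed
      then have "(SUP n. ennreal (C n \<omega>)) = \<top>"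
        by (metis ennreal_Ex_less_of_nat less_top not_less)
      with elim show False by simp
    qed
  qed
qed

lemma expectation_le: "(\<integral>\<omega>. V n \<omega> \<partial>M) \<le> (\<integral>\<omega>. V 0 \<omega> \<partial>M)"
proof (induction n)
  case (Suc n)
  have "space M \<in> sets (F n)"
    using subalg[of n] sets.top[of "F n"] by (simp add: subalgebra_def)
  moreover have "(\<integral>\<omega>. indicator (space M) \<omega> * V m \<omega> \<partial>M) = (\<integral>\<omega>. V m \<omega> \<partial>M)" for m
    by (intro Bochner_Integration.integral_cong) auto
  ultimately show ?case using decreasing[of "space M" n] Suc by simp
qed simp

text \<open>Fatou's lemma and the decreasing means make the limit inferior finite almost surely; the
  countably many pairs of rational levels share one null set.\<close>

theorem AE_convergent: "AE \<omega> in M. convergent (\<lambda>n. V n \<omega>)"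
proof -
  have VM[measurable]: "V n \<in> borel_measurable M" for n
    using integrable by (rule borel_measurable_integrable)
  have "(\<integral>\<^sup>+\<omega>. liminf (\<lambda>n. ennreal (V n \<omega>)) \<partial>M) \<le> liminf (\<lambda>n. \<integral>\<^sup>+\<omega>. ennreal (V n \<omega>) \<partial>M)"
    by (rule nn_integral_liminf) simp
  also have "\<dots> \<le> liminf (\<lambda>n::nat. ennreal (\<integral>\<omega>. V 0 \<omega> \<partial>M))"
    by (intro Liminf_mono always_eventually allI)
      (simp add: nn_integral_eq_integral[OF integrable nonneg] ennreal_leI expectation_le)
  also have "\<dots> = ennreal (\<integral>\<omega>. V 0 \<omega> \<partial>M)" by (simp add: Liminf_const)
  finally have "(\<integral>\<^sup>+\<omega>. liminf (\<lambda>n. ennreal (V n \<omega>)) \<partial>M) \<noteq> \<infinity>" by (auto simp: top_unique)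
  then have fin: "AE \<omega> in M. liminf (\<lambda>n. ennreal (V n \<omega>)) \<noteq> \<infinity>"
    by (intro nn_integral_noteq_infinite) auto
  have "AE \<omega> in M. \<forall>a\<in>\<rat>. \<forall>b\<in>\<rat>. 0 < a \<longrightarrow> a < b \<longrightarrow>
      \<not> ((\<exists>\<^sub>F n in sequentially. V n \<omega> \<le> a) \<and> (\<exists>\<^sub>F n in sequentially. b \<le> V n \<omega>))"
    by (intro AE_ball_countable[THEN iffD2] ballI AE_impI AE_no_oscillation countable_rat less_imp_le)
  moreover have "AE \<omega> in M. \<forall>n. 0 \<le> V n \<omega>"
    using nonneg by (simp add: AE_all_countable)
  ultimately show ?thesis
    using fin
  proof eventually_elim
    case (elim \<omega>)
    show ?case
      by (rule no_oscillation_imp_convergent) (use elim in \<open>auto simp: top.not_eq_extremum\<close>)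
  qed
qed

end

section \<open>Separability of finite products and countable dense subsets\<close>

instance vec :: ("{metric_space, second_countable_topology}", finite) second_countable_topology
proof
  obtain B :: "'a set set" where B: "countable B" "topological_basis B"
    using ex_countable_basis by auto
  define box where "box b = {x :: 'a ^ 'b. \<forall>i. x $ i \<in> b i}" for b
  have "topological_basis (box ` PiE UNIV (\<lambda>_. B))"
  proof (rule topological_basisI)
    show "open X" if "X \<in> box ` PiE UNIV (\<lambda>_. B)" for X
      using that B(2) unfolding box_def
      by (auto intro!: open_vector_box topological_basis_open[OF B(2)])
    fix S :: "('a ^ 'b) set" and x assume "open S" "x \<in> S"
    then obtain A where A: "\<And>i. open (A i)" "\<And>i. x $ i \<in> A i" "\<And>y. (\<forall>i. y $ i \<in> A i) \<Longrightarrow> y \<in> S"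
      unfolding open_vec_def by metis
    have "\<exists>b. b \<in> B \<and> x $ i \<in> b \<and> b \<subseteq> A i" for i
      using topological_basisE[OF B(2) A(1,2)] by metis
    then obtain b where b: "\<And>i. b i \<in> B" "\<And>i. x $ i \<in> b i" "\<And>i. b i \<subseteq> A i" by metis
    have "box b \<subseteq> S"
    proof
      fix y assume "y \<in> box b"
      then have "\<forall>i. y $ i \<in> A i" using b(3) by (auto simp: box_def)
      then show "y \<in> S" by (rule A(3))
    qed
    then show "\<exists>X\<in>box ` PiE UNIV (\<lambda>_. B). x \<in> X \<and> X \<subseteq> S"
      using b by (intro bexI[of _ "box b"]) (auto simp: box_def)
  qed
  moreover have "countable (box ` PiE UNIV (\<lambda>_. B))"
    using B(1) by (intro countable_image countable_PiE) auto
  ultimately show "\<exists>B::('a ^ 'b) set set. countable B \<and> open = generate_topology B"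
    using topological_basis_imp_subbasis by blast
qed

text \<open>One point is chosen from each basic open set that meets \<open>S\<close>. Membership
  \<open>D \<subseteq> S\<close> matters: the Lyapunov function is controlled at saddle points
  only.\<close>

lemma countable_dense_subset:
  fixes S :: "'a::second_countable_topology set"
  obtains D where "countable D" "D \<subseteq> S" "S \<subseteq> closure D"
proof -
  obtain B :: "'a set set" where B: "countable B" "topological_basis B"
    using ex_countable_basis by auto
  define pt where "pt b = (SOME x. x \<in> b \<inter> S)" for b
  have pt: "pt b \<in> b \<inter> S" if "b \<inter> S \<noteq> {}" for b
    unfolding pt_def by (rule someI_ex) (use that in blast)
  define D where "D = pt ` {b \<in> B. b \<inter> S \<noteq> {}}"
  have "S \<subseteq> closure D"
  proof
    fix x assume x: "x \<in> S"
    show "x \<in> closure D"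
    proof (rule ccontr)
      assume "x \<notin> closure D"
      then obtain b where b: "b \<in> B" "x \<in> b" "b \<subseteq> - closure D"
        using topological_basisE[OF B(2), of "- closure D" x] by auto
      then have "pt b \<in> b" "pt b \<in> D" using pt[of b] x by (auto simp: D_def)
      then show False using b(3) closure_subset[of D] by auto
    qed
  qed
  moreover have "countable D" unfolding D_def using B(1) by auto
  moreover have "D \<subseteq> S" unfolding D_def using pt by auto
  ultimately show thesis using that by blast
qed

section \<open>Almost monotone sequences and almost supermartingales\<close>

lemma prod_one_plus_convergent:
  fixes \<epsilon> :: "nat \<Rightarrow> real"
  assumes \<epsilon>: "\<And>k. 0 \<le> \<epsilon> k" "summable \<epsilon>"
  obtains P where "(\<lambda>n. \<Prod>k<n. 1 + \<epsilon> k) \<longlonglongrightarrow> P" "\<And>n. 1 \<le> (\<Prod>k<n. 1 + \<epsilon> k)"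
    "\<And>n. (\<Prod>k<n. 1 + \<epsilon> k) \<le> P"
proof -
  define p where "p n = (\<Prod>k<n. 1 + \<epsilon> k)" for n
  have one: "1 \<le> p n" for n unfolding p_def using \<epsilon> by (intro prod_ge_1) auto
  have inc: "incseq p"
  proof (rule incseq_SucI)
    fix n
    have "p n * 1 \<le> p n * (1 + \<epsilon> n)" using one[of n] \<epsilon> by (intro mult_left_mono) auto
    then show "p n \<le> p (Suc n)" by (simp add: p_def)
  qed
  have "p n \<le> exp (suminf \<epsilon>)" for n
  proof -
    have "p n \<le> (\<Prod>k<n. exp (\<epsilon> k))"
      unfolding p_def using \<epsilon> by (intro prod_mono) (auto intro: add_nonneg_nonneg exp_ge_add_one_self)
    also have "\<dots> = exp (\<Sum>k<n. \<epsilon> k)" by (simp add: exp_sum)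
    also have "\<dots> \<le> exp (suminf \<epsilon>)" using \<epsilon> by (auto intro: sum_le_suminf)
    finally show ?thesis .
  qed
  then obtain P where "p \<longlonglongrightarrow> P" "\<And>n. p n \<le> P"
    using incseq_convergent[OF inc] by blast
  then show thesis using one by (intro that[of P]) (auto simp: p_def[abs_def])
qed

text \<open>Division by the partial products of \<open>1 + \<epsilon> k\<close> makes the sequence
  decreasing, and these products converge.\<close>

lemma quasi_decreasing_convergent:
  fixes a :: "nat \<Rightarrow> real"
  assumes \<epsilon>: "\<And>k. 0 \<le> \<epsilon> k" "summable \<epsilon>"
    and a: "\<And>k. 0 \<le> a k" "\<And>k. a (Suc k) \<le> (1 + \<epsilon> k) * a k"
  shows "convergent a"
proof -
  define p where "p n = (\<Prod>k<n. 1 + \<epsilon> k)" for n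
  obtain P where P: "p \<longlonglongrightarrow> P" "\<And>n. 1 \<le> p n"
    using prod_one_plus_convergent[OF \<epsilon>] unfolding p_def[abs_def] by blast
  have pos: "0 < p n" for n using P(2)[of n] by linarith
  have "decseq (\<lambda>n. a n / p n)"
  proof (rule decseq_SucI)
    fix n
    have "a (Suc n) / p (Suc n) \<le> ((1 + \<epsilon> n) * a n) / p (Suc n)"
      using a(2)[of n] pos[of "Suc n"] by (intro divide_right_mono) auto
    also have "\<dots> = a n / p n" using \<epsilon>(1)[of n] by (simp add: p_def)
    finally show "a (Suc n) / p (Suc n) \<le> a n / p n" .
  qed
  moreover have "0 \<le> a n / p n" for n using a(1)[of n] pos[of n] by simp
  ultimately obtain l where "(\<lambda>n. a n / p n) \<longlonglongrightarrow> l"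
    using decseq_convergent[of "\<lambda>n. a n / p n" 0] by blast
  from tendsto_mult[OF this P(1)] have "a \<longlonglongrightarrow> l * P" using pos by (simp add: less_imp_neq[THEN not_sym])
  then show ?thesis by (rule convergentI)
qed

text \<open>The series of the \<open>\<theta> n\<close> has finite expectation, so it converges
  almost surely and its terms vanish.\<close>

lemma (in prob_space) summable_expectation_imp_AE_tendsto_0:
  fixes \<theta> :: "nat \<Rightarrow> 'a \<Rightarrow> real"
  assumes int: "\<And>n. integrable M (\<theta> n)" and nonneg: "\<And>n. AE \<omega> in M. 0 \<le> \<theta> n \<omega>"
    and bound: "\<And>n. (\<Sum>k<n. \<integral>\<omega>. \<theta> k \<omega> \<partial>M) \<le> C"
  shows "AE \<omega> in M. (\<lambda>n. \<theta> n \<omega>) \<longlonglongrightarrow> 0"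
proof -
  note [measurable] = borel_measurable_integrable[OF int]
  have "(\<integral>\<^sup>+\<omega>. (\<Sum>k. ennreal (\<theta> k \<omega>)) \<partial>M) = (\<Sum>k. \<integral>\<^sup>+\<omega>. ennreal (\<theta> k \<omega>) \<partial>M)"
    by (rule nn_integral_suminf) simp
  also have "\<dots> = (\<Sum>k. ennreal (\<integral>\<omega>. \<theta> k \<omega> \<partial>M))"
    by (simp add: nn_integral_eq_integral[OF int nonneg])
  also have "\<dots> \<le> ennreal C"
  proof (rule suminf_le_const[OF summableI])
    show "(\<Sum>k<n. ennreal (\<integral>\<omega>. \<theta> k \<omega> \<partial>M)) \<le> ennreal C" for n
      using bound[of n] integral_nonneg_AE[OF nonneg] by (simp add: sum_ennreal ennreal_leI)
  qed
  finally have "(\<integral>\<^sup>+\<omega>. (\<Sum>k. ennreal (\<theta> k \<omega>)) \<partial>M) \<noteq> \<infinity>" by (auto simp: top_unique)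
  then have "AE \<omega> in M. (\<Sum>k. ennreal (\<theta> k \<omega>)) \<noteq> \<infinity>"
    by (intro nn_integral_noteq_infinite) auto
  moreover have "AE \<omega> in M. \<forall>k. 0 \<le> \<theta> k \<omega>" using nonneg by (simp add: AE_all_countable)
  ultimately show ?thesis
  proof eventually_elim
    case (elim \<omega>)
    then have "summable (\<lambda>k. \<theta> k \<omega>)" by (intro summable_suminf_not_top) auto
    then show ?case by (rule summable_LIMSEQ_zero)
  qed
qed

text \<open>After division by \<open>p n\<close> the factors \<open>1 + \<epsilon> n\<close>
  disappear and \<open>V\<close> becomes a nonnegative supermartingale. The same scaled inequality
  telescopes in expectation and bounds the sum of the means of \<open>\<theta>\<close>.\<close>

lemma (in prob_space) robbins_siegmund:
  fixes V \<theta> :: "nat \<Rightarrow> 'a \<Rightarrow> real"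
  assumes F: "\<And>n. subalgebra M (F n)" "\<And>n. sets (F n) \<subseteq> sets (F (Suc n))"
    and V: "\<And>n. V n \<in> borel_measurable (F n)" "\<And>n. integrable M (V n)" "\<And>n. AE \<omega> in M. 0 \<le> V n \<omega>"
    and \<theta>: "\<And>n. integrable M (\<theta> n)" "\<And>n. AE \<omega> in M. 0 \<le> \<theta> n \<omega>"
    and \<epsilon>: "\<And>n. 0 \<le> \<epsilon> n" "summable \<epsilon>"
    and step: "\<And>n B. B \<in> sets (F n) \<Longrightarrow> (\<integral>\<omega>. indicator B \<omega> * V (Suc n) \<omega> \<partial>M)
      \<le> (1 + \<epsilon> n) * (\<integral>\<omega>. indicator B \<omega> * V n \<omega> \<partial>M) - (\<integral>\<omega>. indicator B \<omega> * \<theta> n \<omega> \<partial>M)"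
  shows "AE \<omega> in M. convergent (\<lambda>n. V n \<omega>)" "AE \<omega> in M. (\<lambda>n. \<theta> n \<omega>) \<longlonglongrightarrow> 0"
proof -
  define p where "p n = (\<Prod>k<n. 1 + \<epsilon> k)" for n
  obtain P where P: "p \<longlonglongrightarrow> P" "\<And>n. 1 \<le> p n" "\<And>n. p n \<le> P"
    using prod_one_plus_convergent[OF \<epsilon>] unfolding p_def[abs_def] by blast
  have pos: "0 < p n" for n using P(2)[of n] by linarith
  have p_Suc: "p (Suc n) = p n * (1 + \<epsilon> n)" for n by (simp add: p_def)
  have FM: "B \<in> sets M" if "B \<in> sets (F n)" for B n
    using that F(1)[of n] by (auto simp: subalgebra_def)
  have scaled: "(\<integral>\<omega>. indicator B \<omega> * (V (Suc n) \<omega> / p (Suc n)) \<partial>M)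
      \<le> (\<integral>\<omega>. indicator B \<omega> * (V n \<omega> / p n) \<partial>M) - (\<integral>\<omega>. indicator B \<omega> * \<theta> n \<omega> \<partial>M) / p (Suc n)"
    if B: "B \<in> sets (F n)" for B n
  proof -
    have "(\<integral>\<omega>. indicator B \<omega> * V (Suc n) \<omega> \<partial>M) / p (Suc n)
      \<le> ((1 + \<epsilon> n) * (\<integral>\<omega>. indicator B \<omega> * V n \<omega> \<partial>M) - (\<integral>\<omega>. indicator B \<omega> * \<theta> n \<omega> \<partial>M)) / p (Suc n)"
      using step[OF B] pos[of "Suc n"] by (intro divide_right_mono) auto
    also have "\<dots> = (\<integral>\<omega>. indicator B \<omega> * V n \<omega> \<partial>M) / p n - (\<integral>\<omega>. indicator B \<omega> * \<theta> n \<omega> \<partial>M) / p (Suc n)"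
      using \<epsilon>(1)[of n] pos[of n] by (simp add: diff_divide_distrib p_Suc)
    finally show ?thesis by simp
  qed
  have ind\<theta>: "0 \<le> (\<integral>\<omega>. indicator B \<omega> * \<theta> n \<omega> \<partial>M)" for B n
    by (intro integral_nonneg_AE, use \<theta>(2)[of n] in eventually_elim) auto
  interpret nonneg_supermartingale M F "\<lambda>n \<omega>. V n \<omega> / p n"
  proof
    show "(\<lambda>\<omega>. V n \<omega> / p n) \<in> borel_measurable (F n)" for n
      using V(1)[of n] by measurable
    show "AE \<omega> in M. 0 \<le> V n \<omega> / p n" for n
      using V(3)[of n] by eventually_elim (use pos[of n] in auto)
    show "(\<integral>\<omega>. indicator B \<omega> * (V (Suc n) \<omega> / p (Suc n)) \<partial>M) \<le> (\<integral>\<omega>. indicator B \<omega> * (V n \<omega> / p n) \<partial>M)"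
      if "B \<in> sets (F n)" for B n
      using scaled[OF that] ind\<theta>[of B n] pos[of "Suc n"]
      by (smt (verit) divide_nonneg_pos)
  qed (use F V in auto)
  show "AE \<omega> in M. convergent (\<lambda>n. V n \<omega>)"
    using AE_convergent
  proof eventually_elim
    case (elim \<omega>)
    then obtain l where "(\<lambda>n. V n \<omega> / p n) \<longlonglongrightarrow> l" by (auto simp: convergent_def)
    from tendsto_mult[OF this P(1)] have "(\<lambda>n. V n \<omega>) \<longlonglongrightarrow> l * P"
      using pos by (simp add: less_imp_neq[THEN not_sym])
    then show ?case by (rule convergentI)
  qed
  have top: "space M \<in> sets (F n)" for n
    using F(1)[of n] sets.top[of "F n"] by (simp add: subalgebra_def)
  have ind_top: "(\<integral>\<omega>. indicator (space M) \<omega> * h \<omega> \<partial>M) = (\<integral>\<omega>. h \<omega> \<partial>M)" for h :: "'a \<Rightarrow> real"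
    by (intro Bochner_Integration.integral_cong) auto
  \<comment> \<open>The limit \<open>P\<close> dominates every partial product, so
    \<open>1 / P\<close> is a common lower bound for the factors in front of the means of
    \<open>\<theta>\<close>.\<close>
  have "(\<integral>\<omega>. V n \<omega> / p n \<partial>M) + (\<Sum>k<n. \<integral>\<omega>. \<theta> k \<omega> \<partial>M) / P \<le> (\<integral>\<omega>. V 0 \<omega> \<partial>M)" for n
  proof (induction n)
    case 0
    then show ?case by (simp add: p_def)
  next
    case (Suc n)
    have "(\<integral>\<omega>. \<theta> n \<omega> \<partial>M) / P \<le> (\<integral>\<omega>. \<theta> n \<omega> \<partial>M) / p (Suc n)"
      using P(3)[of "Suc n"] pos[of "Suc n"] integral_nonneg_AE[OF \<theta>(2)[of n]]
      by (intro divide_left_mono) auto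
    then show ?case
      using Suc scaled[OF top[of n]] unfolding ind_top by (simp add: add_divide_distrib)
  qed
  moreover have "0 \<le> (\<integral>\<omega>. V n \<omega> / p n \<partial>M)" for n
    by (rule integral_nonneg_AE[OF nonneg])
  ultimately have "(\<Sum>k<n. \<integral>\<omega>. \<theta> k \<omega> \<partial>M) / P \<le> (\<integral>\<omega>. V 0 \<omega> \<partial>M)" for n
    by (smt (verit))
  then have "(\<Sum>k<n. \<integral>\<omega>. \<theta> k \<omega> \<partial>M) \<le> (\<integral>\<omega>. V 0 \<omega> \<partial>M) * P" for n
    using pos[of 0] P(3)[of 0] by (simp add: pos_divide_le_eq)
  then show "AE \<omega> in M. (\<lambda>n. \<theta> n \<omega>) \<longlonglongrightarrow> 0"
    by (rule summable_expectation_imp_AE_tendsto_0[OF \<theta>])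
qed

section \<open>Independent sampling and functions of the sampled indices\<close>

locale serial_sampling_space = prob_space M for M :: "'w measure" +
  fixes p :: "'n::finite \<Rightarrow> real" and pick :: "nat \<Rightarrow> 'w \<Rightarrow> 'n"
  assumes sampling: "serial_sampling M p pick"
begin

definition past :: "nat \<Rightarrow> 'w \<Rightarrow> nat \<Rightarrow> 'n" where
  "past k \<omega> = (\<lambda>j\<in>{..<k}. pick j \<omega>)"

text \<open>Comparing pairs of outcomes lets this be proved for iterates directly from the
  recursion, for values in any type and without measurability of the step-size rule.\<close>

definition past_determined :: "nat \<Rightarrow> ('w \<Rightarrow> 'b) \<Rightarrow> bool" where
  "past_determined k \<phi> \<longleftrightarrow>
    (\<forall>\<omega>\<in>space M. \<forall>\<omega>'\<in>space M. (\<forall>j<k. pick j \<omega> = pick j \<omega>') \<longrightarrow> \<phi> \<omega> = \<phi> \<omega>')"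

text \<open>The filtration of the supermartingale is generated by the sampled indices. At each time
  it has finitely many atoms, and the iterates, being functions of the indices, are constant on
  them.\<close>

definition past_algebra :: "nat \<Rightarrow> 'w measure" where
  "past_algebra k = vimage_algebra (space M) (past k) (PiM {..<k} (\<lambda>_. count_space UNIV))"

lemma indep: "indep_vars (\<lambda>_. count_space UNIV) pick UNIV"
  using sampling by (simp add: serial_sampling_def)

lemma measurable_pick[measurable]: "pick k \<in> M \<rightarrow>\<^sub>M count_space UNIV"
  using indep by (simp add: indep_vars_def)

lemma prob_pick: "prob {\<omega> \<in> space M. pick k \<omega> = i} = p i"
  using sampling by (simp add: serial_sampling_def)

lemma PiM_past: "PiM {..<k::nat} (\<lambda>_. count_space (UNIV :: 'n set)) = count_space (PiE {..<k} (\<lambda>_. UNIV))"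
  by (rule count_space_PiM_finite) simp_all

lemma measurable_past[measurable]: "past k \<in> M \<rightarrow>\<^sub>M PiM {..<k} (\<lambda>_. count_space UNIV)"
  unfolding past_def by (rule measurable_restrict) simp

lemma past_in_PiE: "past k \<omega> \<in> PiE {..<k} (\<lambda>_. UNIV)"
  by (simp add: past_def)

lemma past_eq_iff: "past k \<omega> = past k \<omega>' \<longleftrightarrow> (\<forall>j<k. pick j \<omega> = pick j \<omega>')"
  by (auto simp: past_def fun_eq_iff restrict_def)

text \<open>The factor evaluates \<open>\<phi>\<close> at a chosen outcome with the given
  history.\<close>

lemma past_determined_factor:
  assumes "past_determined k \<phi>"
  obtains G where "\<And>\<omega>. \<omega> \<in> space M \<Longrightarrow> \<phi> \<omega> = G (past k \<omega>)"
proof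
  fix \<omega> assume \<omega>: "\<omega> \<in> space M"
  define \<omega>' where "\<omega>' = (SOME \<omega>'. \<omega>' \<in> space M \<and> past k \<omega>' = past k \<omega>)"
  have "\<omega>' \<in> space M \<and> past k \<omega>' = past k \<omega>"
    unfolding \<omega>'_def by (rule someI[of _ \<omega>]) (use \<omega> in simp)
  then have "\<phi> \<omega> = \<phi> \<omega>'"
    using assms \<omega> unfolding past_determined_def past_eq_iff by metis
  then show "\<phi> \<omega> = (\<lambda>h. \<phi> (SOME \<omega>'. \<omega>' \<in> space M \<and> past k \<omega>' = h)) (past k \<omega>)"
    by (simp add: \<omega>'_def)
qed

lemma space_past_algebra: "space (past_algebra k) = space M"
  by (simp add: past_algebra_def)

text \<open>The histories of length \<open>k\<close> form a finite discrete space, in which every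
  set is measurable; only dependence on the history remains as a condition.\<close>

lemma sets_past_algebra:
  "A \<in> sets (past_algebra k) \<longleftrightarrow> A \<subseteq> space M \<and> past_determined k (\<lambda>\<omega>. \<omega> \<in> A)"
proof -
  have *: "sets (past_algebra k) = {past k -` B \<inter> space M | B. B \<subseteq> PiE {..<k} (\<lambda>_. UNIV)}"
    unfolding past_algebra_def
    by (subst sets_vimage_algebra2) (auto simp: PiM_past past_in_PiE)
  show ?thesis
  proof
    assume "A \<in> sets (past_algebra k)"
    then show "A \<subseteq> space M \<and> past_determined k (\<lambda>\<omega>. \<omega> \<in> A)"
      unfolding * past_determined_def by (auto simp: past_eq_iff[symmetric])
  next
    assume A: "A \<subseteq> space M \<and> past_determined k (\<lambda>\<omega>. \<omega> \<in> A)"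
    then obtain G where "\<And>\<omega>. \<omega> \<in> space M \<Longrightarrow> (\<omega> \<in> A) = G (past k \<omega>)"
      using past_determined_factor by blast
    then have "A = past k -` {h \<in> PiE {..<k} (\<lambda>_. UNIV). G h} \<inter> space M"
      using A past_in_PiE by auto
    then show "A \<in> sets (past_algebra k)" unfolding * by blast
  qed
qed

lemma subalgebra_past_algebra: "subalgebra M (past_algebra k)"
  unfolding subalgebra_def
proof (intro conjI subsetI)
  fix A assume "A \<in> sets (past_algebra k)"
  then obtain B where "B \<in> sets (PiM {..<k} (\<lambda>_. count_space UNIV))" "A = past k -` B \<inter> space M"
    unfolding past_algebra_def by (subst (asm) sets_vimage_algebra2) (auto simp: PiM_past past_in_PiE)
  then show "A \<in> sets M" by simp
qed (simp add: space_past_algebra)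

lemma past_determined_Suc: "past_determined k \<phi> \<Longrightarrow> past_determined (Suc k) \<phi>"
  unfolding past_determined_def by (meson less_SucI)

lemma past_algebra_mono: "sets (past_algebra k) \<subseteq> sets (past_algebra (Suc k))"
  using past_determined_Suc by (auto simp: sets_past_algebra)

lemma past_determined_measurable:
  fixes \<phi> :: "'w \<Rightarrow> real"
  assumes "past_determined k \<phi>"
  shows "\<phi> \<in> borel_measurable (past_algebra k)"
proof (rule measurableI)
  fix A :: "real set"
  have "past_determined k (\<lambda>\<omega>. \<omega> \<in> \<phi> -` A \<inter> space M)"
    unfolding past_determined_def
  proof (intro ballI impI)
    fix \<omega> \<omega>' assume \<omega>: "\<omega> \<in> space M" "\<omega>' \<in> space M" "\<forall>j<k. pick j \<omega> = pick j \<omega>'"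
    then have "\<phi> \<omega> = \<phi> \<omega>'" using assms unfolding past_determined_def by blast
    then show "(\<omega> \<in> \<phi> -` A \<inter> space M) = (\<omega>' \<in> \<phi> -` A \<inter> space M)" using \<omega> by simp
  qed
  then show "\<phi> -` A \<inter> space (past_algebra k) \<in> sets (past_algebra k)"
    by (simp add: sets_past_algebra space_past_algebra)
qed simp

text \<open>There are finitely many histories of length \<open>k\<close>, so \<open>\<phi>\<close>
  is bounded by the largest of finitely many values.\<close>

lemma past_determined_integrable:
  fixes \<phi> :: "'w \<Rightarrow> real"
  assumes \<phi>: "past_determined k \<phi>"
  shows "integrable M \<phi>"
proof -
  obtain G where G: "\<And>\<omega>. \<omega> \<in> space M \<Longrightarrow> \<phi> \<omega> = G (past k \<omega>)"
    using past_determined_factor[OF \<phi>] by blast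
  have fin: "finite ((\<lambda>h. \<bar>G h\<bar>) ` PiE {..<k} (\<lambda>_. UNIV))"
    by (intro finite_imageI finite_PiE) auto
  show ?thesis
  proof (rule integrable_const_bound)
    show "AE \<omega> in M. norm (\<phi> \<omega>) \<le> Max ((\<lambda>h. \<bar>G h\<bar>) ` PiE {..<k} (\<lambda>_. UNIV))"
      using G past_in_PiE by (intro AE_I2) (auto intro!: Max_ge[OF fin])
    show "\<phi> \<in> borel_measurable M"
      by (rule measurable_from_subalg[OF subalgebra_past_algebra past_determined_measurable[OF \<phi>]])
  qed
qed

text \<open>The index drawn at time \<open>k\<close> is independent of the block of earlier indices,
  through which \<open>\<phi>\<close> factors, so the expectation of the product splits.\<close>

lemma expectation_pick_indicator:
  fixes \<phi> :: "'w \<Rightarrow> real"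
  assumes \<phi>: "past_determined k \<phi>"
  shows "integrable M (\<lambda>\<omega>. indicator {i} (pick k \<omega>) * \<phi> \<omega>)"
    "(\<integral>\<omega>. indicator {i} (pick k \<omega>) * \<phi> \<omega> \<partial>M) = p i * (\<integral>\<omega>. \<phi> \<omega> \<partial>M)"
proof -
  obtain G where G: "\<And>\<omega>. \<omega> \<in> space M \<Longrightarrow> \<phi> \<omega> = G (past k \<omega>)"
    using past_determined_factor[OF \<phi>] by blast
  define X where "X \<omega> = (indicator {i} (pick k \<omega>) :: real)" for \<omega>
  have "indep_var borel ((\<lambda>h. indicator {i} (h k)) \<circ> (\<lambda>\<omega>. \<lambda>j\<in>{k}. pick j \<omega>))
      borel (G \<circ> (\<lambda>\<omega>. \<lambda>j\<in>{..<k}. pick j \<omega>))"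
  proof (rule indep_var_compose[OF indep_var_restrict[OF indep]])
    show "G \<in> borel_measurable (PiM {..<k} (\<lambda>_. count_space UNIV))"
      unfolding PiM_past by simp
    show "(\<lambda>h. indicator {i} (h k)) \<in> borel_measurable (PiM {k} (\<lambda>_. count_space UNIV))"
      by (rule measurable_compose[OF measurable_component_singleton[of k]]) auto
  qed auto
  then have ind: "indep_var borel X borel (G \<circ> past k)"
    by (simp add: o_def X_def[abs_def] past_def[abs_def])
  have iX: "integrable M X"
    by (rule integrable_const_bound[where B = 1]) (auto simp: X_def[abs_def] indicator_def)
  have EX: "(\<integral>\<omega>. X \<omega> \<partial>M) = p i"
  proof -
    have "(\<integral>\<omega>. X \<omega> \<partial>M) = (\<integral>\<omega>. indicator {\<omega> \<in> space M. pick k \<omega> = i} \<omega> \<partial>M)"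
      by (intro Bochner_Integration.integral_cong) (auto simp: X_def indicator_def)
    also have "\<dots> = p i" by (simp add: prob_pick)
    finally show ?thesis .
  qed
  have iG: "integrable M (G \<circ> past k)"
    using past_determined_integrable[OF \<phi>] G by (subst Bochner_Integration.integrable_cong[of _ M _ \<phi>]) auto
  have "integrable M (\<lambda>\<omega>. X \<omega> * (G \<circ> past k) \<omega>)"
    by (rule indep_var_integrable[OF ind iX iG])
  then show "integrable M (\<lambda>\<omega>. indicator {i} (pick k \<omega>) * \<phi> \<omega>)"
    using G by (subst Bochner_Integration.integrable_cong[of _ M _ "\<lambda>\<omega>. X \<omega> * (G \<circ> past k) \<omega>"]) (auto simp: X_def)
  have "(\<integral>\<omega>. indicator {i} (pick k \<omega>) * \<phi> \<omega> \<partial>M) = (\<integral>\<omega>. X \<omega> * (G \<circ> past k) \<omega> \<partial>M)"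
    using G by (intro Bochner_Integration.integral_cong) (auto simp: X_def)
  also have "\<dots> = p i * (\<integral>\<omega>. (G \<circ> past k) \<omega> \<partial>M)"
    unfolding indep_var_lebesgue_integral[OF ind iX iG] EX ..
  also have "(\<integral>\<omega>. (G \<circ> past k) \<omega> \<partial>M) = (\<integral>\<omega>. \<phi> \<omega> \<partial>M)"
    using G by (intro Bochner_Integration.integral_cong) auto
  finally show "(\<integral>\<omega>. indicator {i} (pick k \<omega>) * \<phi> \<omega> \<partial>M) = p i * (\<integral>\<omega>. \<phi> \<omega> \<partial>M)" .
qed

text \<open>The conditional expectation given the past, in integrated form: with the history frozen,
  only the next index is averaged.\<close>

lemma expectation_pick:
  fixes \<Phi> :: "'n \<Rightarrow> 'w \<Rightarrow> real"
  assumes \<Phi>: "\<And>i. past_determined k (\<Phi> i)"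
  shows "(\<integral>\<omega>. \<Phi> (pick k \<omega>) \<omega> \<partial>M) = (\<integral>\<omega>. (\<Sum>i\<in>UNIV. p i * \<Phi> i \<omega>) \<partial>M)"
proof -
  have "(\<integral>\<omega>. \<Phi> (pick k \<omega>) \<omega> \<partial>M) = (\<integral>\<omega>. (\<Sum>i\<in>UNIV. indicator {i} (pick k \<omega>) * \<Phi> i \<omega>) \<partial>M)"
    by (intro Bochner_Integration.integral_cong refl) (simp add: indicator_def if_distrib cong: if_cong)
  also have "\<dots> = (\<Sum>i\<in>UNIV. \<integral>\<omega>. indicator {i} (pick k \<omega>) * \<Phi> i \<omega> \<partial>M)"
    by (rule Bochner_Integration.integral_sum) (rule expectation_pick_indicator(1)[OF \<Phi>])
  also have "\<dots> = (\<Sum>i\<in>UNIV. \<integral>\<omega>. p i * \<Phi> i \<omega> \<partial>M)"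
    by (simp add: expectation_pick_indicator(2)[OF \<Phi>])
  also have "\<dots> = (\<integral>\<omega>. (\<Sum>i\<in>UNIV. p i * \<Phi> i \<omega>) \<partial>M)"
    using past_determined_integrable[OF \<Phi>] by (intro Bochner_Integration.integral_sum[symmetric]) simp
  finally show ?thesis .
qed

text \<open>Total mass of the law of the first index, obtained by averaging the constant 1.\<close>

lemma sum_p: "(\<Sum>i\<in>UNIV. p i) = 1"
  using expectation_pick[of 0 "\<lambda>_ _. 1"] by (simp add: past_determined_def prob_space)

end

section \<open>The Lyapunov function\<close>

locale saddle_problem =
  fixes Y :: "'n::finite \<Rightarrow> 'y::{real_inner, banach, second_countable_topology} set"
    and A :: "'n \<Rightarrow> 'x::{real_inner, banach, second_countable_topology} \<Rightarrow> 'y"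
    and f :: "'n \<Rightarrow> 'y \<Rightarrow> ereal"
    and g :: "'x \<Rightarrow> ereal"
    and p :: "'n \<Rightarrow> real"
    and \<beta> :: real
  assumes Y: "\<And>i. subspace (Y i)" "\<And>i. closed (Y i)"
    and A: "\<And>i. bounded_linear (A i)" "\<And>i. range (A i) \<subseteq> Y i"
    and f: "\<And>i. proper_on (Y i) (f i)" "\<And>i. ereal_convex_on (Y i) (f i)"
           "\<And>i. lsc_on (Y i) (f i)"
    and g: "proper_on UNIV g" "ereal_convex_on UNIV g" "lsc_on UNIV g"
    and p_pos: "\<And>i. 0 < p i"
    and p_sum: "(\<Sum>i\<in>UNIV. p i) = 1"
    and \<beta>: "0 < \<beta>" "\<beta> < 1"
begin

abbreviation conj_f :: "'n \<Rightarrow> 'y \<Rightarrow> ereal" where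
  "conj_f i \<equiv> fenchel_conjugate (Y i) (f i)"

abbreviation C :: "('x \<times> ('y ^ 'n)) set" where
  "C \<equiv> saddle_points Y A f g"

lemmas conj_f = fenchel_conjugate_proper_convex_lsc[OF Y f]

lemma A_diff: "A i (u - v) = A i u - A i v"
  using A(1)[of i] by (simp add: bounded_linear.linear linear_diff)

lemma inner_stacked_adjoint: "inner (stacked_adjoint A y) u = (\<Sum>i\<in>UNIV. inner (y $ i) (A i u))"
proof -
  have "inner (adjoint (A i) v) u = inner v (A i u)" for i v
    using adjoint_works_hilbert[OF A(1), of i u v] by (simp add: inner_commute)
  then show ?thesis by (simp add: stacked_adjoint_def inner_sum_left)
qed

definition primal_step :: "real \<Rightarrow> 'x \<Rightarrow> 'y ^ 'n \<Rightarrow> 'x" where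
  "primal_step \<tau> x yb = prox UNIV (\<lambda>u. ereal \<tau> * g u) (x - \<tau> *\<^sub>R stacked_adjoint A yb)"

definition dual_step :: "real \<Rightarrow> 'n \<Rightarrow> 'x \<Rightarrow> 'y \<Rightarrow> 'y" where
  "dual_step \<sigma> i x v = prox (Y i) (\<lambda>w. ereal \<sigma> * conj_f i w) (v + \<sigma> *\<^sub>R A i x)"

text \<open>Optimality of the prox makes the first two terms of the left vector a subgradient of
  \<open>g\<close> at the new point; monotonicity compares it with \<open>\<xi>\<close> at
  \<open>u\<close>.\<close>

lemma primal_step_mono:
  fixes x u :: 'x and yb :: "'y ^ 'n"
  assumes \<tau>: "0 < \<tau>" and \<xi>: "\<xi> \<in> subdifferential UNIV g u"
  defines "x' \<equiv> primal_step \<tau> x yb"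
  shows "0 \<le> inner ((1 / \<tau>) *\<^sub>R (x - x') - stacked_adjoint A yb - \<xi>) (x' - u)"
proof -
  have "(1 / \<tau>) *\<^sub>R ((x - \<tau> *\<^sub>R stacked_adjoint A yb) - x') \<in> subdifferential UNIV g x'"
    unfolding x'_def primal_step_def
    by (rule prox_subdifferential(2)[OF subspace_UNIV closed_UNIV g \<tau> UNIV_I])
  also have "(1 / \<tau>) *\<^sub>R ((x - \<tau> *\<^sub>R stacked_adjoint A yb) - x') = (1 / \<tau>) *\<^sub>R (x - x') - stacked_adjoint A yb"
    using \<tau> by (simp add: algebra_simps)
  finally show ?thesis
    by (rule subdifferential_mono[OF g(1) UNIV_I UNIV_I _ \<xi>])
qed

lemma dual_step_mono:
  fixes x :: 'x and v :: 'y
  assumes \<sigma>: "0 < \<sigma>" and v: "v \<in> Y i"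
  defines "v' \<equiv> dual_step \<sigma> i x v"
  shows "v' \<in> Y i"
    "w \<in> Y i \<Longrightarrow> \<zeta> \<in> subdifferential (Y i) (conj_f i) w \<Longrightarrow>
      0 \<le> inner ((1 / \<sigma>) *\<^sub>R (v - v') + A i x - \<zeta>) (v' - w)"
proof -
  have in_Y: "v + \<sigma> *\<^sub>R A i x \<in> Y i"
    using v Y(1)[of i] A(2)[of i] by (intro subspace_add subspace_scale) auto
  note P = prox_subdifferential[OF Y conj_f \<sigma> in_Y, folded dual_step_def, folded v'_def]
  show "v' \<in> Y i" by (rule P(1))
  have "(1 / \<sigma>) *\<^sub>R ((v + \<sigma> *\<^sub>R A i x) - v') = (1 / \<sigma>) *\<^sub>R (v - v') + A i x"
    using \<sigma> by (simp add: algebra_simps)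
  then show "0 \<le> inner ((1 / \<sigma>) *\<^sub>R (v - v') + A i x - \<zeta>) (v' - w)"
    if "w \<in> Y i" "\<zeta> \<in> subdifferential (Y i) (conj_f i) w"
    using subdifferential_mono[OF conj_f(1) P(1) that(1) P(2) that(2)] by simp
qed

text \<open>The midpoint of \<open>sqrt \<beta>\<close> and 1; \<open>\<delta>\<close> is half the
  length of that interval.\<close>

definition \<kappa> :: real where "\<kappa> = (1 + sqrt \<beta>) / 2"
definition \<delta> :: real where "\<delta> = (1 - sqrt \<beta>) / 2"

lemma \<delta>: "0 < \<delta>" "\<delta> \<le> 1" "\<kappa> \<le> 1" "0 \<le> \<kappa>" "1 - \<kappa> = \<delta>" "\<kappa> - sqrt \<beta> = \<delta>" "\<delta> \<le> 1 - sqrt \<beta>"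
proof -
  have "0 \<le> sqrt \<beta>" "sqrt \<beta> < 1" using \<beta> by auto
  then show "0 < \<delta>" "\<delta> \<le> 1" "\<kappa> \<le> 1" "0 \<le> \<kappa>" "1 - \<kappa> = \<delta>" "\<kappa> - sqrt \<beta> = \<delta>" "\<delta> \<le> 1 - sqrt \<beta>"
    by (auto simp: \<delta>_def \<kappa>_def field_simps)
qed

text \<open>\<open>a\<close> and \<open>b\<close> stand for \<open>1 / \<tau>\<close> and \<open>1 / \<sigma>\<close>. When the
  operator that couples a step-size to the others vanishes, the step-size may be unbounded; its weight
  is then 1 instead. The vector \<open>d\<close> is the last dual increment.\<close>

definition energy :: "real \<Rightarrow> ('n \<Rightarrow> real) \<Rightarrow> 'x \<times> ('y ^ 'n) \<Rightarrow> 'x \<Rightarrow> 'y ^ 'n \<Rightarrow> 'y ^ 'n \<Rightarrow> real" where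
  "energy a b z x y d = a * (norm (x - fst z))\<^sup>2
    + (\<Sum>i\<in>UNIV. b i / p i * ((norm (y $ i - snd z $ i))\<^sup>2 + \<kappa> * (norm (d $ i))\<^sup>2))"

text \<open>The correction is the error of the extrapolation: \<open>ybar - y\<close> has components
  \<open>d $ i / p i\<close>, and the primal step sees it paired with
  \<open>A i (x - fst z)\<close>.\<close>

definition lyapunov :: "real \<Rightarrow> ('n \<Rightarrow> real) \<Rightarrow> 'x \<times> ('y ^ 'n) \<Rightarrow> 'x \<Rightarrow> 'y ^ 'n \<Rightarrow> 'y ^ 'n \<Rightarrow> real" where
  "lyapunov a b z x y d = energy a b z x y d
    - 2 * (\<Sum>i\<in>UNIV. inner (A i (x - fst z)) (d $ i) / p i)"

text \<open>The step-size bound expressed through the reciprocals and multiplied out, so that it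
  also makes sense for weights that have been replaced by 1.\<close>

definition coupled_weights :: "real \<Rightarrow> ('n \<Rightarrow> real) \<Rightarrow> bool" where
  "coupled_weights a b \<longleftrightarrow> 0 < a \<and> (\<forall>i. 0 < b i \<and> (onorm (A i))\<^sup>2 / p i \<le> \<beta> * (a * b i))"

text \<open>Since \<open>d\<close> lives in one block, the sum is a single inner product, to which
  Cauchy-Schwarz, the weight condition for that block and the arithmetic-geometric mean inequality
  apply.\<close>

lemma coupling_bound:
  assumes w: "coupled_weights a b" and d: "\<And>i. i \<noteq> j \<Longrightarrow> d $ i = 0"
  shows "\<bar>2 * (\<Sum>i\<in>UNIV. inner (A i u) (d $ i) / p i)\<bar>
    \<le> sqrt \<beta> * (a * (norm u)\<^sup>2 + (\<Sum>i\<in>UNIV. b i / p i * (norm (d $ i))\<^sup>2))"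
proof -
  have a: "0 < a" and b: "0 < b j" and N: "(onorm (A j))\<^sup>2 / p j \<le> \<beta> * (a * b j)"
    using w unfolding coupled_weights_def by auto
  have single: "(\<Sum>i\<in>UNIV. h i) = h j" if "\<And>i. i \<noteq> j \<Longrightarrow> h i = 0" for h :: "'n \<Rightarrow> real"
    using that by (subst sum.remove[of _ j]) (auto intro!: sum.neutral)
  define P where "P = a * (norm u)\<^sup>2"
  define Q where "Q = b j / p j * (norm (d $ j))\<^sup>2"
  have PQ: "0 \<le> P" "0 \<le> Q" using a b p_pos[of j] by (auto simp: P_def Q_def)
  define t where "t = inner (A j u) (d $ j) / p j"
  have "\<bar>inner (A j u) (d $ j)\<bar> \<le> onorm (A j) * norm u * norm (d $ j)"
    using Cauchy_Schwarz_ineq2[of "A j u" "d $ j"] mult_right_mono[OF onorm[OF A(1), of j u] norm_ge_zero[of "d $ j"]]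
    by linarith
  then have "\<bar>inner (A j u) (d $ j)\<bar>\<^sup>2 \<le> (onorm (A j) * norm u * norm (d $ j))\<^sup>2"
    by (intro power_mono) auto
  then have "t\<^sup>2 \<le> (onorm (A j) * norm u * norm (d $ j))\<^sup>2 / (p j)\<^sup>2"
    using p_pos[of j] by (simp add: t_def power_divide divide_right_mono)
  also have "\<dots> = ((onorm (A j))\<^sup>2 / p j) * ((norm u)\<^sup>2 * (norm (d $ j))\<^sup>2 / p j)"
    by (simp add: power_mult_distrib power2_eq_square)
  also have "\<dots> \<le> (\<beta> * (a * b j)) * ((norm u)\<^sup>2 * (norm (d $ j))\<^sup>2 / p j)"
    using p_pos[of j] by (intro mult_right_mono N) auto
  also have "\<dots> = \<beta> * (P * Q)" by (simp add: P_def Q_def)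
  \<comment> \<open>\<open>4 P Q\<close> is at most the square of \<open>P + Q\<close>; this is
    where the factor 2 in front of the coupling is used up.\<close>
  also have "4 * (\<beta> * (P * Q)) \<le> \<beta> * (P + Q)\<^sup>2"
    using \<beta> zero_le_power2[of "P - Q"] by (simp add: power2_sum power2_diff)
  finally have "(2 * t)\<^sup>2 \<le> (sqrt \<beta> * (P + Q))\<^sup>2"
    using \<beta> by (simp add: power_mult_distrib)
  then have "\<bar>2 * t\<bar> \<le> sqrt \<beta> * (P + Q)"
    using PQ \<beta> by (intro power2_le_imp_le[of "\<bar>2 * t\<bar>"]) auto
  moreover have "(\<Sum>i\<in>UNIV. inner (A i u) (d $ i) / p i) = t"
    unfolding t_def by (rule single) (simp add: d)
  moreover have "(\<Sum>i\<in>UNIV. b i / p i * (norm (d $ i))\<^sup>2) = Q"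
    unfolding Q_def by (rule single) (simp add: d)
  ultimately show ?thesis by (simp add: P_def)
qed

lemma energy_split:
  "energy a b z x y d = a * (norm (x - fst z))\<^sup>2 + (\<Sum>i\<in>UNIV. b i / p i * (norm (y $ i - snd z $ i))\<^sup>2)
    + \<kappa> * (\<Sum>i\<in>UNIV. b i / p i * (norm (d $ i))\<^sup>2)"
  by (simp add: energy_def distrib_left sum.distrib sum_distrib_left mult.left_commute)

text \<open>The coupling takes the fraction \<open>sqrt \<beta>\<close> of the primal square and of
  the increment square. What remains has coefficients \<open>1 - sqrt \<beta>\<close>, 1 and
  \<open>\<kappa> - sqrt \<beta>\<close>, each enough for \<open>\<delta>\<close> times the
  energy.\<close>

lemma energy_le_lyapunov:
  assumes w: "coupled_weights a b" and d: "\<And>i. i \<noteq> j \<Longrightarrow> d $ i = 0"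
  shows "\<delta> * energy a b z x y d \<le> lyapunov a b z x y d"
proof -
  have pos: "0 < a" "\<And>i. 0 < b i" using w unfolding coupled_weights_def by auto
  define X where "X = a * (norm (x - fst z))\<^sup>2"
  define U where "U = (\<Sum>i\<in>UNIV. b i / p i * (norm (y $ i - snd z $ i))\<^sup>2)"
  define D where "D = (\<Sum>i\<in>UNIV. b i / p i * (norm (d $ i))\<^sup>2)"
  have nn: "0 \<le> X" "0 \<le> U" "0 \<le> D"
    using pos p_pos unfolding X_def U_def D_def
    by (intro sum_nonneg mult_nonneg_nonneg divide_nonneg_nonneg zero_le_power2 less_imp_le; simp)+
  have "\<bar>2 * (\<Sum>i\<in>UNIV. inner (A i (x - fst z)) (d $ i) / p i)\<bar> \<le> sqrt \<beta> * (X + D)"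
    unfolding X_def D_def by (rule coupling_bound[OF w d])
  then have "X + U + \<kappa> * D - sqrt \<beta> * (X + D) \<le> lyapunov a b z x y d"
    unfolding lyapunov_def energy_split X_def[symmetric] U_def[symmetric] D_def[symmetric] by linarith
  moreover have "\<delta> * X \<le> (1 - sqrt \<beta>) * X" "\<delta> * U \<le> 1 * U" "\<delta> * (\<kappa> * D) \<le> \<delta> * D"
    using \<delta> nn by (auto intro!: mult_right_mono mult_left_mono mult_left_le_one_le)
  moreover have "\<delta> * D = \<kappa> * D - sqrt \<beta> * D" unfolding \<delta>(6)[symmetric] by (simp add: left_diff_distrib)
  ultimately show ?thesis
    unfolding energy_split X_def[symmetric] U_def[symmetric] D_def[symmetric]
    by (simp add: algebra_simps)
qed

lemma energy_nonneg:
  assumes "coupled_weights a b"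
  shows "0 \<le> energy a b z x y d"
  using assms p_pos \<delta> unfolding energy_def coupled_weights_def
  by (intro add_nonneg_nonneg sum_nonneg mult_nonneg_nonneg) (auto intro!: divide_nonneg_nonneg less_imp_le)

text \<open>The coupling contains no weights, so a change of weights only adds
  \<open>\<epsilon>\<close> times the energy, and the energy is at most the Lyapunov function
  divided by \<open>\<delta>\<close>.\<close>

lemma lyapunov_weights_mono:
  assumes w: "coupled_weights a b" and d: "\<And>i. i \<noteq> j \<Longrightarrow> d $ i = 0"
    and \<epsilon>: "0 \<le> \<epsilon>" and le: "a' \<le> (1 + \<epsilon>) * a" "\<And>i. b' i \<le> (1 + \<epsilon>) * b i"
  shows "lyapunov a' b' z x y d \<le> (1 + \<epsilon> / \<delta>) * lyapunov a b z x y d"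
proof -
  have "energy a' b' z x y d \<le> (1 + \<epsilon>) * a * (norm (x - fst z))\<^sup>2
      + (\<Sum>i\<in>UNIV. (1 + \<epsilon>) * b i / p i * ((norm (y $ i - snd z $ i))\<^sup>2 + \<kappa> * (norm (d $ i))\<^sup>2))"
    unfolding energy_def using le p_pos \<delta>(4)
    by (intro add_mono sum_mono mult_right_mono divide_right_mono) (auto intro: less_imp_le)
  also have "\<dots> = (1 + \<epsilon>) * energy a b z x y d"
    by (simp add: energy_def sum_distrib_left distrib_left mult.assoc)
  finally have "lyapunov a' b' z x y d \<le> lyapunov a b z x y d + \<epsilon> * energy a b z x y d"
    by (simp add: lyapunov_def distrib_right)
  moreover have "energy a b z x y d \<le> lyapunov a b z x y d / \<delta>"
    using energy_le_lyapunov[OF w d] \<delta>(1) by (simp add: pos_le_divide_eq mult.commute)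
  then have "\<epsilon> * energy a b z x y d \<le> \<epsilon> * (lyapunov a b z x y d / \<delta>)"
    using \<epsilon> by (rule mult_left_mono)
  ultimately show ?thesis by (simp add: distrib_right)
qed

lemma norm_diff_three_points:
  fixes u v w :: "'z::real_inner"
  shows "2 * inner (u - v) (v - w) = (norm (u - w))\<^sup>2 - (norm (v - w))\<^sup>2 - (norm (v - u))\<^sup>2"
  by (simp add: power2_norm_eq_inner inner_diff inner_commute)

definition replace :: "'n \<Rightarrow> 'y ^ 'n \<Rightarrow> 'y ^ 'n \<Rightarrow> 'y ^ 'n" where
  "replace i v y = (\<chi> j. if j = i then v $ j else y $ j)"

text \<open>\<open>v\<close> holds the prox candidates of all blocks, and the left side is the mean
  over the block that is taken. The factors \<open>1 / p i\<close> in the energy cancel the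
  probabilities, so the averaged dual inequalities carry exactly the term
  \<open>inner (G i) (y $ i - y1 $ i)\<close> that the primal inequality has with the opposite
  sign.\<close>

lemma lyapunov_step:
  fixes x :: 'x and y yb d :: "'y ^ 'n" and \<tau> :: real and \<sigma> :: "'n \<Rightarrow> real"
  assumes z: "z \<in> C" and y: "\<And>i. y $ i \<in> Y i"
    and steps: "0 < \<tau>" "\<And>i. 0 < \<sigma> i"
    and w: "coupled_weights a b" and d: "\<And>i. i \<noteq> j \<Longrightarrow> d $ i = 0"
    and a\<tau>: "a * \<tau> = 1 \<or> (\<forall>i u. A i u = 0)" and b\<sigma>: "\<And>i. b i * \<sigma> i = 1 \<or> (\<forall>u. A i u = 0)"
    and yb: "\<And>i. yb $ i = y $ i + (1 / p i) *\<^sub>R d $ i"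
  defines "x' \<equiv> primal_step \<tau> x yb"
  defines "v \<equiv> \<chi> i. dual_step (\<sigma> i) i x' (y $ i)"
  shows "(\<Sum>i\<in>UNIV. p i * lyapunov a b z x' (replace i v y) (replace i (v - y) 0))
    \<le> lyapunov a b z x y d - \<delta> * (a * (norm (x' - x))\<^sup>2 + (\<Sum>i\<in>UNIV. b i * (norm (v $ i - y $ i))\<^sup>2))"
proof -
  obtain x1 y1 where z_eq: "z = (x1, y1)" by (cases z)
  have y1: "\<And>i. y1 $ i \<in> Y i" "\<And>i. A i x1 \<in> subdifferential (Y i) (conj_f i) (y1 $ i)"
      "- stacked_adjoint A y1 \<in> subdifferential UNIV g x1"
    using z by (auto simp: saddle_points_def z_eq)
  have pos: "0 < a" "\<And>i. 0 < b i" using w unfolding coupled_weights_def by auto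
  define G where "G i = A i (x' - x1)" for i
  have primal: "a * (norm (x' - x1))\<^sup>2 \<le> a * (norm (x - x1))\<^sup>2 - a * (norm (x' - x))\<^sup>2
      - 2 * (\<Sum>i\<in>UNIV. inner (G i) (y $ i - y1 $ i)) - 2 * (\<Sum>i\<in>UNIV. inner (G i) (d $ i) / p i)"
  proof -
    have "0 \<le> inner ((1 / \<tau>) *\<^sub>R (x - x') - stacked_adjoint A yb - - stacked_adjoint A y1) (x' - x1)"
      unfolding x'_def by (rule primal_step_mono[OF steps(1) y1(3)])
    then have "0 \<le> inner (x - x') (x' - x1) / \<tau> - (\<Sum>i\<in>UNIV. inner (yb $ i - y1 $ i) (G i))"
      by (simp add: inner_diff_left inner_add_left inner_stacked_adjoint sum_subtractf G_def)
    then have "0 \<le> (a * \<tau>) * (inner (x - x') (x' - x1) / \<tau> - (\<Sum>i\<in>UNIV. inner (yb $ i - y1 $ i) (G i)))"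
      using pos(1) steps(1) by (intro mult_nonneg_nonneg) auto
    also have "\<dots> = a * inner (x - x') (x' - x1) - (a * \<tau>) * (\<Sum>i\<in>UNIV. inner (yb $ i - y1 $ i) (G i))"
      using steps(1) by (simp add: right_diff_distrib)
    also have "(a * \<tau>) * (\<Sum>i\<in>UNIV. inner (yb $ i - y1 $ i) (G i)) = (\<Sum>i\<in>UNIV. inner (yb $ i - y1 $ i) (G i))"
      using a\<tau> by (auto simp: G_def)
    also have "\<dots> = (\<Sum>i\<in>UNIV. inner (G i) (y $ i - y1 $ i)) + (\<Sum>i\<in>UNIV. inner (G i) (d $ i) / p i)"
      unfolding sum.distrib[symmetric] by (intro sum.cong) (simp_all add: yb inner_commute inner_add inner_diff)
    finally have "(\<Sum>i\<in>UNIV. inner (G i) (y $ i - y1 $ i)) + (\<Sum>i\<in>UNIV. inner (G i) (d $ i) / p i)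
        \<le> a * inner (x - x') (x' - x1)" by simp
    moreover have "a * (2 * inner (x - x') (x' - x1)) =
        a * (norm (x - x1))\<^sup>2 - a * (norm (x' - x1))\<^sup>2 - a * (norm (x' - x))\<^sup>2"
      unfolding norm_diff_three_points by (simp add: right_diff_distrib)
    ultimately show ?thesis by linarith
  qed
  \<comment> \<open>\<open>T i\<close> is \<open>p i\<close> times the change that replacing block
    \<open>i\<close> makes in the dual part, including the new increment and its coupling.\<close>
  define T where "T i = b i * ((norm (v $ i - y1 $ i))\<^sup>2 - (norm (y $ i - y1 $ i))\<^sup>2
      + \<kappa> * (norm (v $ i - y $ i))\<^sup>2) - 2 * inner (G i) (v $ i - y $ i)" for i
  have T: "T i \<le> 2 * inner (G i) (y $ i - y1 $ i) - \<delta> * (b i * (norm (v $ i - y $ i))\<^sup>2)" for i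
  proof -
    have "0 \<le> inner ((1 / \<sigma> i) *\<^sub>R (y $ i - v $ i) + A i x' - A i x1) (v $ i - y1 $ i)"
      unfolding v_def vec_lambda_beta by (rule dual_step_mono(2)[OF steps(2) y y1(1,2)])
    then have "0 \<le> inner (y $ i - v $ i) (v $ i - y1 $ i) / \<sigma> i + inner (G i) (v $ i - y1 $ i)"
      by (simp add: inner_diff_left inner_add_left A_diff G_def)
    then have "0 \<le> (b i * \<sigma> i) * (inner (y $ i - v $ i) (v $ i - y1 $ i) / \<sigma> i + inner (G i) (v $ i - y1 $ i))"
      using pos(2)[of i] steps(2)[of i] by (intro mult_nonneg_nonneg) auto
    also have "\<dots> = b i * inner (y $ i - v $ i) (v $ i - y1 $ i) + (b i * \<sigma> i) * inner (G i) (v $ i - y1 $ i)"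
      using steps(2)[of i] by (simp add: distrib_left)
    also have "(b i * \<sigma> i) * inner (G i) (v $ i - y1 $ i) = inner (G i) (v $ i - y1 $ i)"
      using b\<sigma>[of i] by (auto simp: G_def)
    finally have "0 \<le> b i * (2 * inner (y $ i - v $ i) (v $ i - y1 $ i)) + 2 * inner (G i) (v $ i - y1 $ i)"
      by simp
    moreover have "inner (G i) (v $ i - y1 $ i) = inner (G i) (v $ i - y $ i) + inner (G i) (y $ i - y1 $ i)"
      by (simp add: inner_diff_right)
    \<comment> \<open>The prox inequality yields the full square of the increment; storing the
      fraction \<open>\<kappa>\<close> of it in the new Lyapunov function leaves
      \<open>\<delta>\<close> as decrease.\<close>
    moreover have "\<kappa> * (b i * (norm (v $ i - y $ i))\<^sup>2) = b i * (norm (v $ i - y $ i))\<^sup>2 - \<delta> * (b i * (norm (v $ i - y $ i))\<^sup>2)"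
      unfolding \<delta>(5)[symmetric] by (simp add: left_diff_distrib)
    ultimately show ?thesis
      unfolding T_def norm_diff_three_points by (simp add: right_diff_distrib distrib_left mult.left_commute)
  qed
  define U where "U = (\<Sum>i\<in>UNIV. b i / p i * (norm (y $ i - y1 $ i))\<^sup>2)"
  have expand: "p i * lyapunov a b z x' (replace i v y) (replace i (v - y) 0)
      = p i * (a * (norm (x' - x1))\<^sup>2 + U) + T i" for i
  proof -
    have 1: "(\<Sum>j\<in>UNIV. b j / p j * (norm (replace i v y $ j - y1 $ j))\<^sup>2)
        = U + b i / p i * ((norm (v $ i - y1 $ i))\<^sup>2 - (norm (y $ i - y1 $ i))\<^sup>2)"
    proof -
      have "(\<Sum>j\<in>UNIV. b j / p j * (norm (replace i v y $ j - y1 $ j))\<^sup>2) =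
        (\<Sum>j\<in>UNIV. b j / p j * (norm (y $ j - y1 $ j))\<^sup>2 +
          (if j = i then b j / p j * ((norm (v $ j - y1 $ j))\<^sup>2 - (norm (y $ j - y1 $ j))\<^sup>2) else 0))"
        by (intro sum.cong) (auto simp: replace_def right_diff_distrib)
      then show ?thesis by (simp add: sum.distrib U_def)
    qed
    have 2: "(\<Sum>j\<in>UNIV. b j / p j * (norm (replace i (v - y) 0 $ j))\<^sup>2) = b i / p i * (norm (v $ i - y $ i))\<^sup>2"
      by (simp add: replace_def if_distrib[of norm] if_distrib[of "\<lambda>t. t\<^sup>2"] if_distrib[of "\<lambda>t. _ * t"] cong: if_cong)
    have 3: "(\<Sum>j\<in>UNIV. inner (A j (x' - x1)) (replace i (v - y) 0 $ j) / p j) = inner (G i) (v $ i - y $ i) / p i"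
      by (simp add: replace_def G_def if_distrib[of "inner _"] if_distrib[of "\<lambda>t. t / _"] cong: if_cong)
    have "p i \<noteq> 0" using p_pos[of i] by simp
    then show ?thesis
      unfolding lyapunov_def energy_split z_eq fst_conv snd_conv 1 2 3 T_def
      by (simp add: field_simps)
  qed
  have "(\<Sum>i\<in>UNIV. p i * lyapunov a b z x' (replace i v y) (replace i (v - y) 0))
      = a * (norm (x' - x1))\<^sup>2 + U + (\<Sum>i\<in>UNIV. T i)"
    unfolding expand sum.distrib sum_distrib_right[symmetric] p_sum by simp
  also have "(\<Sum>i\<in>UNIV. T i) \<le> (\<Sum>i\<in>UNIV. 2 * inner (G i) (y $ i - y1 $ i) - \<delta> * (b i * (norm (v $ i - y $ i))\<^sup>2))"
    by (intro sum_mono T)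
  also have "\<dots> = 2 * (\<Sum>i\<in>UNIV. inner (G i) (y $ i - y1 $ i)) - \<delta> * (\<Sum>i\<in>UNIV. b i * (norm (v $ i - y $ i))\<^sup>2)"
    by (simp add: sum_subtractf sum_distrib_left)
  finally have up: "(\<Sum>i\<in>UNIV. p i * lyapunov a b z x' (replace i v y) (replace i (v - y) 0))
    \<le> a * (norm (x - x1))\<^sup>2 - a * (norm (x' - x))\<^sup>2 + U - 2 * (\<Sum>i\<in>UNIV. inner (G i) (d $ i) / p i)
      - \<delta> * (\<Sum>i\<in>UNIV. b i * (norm (v $ i - y $ i))\<^sup>2)"
    using primal by linarith
  define D where "D = (\<Sum>i\<in>UNIV. b i / p i * (norm (d $ i))\<^sup>2)"
  have D: "0 \<le> D"
    unfolding D_def using pos p_pos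
    by (intro sum_nonneg mult_nonneg_nonneg divide_nonneg_nonneg zero_le_power2 less_imp_le)
  \<comment> \<open>The part at the old point \<open>x\<close> is the correction in the old Lyapunov
    function. The part along \<open>x' - x\<close> is absorbed by the primal decrease and by the
    stored squares of \<open>d\<close>.\<close>
  have G_split: "(\<Sum>i\<in>UNIV. inner (G i) (d $ i) / p i) =
      (\<Sum>i\<in>UNIV. inner (A i (x' - x)) (d $ i) / p i) + (\<Sum>i\<in>UNIV. inner (A i (x - x1)) (d $ i) / p i)"
  proof -
    have "G i = A i (x' - x) + A i (x - x1)" for i by (simp add: G_def A_diff)
    then show ?thesis by (simp add: inner_add_left add_divide_distrib sum.distrib)
  qed
  have "\<bar>2 * (\<Sum>i\<in>UNIV. inner (A i (x' - x)) (d $ i) / p i)\<bar> \<le> sqrt \<beta> * (a * (norm (x' - x))\<^sup>2 + D)"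
    unfolding D_def by (rule coupling_bound[OF w d])
  moreover have "lyapunov a b z x y d = a * (norm (x - x1))\<^sup>2 + U + \<kappa> * D
      - 2 * (\<Sum>i\<in>UNIV. inner (A i (x - x1)) (d $ i) / p i)"
    unfolding lyapunov_def energy_split z_eq fst_conv snd_conv U_def D_def ..
  moreover have "\<delta> * D = \<kappa> * D - sqrt \<beta> * D" unfolding \<delta>(6)[symmetric] by (simp add: left_diff_distrib)
  moreover have "0 \<le> \<delta> * D" using \<delta>(1) D by simp
  moreover have "\<delta> * (a * (norm (x' - x))\<^sup>2) \<le> (1 - sqrt \<beta>) * (a * (norm (x' - x))\<^sup>2)"
    using \<delta> pos by (intro mult_right_mono) auto
  ultimately show ?thesis
    using up unfolding G_split by (simp add: distrib_left left_diff_distrib)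
qed

end

section \<open>Convergence along one path\<close>

lemma tendsto_inner_weak_strong:
  fixes w e :: "nat \<Rightarrow> 'a::real_inner"
  assumes w: "bounded (range w)" and e: "e \<longlonglongrightarrow> 0"
  shows "(\<lambda>k. inner (e k) (w k)) \<longlonglongrightarrow> 0"
proof -
  obtain b where b: "\<And>k. norm (w k) \<le> b" using w unfolding bounded_iff by auto
  show ?thesis
  proof (rule Lim_null_comparison)
    show "\<forall>\<^sub>F k in sequentially. norm (inner (e k) (w k)) \<le> norm (e k) * b"
      by (intro always_eventually allI)
        (simp add: order.trans[OF Cauchy_Schwarz_ineq2 mult_left_mono[OF b norm_ge_zero]])
    show "(\<lambda>k. norm (e k) * b) \<longlonglongrightarrow> 0"
      using tendsto_mult_right[OF tendsto_norm_zero[OF e], of b] by simp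
  qed
qed

lemma tendsto_scaleR_Bseq:
  fixes e :: "nat \<Rightarrow> 'a::real_normed_vector" and c :: "nat \<Rightarrow> real"
  assumes c: "Bseq c" and e: "e \<longlonglongrightarrow> 0"
  shows "(\<lambda>k. c k *\<^sub>R e k) \<longlonglongrightarrow> 0"
proof -
  obtain K where K: "\<And>k. norm (c k) \<le> K" using c unfolding Bseq_def by blast
  show ?thesis
  proof (rule Lim_null_comparison)
    show "\<forall>\<^sub>F k in sequentially. norm (c k *\<^sub>R e k) \<le> K * norm (e k)"
      using mult_right_mono[OF K norm_ge_zero] by (intro always_eventually allI) simp
    show "(\<lambda>k. K * norm (e k)) \<longlonglongrightarrow> 0"
      using tendsto_mult_left[OF tendsto_norm_zero[OF e], of K] by simp
  qed
qed

lemma weakly_convergent_to_plus_null: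
  assumes w: "weakly_convergent_to w l" and e: "(\<lambda>k. w' k - w k) \<longlonglongrightarrow> 0"
  shows "weakly_convergent_to w' l"
  unfolding weakly_convergent_to_def
proof
  fix v
  have "(\<lambda>k. inner (w' k - w k) v + inner (w k) v) \<longlonglongrightarrow> inner 0 v + inner l v"
    using w by (intro tendsto_add[OF tendsto_inner[OF e tendsto_const]]) (simp add: weakly_convergent_to_def)
  then show "(\<lambda>k. inner (w' k) v) \<longlonglongrightarrow> inner l v"
    by (simp add: inner_diff_left)
qed

lemma bounded_plus_null:
  fixes w w' :: "nat \<Rightarrow> 'a::real_normed_vector"
  assumes w: "bounded (range w)" and e: "(\<lambda>k. w' k - w k) \<longlonglongrightarrow> 0"
  shows "bounded (range w')"
proof -
  have "Bseq (\<lambda>k. w' k - w k)" using e by (intro convergent_imp_Bseq convergentI)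
  then obtain c where c: "\<And>k. norm (w' k - w k) \<le> c" unfolding Bseq_def by blast
  obtain b where b: "\<And>k. norm (w k) \<le> b" using w unfolding bounded_iff by auto
  have "norm (w' k) \<le> c + b" for k
    using norm_triangle_ineq[of "w' k - w k" "w k"] b[of k] c[of k] by simp
  then show ?thesis unfolding bounded_iff by auto
qed

lemma weakly_convergent_to_fst:
  "weakly_convergent_to w l \<Longrightarrow> weakly_convergent_to (\<lambda>k. fst (w k)) (fst l)"
  unfolding weakly_convergent_to_def
proof
  fix v assume "\<forall>v. (\<lambda>k. inner (w k) v) \<longlonglongrightarrow> inner l v"
  from spec[OF this, of "(v, 0)"] show "(\<lambda>k. inner (fst (w k)) v) \<longlonglongrightarrow> inner (fst l) v"
    by (simp add: inner_prod_def)
qed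

lemma weakly_convergent_to_snd:
  "weakly_convergent_to w l \<Longrightarrow> weakly_convergent_to (\<lambda>k. snd (w k)) (snd l)"
  unfolding weakly_convergent_to_def
proof
  fix v assume "\<forall>v. (\<lambda>k. inner (w k) v) \<longlonglongrightarrow> inner l v"
  from spec[OF this, of "(0, v)"] show "(\<lambda>k. inner (snd (w k)) v) \<longlonglongrightarrow> inner (snd l) v"
    by (simp add: inner_prod_def)
qed

lemma weakly_convergent_to_component:
  fixes w :: "nat \<Rightarrow> 'a::real_inner ^ 'n::finite"
  shows "weakly_convergent_to w l \<Longrightarrow> weakly_convergent_to (\<lambda>k. w k $ i) (l $ i)"
  unfolding weakly_convergent_to_def
proof
  fix v assume "\<forall>v. (\<lambda>k. inner (w k) v) \<longlonglongrightarrow> inner l v"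
  from spec[OF this, of "axis i v"] show "(\<lambda>k. inner (w k $ i) v) \<longlonglongrightarrow> inner (l $ i) v"
    by (simp add: inner_axis)
qed

context saddle_problem
begin

text \<open>Minty's argument: monotonicity is tested at the proximal points of the limit, where the
  limiting inequality says that minus a sum of squares is nonnegative. The bilinear terms in the two
  sequences cancel, so only weak convergence is needed.\<close>

lemma weak_cluster_point_is_saddle:
  fixes X X' :: "nat \<Rightarrow> 'x" and V V' yb :: "nat \<Rightarrow> 'y ^ 'n"
  assumes X': "\<And>k. X' k = primal_step (\<tau> k) (X k) (yb k)"
    and V': "\<And>k i. V' k $ i = dual_step (\<sigma> k i) i (X' k) (V k $ i)"
    and V: "\<And>k i. V k $ i \<in> Y i"
    and pos: "\<And>k. 0 < \<tau> k" "\<And>k i. 0 < \<sigma> k i"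
    and inv: "Bseq (\<lambda>k. 1 / \<tau> k)" "\<And>i. Bseq (\<lambda>k. 1 / \<sigma> k i)"
    and null: "(\<lambda>k. X' k - X k) \<longlonglongrightarrow> 0" "(\<lambda>k. V' k - V k) \<longlonglongrightarrow> 0" "(\<lambda>k. yb k - V k) \<longlonglongrightarrow> 0"
    and bdd: "bounded (range X)" "bounded (range V)"
    and weak: "weakly_convergent_to X \<xi>" "weakly_convergent_to V \<upsilon>"
  shows "(\<xi>, \<upsilon>) \<in> C"
proof -
  have \<upsilon>: "\<upsilon> $ i \<in> Y i" for i
    using V by (rule weak_limit_in_closed_subspace[OF Y _ weakly_convergent_to_component[OF weak(2)]])
  have weak': "weakly_convergent_to X' \<xi>" "weakly_convergent_to V' \<upsilon>"
    using weakly_convergent_to_plus_null weak null by blast+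
  have bdd': "bounded (range X')" "bounded (range V')"
    using bounded_plus_null bdd null by blast+
  \<comment> \<open>\<open>u\<close> and \<open>w\<close> are proximal points built from the limit.
    The limit is a saddle point once it coincides with them, because their optimality conditions
    then become the saddle conditions.\<close>
  define u where "u = prox UNIV (\<lambda>v. ereal 1 * g v) (\<xi> - stacked_adjoint A \<upsilon>)"
  have u: "\<xi> - stacked_adjoint A \<upsilon> - u \<in> subdifferential UNIV g u"
    using prox_subdifferential(2)[OF subspace_UNIV closed_UNIV g zero_less_one UNIV_I]
    by (simp add: u_def)
  define w where "w i = prox (Y i) (\<lambda>v. ereal 1 * conj_f i v) (\<upsilon> $ i + A i \<xi>)" for i
  have in_Y: "\<upsilon> $ i + A i \<xi> \<in> Y i" for i
    using \<upsilon> A(2)[of i] Y(1)[of i] by (intro subspace_add) auto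
  have w: "w i \<in> Y i" "\<upsilon> $ i + A i \<xi> - w i \<in> subdifferential (Y i) (conj_f i) (w i)" for i
    using prox_subdifferential[OF Y conj_f zero_less_one in_Y[of i]] by (simp_all add: w_def)
  define r where "r k = (1 / \<tau> k) *\<^sub>R (X k - X' k)" for k
  define s where "s k i = (1 / \<sigma> k i) *\<^sub>R (V k $ i - V' k $ i)" for k i
  define e where "e k = yb k - V' k" for k
  have "(\<lambda>k. X k - X' k) \<longlonglongrightarrow> 0" using tendsto_minus[OF null(1)] by simp
  then have r0: "r \<longlonglongrightarrow> 0"
    unfolding r_def by (rule tendsto_scaleR_Bseq[OF inv(1)])
  have "(\<lambda>k. V k $ i - V' k $ i) \<longlonglongrightarrow> 0" for i
    using tendsto_vec_nth[OF tendsto_minus[OF null(2)], of i] by simp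
  then have s0: "(\<lambda>k. s k i) \<longlonglongrightarrow> 0" for i
    unfolding s_def by (rule tendsto_scaleR_Bseq[OF inv(2)])
  have "(\<lambda>k. (yb k - V k) - (V' k - V k)) \<longlonglongrightarrow> 0 - 0"
    by (intro tendsto_diff null)
  then have "e \<longlonglongrightarrow> 0" by (simp add: e_def[abs_def])
  then have e0: "(\<lambda>k. e k $ i) \<longlonglongrightarrow> 0" for i
    using tendsto_vec_nth[of e 0] by simp
  \<comment> \<open>The sum of the monotonicity inequalities after the terms pairing
    \<open>A i (X' k)\<close> with \<open>V' k $ i\<close> have cancelled. Each remaining inner
    product pairs a null sequence with a bounded one, or is affine in one weakly convergent
    sequence.\<close>
  define T where "T k = inner (r k) (X' k - u) - (\<Sum>i\<in>UNIV. inner (e k $ i) (A i (X' k - u)))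
      + (\<Sum>i\<in>UNIV. inner (s k i) (V' k $ i - w i))
      - inner (\<xi> - stacked_adjoint A \<upsilon> - u) (X' k - u)
      - (\<Sum>i\<in>UNIV. inner (\<upsilon> $ i + A i \<xi> - w i) (V' k $ i - w i))
      + (\<Sum>i\<in>UNIV. inner (V' k $ i) (A i u)) - (\<Sum>i\<in>UNIV. inner (A i (X' k)) (w i))" for k
  have T_nonneg: "0 \<le> T k" for k
  proof -
    have "0 \<le> inner (r k - stacked_adjoint A (yb k) - (\<xi> - stacked_adjoint A \<upsilon> - u)) (X' k - u)"
      unfolding r_def X' by (rule primal_step_mono[OF pos(1) u])
    moreover have "0 \<le> (\<Sum>i\<in>UNIV. inner (s k i + A i (X' k) - (\<upsilon> $ i + A i \<xi> - w i)) (V' k $ i - w i))"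
      unfolding s_def V' by (intro sum_nonneg dual_step_mono(2)[OF pos(2) V w])
    moreover have "inner (r k - stacked_adjoint A (yb k) - (\<xi> - stacked_adjoint A \<upsilon> - u)) (X' k - u)
      + (\<Sum>i\<in>UNIV. inner (s k i + A i (X' k) - (\<upsilon> $ i + A i \<xi> - w i)) (V' k $ i - w i)) = T k"
    proof -
      have 1: "inner (r k - stacked_adjoint A (yb k) - (\<xi> - stacked_adjoint A \<upsilon> - u)) (X' k - u)
        = inner (r k) (X' k - u) - (\<Sum>i\<in>UNIV. inner (yb k $ i) (A i (X' k - u)))
          - inner (\<xi> - stacked_adjoint A \<upsilon> - u) (X' k - u)"
        unfolding inner_diff_left[of "r k - _"] inner_diff_left[of "r k"] inner_stacked_adjoint ..
      have 2: "(\<Sum>i\<in>UNIV. inner (yb k $ i) (A i (X' k - u))) = (\<Sum>i\<in>UNIV. inner (e k $ i) (A i (X' k - u)))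
        + (\<Sum>i\<in>UNIV. inner (A i (X' k)) (V' k $ i)) - (\<Sum>i\<in>UNIV. inner (V' k $ i) (A i u))"
        unfolding sum.distrib[symmetric] sum_subtractf[symmetric]
        by (intro sum.cong) (simp_all add: e_def A_diff inner_diff inner_commute)
      have 3: "(\<Sum>i\<in>UNIV. inner (s k i + A i (X' k) - (\<upsilon> $ i + A i \<xi> - w i)) (V' k $ i - w i))
        = (\<Sum>i\<in>UNIV. inner (s k i) (V' k $ i - w i)) + (\<Sum>i\<in>UNIV. inner (A i (X' k)) (V' k $ i))
          - (\<Sum>i\<in>UNIV. inner (A i (X' k)) (w i)) - (\<Sum>i\<in>UNIV. inner (\<upsilon> $ i + A i \<xi> - w i) (V' k $ i - w i))"
        unfolding sum.distrib[symmetric] sum_subtractf[symmetric]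
        unfolding inner_diff_left[of "_ + _" "_ - _"] inner_add_left[of "s k _"]
        by (intro sum.cong) (simp_all add: inner_diff_right)
      show ?thesis unfolding 1 2 3 T_def by simp
    qed
    ultimately show ?thesis by linarith
  qed
  have bX: "bounded (range (\<lambda>k. X' k - u))"
    using bounded_translation_minus[OF bdd'(1), of u] by (simp add: image_image)
  have bA: "bounded (range (\<lambda>k. A i (X' k - u)))" for i
    using bounded_linear_image[OF bX A(1)[of i]] by (simp add: image_image)
  have bV: "bounded (range (\<lambda>k. V' k $ i - w i))" for i
    using bounded_translation_minus[OF bounded_linear_image[OF bdd'(2) bounded_linear_vec_nth[of i]], of "w i"]
    by (simp add: image_image)
  have wX: "(\<lambda>k. inner v (X' k - u)) \<longlonglongrightarrow> inner v (\<xi> - u)" for v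
    using weak'(1) unfolding weakly_convergent_to_def inner_diff_right inner_commute[of v]
    by (intro tendsto_diff tendsto_const) auto
  have wV: "(\<lambda>k. inner (V' k $ i) v) \<longlonglongrightarrow> inner (\<upsilon> $ i) v" for i v
    using weakly_convergent_to_component[OF weak'(2), of i] by (simp add: weakly_convergent_to_def)
  have wV': "(\<lambda>k. inner v (V' k $ i - w i)) \<longlonglongrightarrow> inner v (\<upsilon> $ i - w i)" for i v
    using wV[of i v] unfolding inner_diff_right inner_commute[of v]
    by (intro tendsto_diff tendsto_const) auto
  have wA: "(\<lambda>k. inner (A i (X' k)) v) \<longlonglongrightarrow> inner (A i \<xi>) v" for i v
    using weak'(1) unfolding weakly_convergent_to_def adjoint_works_hilbert[OF A(1)] by blast
  \<comment> \<open>Written summand by summand in the shape of \<open>T\<close>, zeros included, so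
    that the limit rules match term by term.\<close>
  define L where "L = 0 - (\<Sum>i::'n\<in>UNIV. 0) + (\<Sum>i::'n\<in>UNIV. 0)
      - inner (\<xi> - stacked_adjoint A \<upsilon> - u) (\<xi> - u)
      - (\<Sum>i\<in>UNIV. inner (\<upsilon> $ i + A i \<xi> - w i) (\<upsilon> $ i - w i))
      + (\<Sum>i\<in>UNIV. inner (\<upsilon> $ i) (A i u)) - (\<Sum>i\<in>UNIV. inner (A i \<xi>) (w i))"
  have "T \<longlonglongrightarrow> L"
    unfolding T_def L_def
    by (intro tendsto_add tendsto_diff tendsto_sum tendsto_inner_weak_strong bX bA bV r0 s0 e0 wX wV wV' wA)
  then have "0 \<le> L" using T_nonneg by (intro LIMSEQ_le_const) auto
  moreover have "L = - (norm (\<xi> - u))\<^sup>2 - (\<Sum>i\<in>UNIV. (norm (\<upsilon> $ i - w i))\<^sup>2)"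
  proof -
    have 1: "inner (\<xi> - stacked_adjoint A \<upsilon> - u) (\<xi> - u) = (norm (\<xi> - u))\<^sup>2
       - (\<Sum>i\<in>UNIV. inner (\<upsilon> $ i) (A i \<xi>)) + (\<Sum>i\<in>UNIV. inner (\<upsilon> $ i) (A i u))"
    proof -
      have "\<xi> - stacked_adjoint A \<upsilon> - u = (\<xi> - u) - stacked_adjoint A \<upsilon>" by simp
      then show ?thesis
        by (simp only: inner_diff_left[of "\<xi> - u" "stacked_adjoint A \<upsilon>"] inner_stacked_adjoint power2_norm_eq_inner)
          (simp add: A_diff inner_diff_right sum_subtractf)
    qed
    have 2: "(\<Sum>i\<in>UNIV. inner (\<upsilon> $ i + A i \<xi> - w i) (\<upsilon> $ i - w i)) = (\<Sum>i\<in>UNIV. (norm (\<upsilon> $ i - w i))\<^sup>2)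
       + (\<Sum>i\<in>UNIV. inner (\<upsilon> $ i) (A i \<xi>)) - (\<Sum>i\<in>UNIV. inner (A i \<xi>) (w i))"
      unfolding sum.distrib[symmetric] sum_subtractf[symmetric]
      by (intro sum.cong) (simp_all add: power2_norm_eq_inner inner_diff inner_add inner_commute)
    show ?thesis unfolding L_def 1 2 by simp
  qed
  ultimately have le: "(norm (\<xi> - u))\<^sup>2 + (\<Sum>i\<in>UNIV. (norm (\<upsilon> $ i - w i))\<^sup>2) \<le> 0" by simp
  have sum_nn: "0 \<le> (\<Sum>i\<in>UNIV. (norm (\<upsilon> $ i - w i))\<^sup>2)" by (intro sum_nonneg) simp
  have "(norm (\<xi> - u))\<^sup>2 = 0" using le sum_nn zero_le_power2[of "norm (\<xi> - u)"] by linarith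
  then have \<xi>u: "u = \<xi>" by simp
  have "(\<Sum>i\<in>UNIV. (norm (\<upsilon> $ i - w i))\<^sup>2) = 0" using le sum_nn zero_le_power2[of "norm (\<xi> - u)"] by linarith
  then have \<upsilon>w: "w i = \<upsilon> $ i" for i by (simp add: sum_nonneg_eq_0_iff)
  show ?thesis
    unfolding saddle_points_def using \<upsilon> u w(2) by (simp add: \<xi>u \<upsilon>w)
qed

end

section \<open>Weighted squares and the limiting metric\<close>

lemma weighted_square_null:
  fixes e :: "nat \<Rightarrow> 'a::real_normed_vector"
  assumes c: "c \<longlonglongrightarrow> c0" "0 < c0" "\<And>k. 0 < c k"
    and le: "\<And>k. c k * (norm (e k))\<^sup>2 \<le> t k" and t: "t \<longlonglongrightarrow> 0"
  shows "e \<longlonglongrightarrow> 0"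
proof -
  have "(\<lambda>k. (norm (e k))\<^sup>2) \<longlonglongrightarrow> 0"
  proof (rule tendsto_sandwich[where f = "\<lambda>_. 0" and h = "\<lambda>k. t k / c k"])
    show "\<forall>\<^sub>F k in sequentially. (norm (e k))\<^sup>2 \<le> t k / c k"
      using le c(3) by (intro always_eventually allI) (simp add: pos_le_divide_eq mult.commute)
    show "(\<lambda>k. t k / c k) \<longlonglongrightarrow> 0"
      using tendsto_divide[OF t c(1)] c(2) by simp
  qed auto
  from tendsto_real_sqrt[OF this] have "(\<lambda>k. norm (e k)) \<longlonglongrightarrow> 0" by simp
  then show ?thesis by (rule tendsto_norm_zero_cancel)
qed

lemma weighted_square_bounded:
  fixes e :: "nat \<Rightarrow> 'a::real_normed_vector"
  assumes c: "c \<longlonglongrightarrow> c0" "0 < c0" "\<And>k. 0 < c k"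
    and le: "\<And>k. c k * (norm (e k))\<^sup>2 \<le> t k" and t: "convergent t"
  shows "bounded (range e)"
proof -
  obtain t0 where "t \<longlonglongrightarrow> t0" using t unfolding convergent_def by blast
  then have "(\<lambda>k. t k / c k) \<longlonglongrightarrow> t0 / c0"
    using c(1,2) by (intro tendsto_divide) auto
  then have "Bseq (\<lambda>k. t k / c k)" by (intro convergent_imp_Bseq convergentI)
  then obtain K where K: "\<And>k. norm (t k / c k) \<le> K" unfolding Bseq_def by blast
  have "norm (e k) \<le> K + 1" for k
  proof -
    have "(norm (e k))\<^sup>2 \<le> t k / c k"
      using le[of k] c(3)[of k] by (simp add: pos_le_divide_eq mult.commute)
    also have "\<dots> \<le> K" using K[of k] abs_ge_self[of "t k / c k"] unfolding real_norm_def by linarith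
    finally have "(norm (e k))\<^sup>2 \<le> K" .
    moreover have "0 \<le> (norm (e k) - 1)\<^sup>2" by simp
    then have "2 * norm (e k) \<le> (norm (e k))\<^sup>2 + 1" by (simp add: power2_diff)
    ultimately show ?thesis using norm_ge_zero[of "e k"] by linarith
  qed
  then show ?thesis unfolding bounded_iff by auto
qed

lemma Bseq_norm_square:
  fixes e :: "nat \<Rightarrow> 'a::real_normed_vector"
  assumes "bounded (range e)"
  shows "Bseq (\<lambda>k. (norm (e k))\<^sup>2)"
proof -
  obtain K where K: "\<And>k. norm (e k) \<le> K" using assms unfolding bounded_iff by auto
  have "norm ((norm (e k))\<^sup>2) \<le> K\<^sup>2" for k using K[of k] by (simp add: power_mono)
  then show ?thesis by (intro BseqI')
qed

lemma bounded_vec_components: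
  fixes y :: "nat \<Rightarrow> 'a::real_normed_vector ^ 'n::finite"
  assumes "\<And>i. bounded (range (\<lambda>k. y k $ i))"
  shows "bounded (range y)"
proof -
  have "\<exists>K. \<forall>k. norm (y k $ i) \<le> K" for i
    using assms[of i] unfolding bounded_iff by auto
  then obtain K where K: "\<And>k i. norm (y k $ i) \<le> K i" by metis
  have "norm (y k) \<le> sum K UNIV" for k
    using order.trans[OF L2_set_le_sum sum_mono[OF K]] unfolding norm_vec_def by auto
  then show ?thesis unfolding bounded_iff by auto
qed

context saddle_problem
begin

lemma energy_ge:
  assumes "coupled_weights a b"
  shows "a * (norm (x - fst z))\<^sup>2 \<le> energy a b z x y d"
    "b i / p i * (norm (y $ i - snd z $ i))\<^sup>2 \<le> energy a b z x y d"
proof -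
  define t where "t i = b i / p i * ((norm (y $ i - snd z $ i))\<^sup>2 + \<kappa> * (norm (d $ i))\<^sup>2)" for i
  have pos: "0 < a" "\<And>i. 0 \<le> b i / p i" using assms p_pos unfolding coupled_weights_def
    by (auto intro: divide_nonneg_nonneg less_imp_le)
  have t: "0 \<le> t i" for i
    unfolding t_def using pos \<delta>(4) by (intro mult_nonneg_nonneg add_nonneg_nonneg) auto
  show "a * (norm (x - fst z))\<^sup>2 \<le> energy a b z x y d"
    unfolding energy_def t_def[symmetric] using t by (simp add: sum_nonneg)
  have "b i / p i * (norm (y $ i - snd z $ i))\<^sup>2 \<le> t i"
    unfolding t_def using pos \<delta>(4) by (intro mult_left_mono) auto
  also have "\<dots> \<le> (\<Sum>i\<in>UNIV. t i)" using t by (intro member_le_sum) auto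
  also have "\<dots> \<le> energy a b z x y d"
    unfolding energy_def t_def[symmetric] using pos by simp
  finally show "b i / p i * (norm (y $ i - snd z $ i))\<^sup>2 \<le> energy a b z x y d" .
qed

text \<open>The block-diagonal operator whose quadratic form, at the difference of the iterate and
  \<open>z\<close>, is the energy with zero increment.\<close>

definition metric_op :: "real \<Rightarrow> ('n \<Rightarrow> real) \<Rightarrow> 'x \<times> ('y ^ 'n) \<Rightarrow> 'x \<times> ('y ^ 'n)" where
  "metric_op a b z = (a *\<^sub>R fst z, \<chi> i. (b i / p i) *\<^sub>R snd z $ i)"

lemma metric_op_diff: "metric_op a b (z - z') = metric_op a b z - metric_op a b z'"
  by (simp add: metric_op_def vec_eq_iff scaleR_diff_right)

lemma inner_metric_op:
  "inner w (metric_op a b z) = a * inner (fst w) (fst z) + (\<Sum>i\<in>UNIV. b i / p i * inner (snd w $ i) (snd z $ i))"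
  by (simp add: metric_op_def inner_prod_def inner_vec_def)

text \<open>The square of the iterate does not involve \<open>z\<close>, so differences of energies
  at two points are affine in the iterate; convergence of energies thus gives convergence of inner
  products.\<close>

lemma metric_op_polarization:
  "energy a b z x y 0 = inner (x, y) (metric_op a b (x, y)) - 2 * inner (x, y) (metric_op a b z)
    + inner z (metric_op a b z)"
proof -
  have "energy a b z x y 0 = inner ((x, y) - z) (metric_op a b ((x, y) - z))"
    by (simp add: energy_def inner_metric_op power2_norm_eq_inner)
  moreover have "inner z (metric_op a b (x, y)) = inner (x, y) (metric_op a b z)"
    by (simp add: inner_metric_op inner_commute)
  ultimately show ?thesis
    by (simp add: metric_op_diff inner_diff_left inner_diff_right)
qed

lemma metric_op_definite:
  assumes pos: "0 < a" "\<And>i. 0 < b i" and z: "z \<noteq> 0"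
  shows "inner z (metric_op a b z) \<noteq> 0"
proof
  assume 0: "inner z (metric_op a b z) = 0"
  have nn: "0 \<le> a * inner (fst z) (fst z)" "\<And>i. 0 \<le> b i / p i * inner (snd z $ i) (snd z $ i)"
    using pos p_pos by (intro mult_nonneg_nonneg divide_nonneg_nonneg inner_ge_zero; simp add: less_imp_le)+
  have "0 \<le> (\<Sum>i\<in>UNIV. b i / p i * inner (snd z $ i) (snd z $ i))" by (intro sum_nonneg nn)
  then have *: "a * inner (fst z) (fst z) = 0" "(\<Sum>i\<in>UNIV. b i / p i * inner (snd z $ i) (snd z $ i)) = 0"
    using 0 nn(1) unfolding inner_metric_op by linarith+
  then have "\<forall>i. b i / p i * inner (snd z $ i) (snd z $ i) = 0"
    using sum_nonneg_eq_0_iff[of UNIV "\<lambda>i. b i / p i * inner (snd z $ i) (snd z $ i)"] nn(2) by simp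
  then have "snd z $ i = 0" for i
    using pos(2)[of i] p_pos[of i] by (metis divide_eq_0_iff inner_eq_zero_iff less_irrefl mult_eq_0_iff)
  moreover have "fst z = 0" using *(1) pos(1) by simp
  ultimately show False using z by (simp add: prod_eq_iff vec_eq_iff)
qed

lemma continuous_metric_op: "continuous_on UNIV (\<lambda>z. metric_op a b (z - z'))"
  unfolding metric_op_def by (intro continuous_intros)

text \<open>The deterministic half of the argument: everything that probability has to supply on a
  path is a hypothesis. Convergence of the Lyapunov function is asked for on the dense set
  \<open>D\<close> only.\<close>

lemma pathwise_convergence:
  fixes x :: "nat \<Rightarrow> 'x" and y yb v d :: "nat \<Rightarrow> 'y ^ 'n"
  assumes x: "\<And>k. x (Suc k) = primal_step (\<tau> (Suc k)) (x k) (yb k)"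
    and v: "\<And>k i. v k $ i = dual_step (\<sigma> (Suc k) i) i (x (Suc k)) (y k $ i)"
    and y: "\<And>k i. y k $ i \<in> Y i"
    and d: "\<And>k. d (Suc k) = replace (pick k) (v k - y k) 0" "d 0 = 0"
    and yb: "\<And>k i. yb k $ i = y k $ i + (1 / p i) *\<^sub>R d k $ i"
    and pos: "\<And>k. 0 < \<tau> k" "\<And>k i. 0 < \<sigma> k i"
    and inv: "Bseq (\<lambda>k. 1 / \<tau> k)" "\<And>i. Bseq (\<lambda>k. 1 / \<sigma> k i)"
    and w: "\<And>k. coupled_weights (a k) (b k)"
    and lim: "a \<longlonglongrightarrow> a0" "0 < a0" "\<And>i. (\<lambda>k. b k i) \<longlonglongrightarrow> b0 i" "\<And>i. 0 < b0 i"
    and D: "D \<subseteq> C" "C \<subseteq> closure D" "D \<noteq> {}"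
    and L: "\<And>z. z \<in> D \<Longrightarrow> convergent (\<lambda>k. lyapunov (a k) (b k) z (x k) (y k) (d k))"
    and \<theta>: "(\<lambda>k. a k * (norm (x (Suc k) - x k))\<^sup>2 + (\<Sum>i\<in>UNIV. b k i * (norm (v k $ i - y k $ i))\<^sup>2)) \<longlonglongrightarrow> 0"
  obtains z where "z \<in> C" "weakly_convergent_to (\<lambda>k. (x k, y k)) z"
proof -
  have w_pos: "0 < a k" "0 < b k i" for k i using w[of k] unfolding coupled_weights_def by auto
  have b_div: "(\<lambda>k. b k i / p i) \<longlonglongrightarrow> b0 i / p i" "0 < b0 i / p i" "0 < b k i / p i" for i k
    using lim(3,4) w_pos(2) p_pos[of i] by (auto intro!: tendsto_intros)
  have dx: "(\<lambda>k. x (Suc k) - x k) \<longlonglongrightarrow> 0"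
  proof (rule weighted_square_null[OF lim(1,2) w_pos(1) _ \<theta>])
    show "a k * (norm (x (Suc k) - x k))\<^sup>2
      \<le> a k * (norm (x (Suc k) - x k))\<^sup>2 + (\<Sum>i\<in>UNIV. b k i * (norm (v k $ i - y k $ i))\<^sup>2)" for k
      using w_pos(2) by (simp add: sum_nonneg less_imp_le)
  qed
  have dv_i: "(\<lambda>k. v k $ i - y k $ i) \<longlonglongrightarrow> 0" for i
  proof (rule weighted_square_null[OF lim(3,4) w_pos(2) _ \<theta>])
    fix k
    have "b k i * (norm (v k $ i - y k $ i))\<^sup>2 \<le> (\<Sum>i\<in>UNIV. b k i * (norm (v k $ i - y k $ i))\<^sup>2)"
      using w_pos(2) by (intro member_le_sum) (auto simp: less_imp_le)
    moreover have "0 \<le> a k * (norm (x (Suc k) - x k))\<^sup>2" using w_pos(1)[of k] by simp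
    ultimately show "b k i * (norm (v k $ i - y k $ i))\<^sup>2
      \<le> a k * (norm (x (Suc k) - x k))\<^sup>2 + (\<Sum>i\<in>UNIV. b k i * (norm (v k $ i - y k $ i))\<^sup>2)"
      by linarith
  qed
  then have dv: "(\<lambda>k. v k - y k) \<longlonglongrightarrow> 0" by (intro vec_tendstoI) simp
  \<comment> \<open>The increment at \<open>Suc k\<close> is \<open>v k - y k\<close> in the picked
    block and 0 elsewhere, hence the shift of the index.\<close>
  have d_i: "(\<lambda>k. d k $ i) \<longlonglongrightarrow> 0" for i
  proof (rule LIMSEQ_imp_Suc, rule Lim_null_comparison)
    show "\<forall>\<^sub>F k in sequentially. norm (d (Suc k) $ i) \<le> norm (v k $ i - y k $ i)"
      by (simp add: d(1) replace_def)
    show "(\<lambda>k. norm (v k $ i - y k $ i)) \<longlonglongrightarrow> 0" by (rule tendsto_norm_zero[OF dv_i])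
  qed
  have d_supp: "\<exists>j. \<forall>i. i \<noteq> j \<longrightarrow> d k $ i = 0" for k
    by (cases k) (auto simp: d replace_def)
  have energy_le: "energy (a k) (b k) z (x k) (y k) (d k)
      \<le> lyapunov (a k) (b k) z (x k) (y k) (d k) / \<delta>" for k z
  proof -
    obtain j where "\<And>i. i \<noteq> j \<Longrightarrow> d k $ i = 0" using d_supp by blast
    from energy_le_lyapunov[OF w this] show ?thesis
      using \<delta>(1) by (simp add: pos_le_divide_eq mult.commute)
  qed
  have L_div: "convergent (\<lambda>k. lyapunov (a k) (b k) z (x k) (y k) (d k) / \<delta>)" if "z \<in> D" for z
    using convergent_mult[OF L[OF that] convergent_const[of "1 / \<delta>"]] by simp
  have bnd_x: "bounded (range (\<lambda>k. x k - fst z))" if "z \<in> D" for z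
    by (rule weighted_square_bounded[OF lim(1,2) w_pos(1) order.trans[OF energy_ge(1)[OF w] energy_le] L_div[OF that]])
  have bnd_y: "bounded (range (\<lambda>k. y k $ i - snd z $ i))" if "z \<in> D" for z i
    by (rule weighted_square_bounded[OF b_div order.trans[OF energy_ge(2)[OF w] energy_le] L_div[OF that]])
  obtain z0 where z0: "z0 \<in> D" using D(3) by blast
  have bdd_x: "bounded (range x)"
    using bounded_translation[OF bnd_x[OF z0], of "fst z0"] by (simp add: image_image)
  have bdd_y: "bounded (range y)"
  proof (rule bounded_vec_components)
    show "bounded (range (\<lambda>k. y k $ i))" for i
      using bounded_translation[OF bnd_y[OF z0, of i], of "snd z0 $ i"] by (simp add: image_image)
  qed
  \<comment> \<open>Distances are bounded, weights converge and increments vanish, so passing to the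
    limiting weights and dropping the increment changes the Lyapunov function by a null
    sequence.\<close>
  have E: "convergent (\<lambda>k. energy a0 b0 z (x k) (y k) 0)" if z: "z \<in> D" for z
  proof -
    have 1: "(\<lambda>k. (norm (x k - fst z))\<^sup>2 *\<^sub>R (a0 - a k)) \<longlonglongrightarrow> 0"
      using tendsto_diff[OF tendsto_const[of a0] lim(1)]
      by (intro tendsto_scaleR_Bseq Bseq_norm_square bnd_x z) simp
    have 2: "(\<lambda>k. (norm (y k $ i - snd z $ i))\<^sup>2 *\<^sub>R (b0 i / p i - b k i / p i)) \<longlonglongrightarrow> 0" for i
      using tendsto_diff[OF tendsto_const[of "b0 i / p i"] b_div(1)[of i]]
      by (intro tendsto_scaleR_Bseq Bseq_norm_square bnd_y z) simp
    have 3: "(\<lambda>k. b k i / p i * (norm (d k $ i))\<^sup>2) \<longlonglongrightarrow> b0 i / p i * (norm (0::'y))\<^sup>2" for i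
      by (intro tendsto_mult b_div(1) tendsto_power tendsto_norm d_i)
    have 4: "(\<lambda>k. inner (d k $ i) (A i (x k - fst z)) / p i) \<longlonglongrightarrow> 0 / p i" for i
      using bounded_linear_image[OF bnd_x[OF z] A(1)[of i]] p_pos[of i]
      by (intro tendsto_divide tendsto_const tendsto_inner_weak_strong d_i) (auto simp: image_image)
    have "(\<lambda>k. (norm (x k - fst z))\<^sup>2 *\<^sub>R (a0 - a k)
        + (\<Sum>i\<in>UNIV. (norm (y k $ i - snd z $ i))\<^sup>2 *\<^sub>R (b0 i / p i - b k i / p i))
        - \<kappa> * (\<Sum>i\<in>UNIV. b k i / p i * (norm (d k $ i))\<^sup>2)
        + 2 * (\<Sum>i\<in>UNIV. inner (d k $ i) (A i (x k - fst z)) / p i))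
      \<longlonglongrightarrow> 0 + (\<Sum>i::'n\<in>UNIV. 0) - \<kappa> * (\<Sum>i\<in>UNIV. b0 i / p i * (norm (0::'y))\<^sup>2) + 2 * (\<Sum>i\<in>UNIV. 0 / p i)"
      by (intro tendsto_add tendsto_diff tendsto_mult_left tendsto_sum 1 2 3 4)
    moreover have "(\<lambda>k. (norm (x k - fst z))\<^sup>2 *\<^sub>R (a0 - a k)
        + (\<Sum>i\<in>UNIV. (norm (y k $ i - snd z $ i))\<^sup>2 *\<^sub>R (b0 i / p i - b k i / p i))
        - \<kappa> * (\<Sum>i\<in>UNIV. b k i / p i * (norm (d k $ i))\<^sup>2)
        + 2 * (\<Sum>i\<in>UNIV. inner (d k $ i) (A i (x k - fst z)) / p i))
      = (\<lambda>k. energy a0 b0 z (x k) (y k) 0 - lyapunov (a k) (b k) z (x k) (y k) (d k))"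
    proof
      fix k
      have 5: "(\<Sum>i\<in>UNIV. (norm (y k $ i - snd z $ i))\<^sup>2 *\<^sub>R (b0 i / p i - b k i / p i))
        = (\<Sum>i\<in>UNIV. b0 i / p i * (norm (y k $ i - snd z $ i))\<^sup>2) - (\<Sum>i\<in>UNIV. b k i / p i * (norm (y k $ i - snd z $ i))\<^sup>2)"
        unfolding sum_subtractf[symmetric] by (intro sum.cong) (simp_all only: real_scaleR_def left_diff_distrib mult.commute)
      have 6: "(\<Sum>i\<in>UNIV. inner (d k $ i) (A i (x k - fst z)) / p i) = (\<Sum>i\<in>UNIV. inner (A i (x k - fst z)) (d k $ i) / p i)"
        by (simp only: inner_commute)
      have 7: "(norm (x k - fst z))\<^sup>2 *\<^sub>R (a0 - a k) = a0 * (norm (x k - fst z))\<^sup>2 - a k * (norm (x k - fst z))\<^sup>2"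
        by (simp only: real_scaleR_def left_diff_distrib mult.commute)
      show "(norm (x k - fst z))\<^sup>2 *\<^sub>R (a0 - a k)
        + (\<Sum>i\<in>UNIV. (norm (y k $ i - snd z $ i))\<^sup>2 *\<^sub>R (b0 i / p i - b k i / p i))
        - \<kappa> * (\<Sum>i\<in>UNIV. b k i / p i * (norm (d k $ i))\<^sup>2)
        + 2 * (\<Sum>i\<in>UNIV. inner (d k $ i) (A i (x k - fst z)) / p i)
        = energy a0 b0 z (x k) (y k) 0 - lyapunov (a k) (b k) z (x k) (y k) (d k)"
        unfolding 5 6 7 lyapunov_def energy_split by simp
    qed
    ultimately have diff: "convergent (\<lambda>k. energy a0 b0 z (x k) (y k) 0 - lyapunov (a k) (b k) z (x k) (y k) (d k))"
      by (simp only: convergentI)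
    from convergent_add[OF diff L[OF z]] show ?thesis by simp
  qed
  let ?w = "\<lambda>k. (x k, y k)"
  let ?W = "metric_op a0 b0"
  have bdd_w: "bounded (range ?w)"
    using bounded_Times[OF bdd_x bdd_y] by (rule bounded_subset) auto
  have conv_D: "convergent (\<lambda>k. inner (?w k) (?W (z - z')))" if "z \<in> D" "z' \<in> D" for z z'
  proof -
    have "inner (?w k) (?W (z - z')) = (1 / 2) * (energy a0 b0 z' (x k) (y k) 0 - energy a0 b0 z (x k) (y k) 0
        + (inner z (?W z) - inner z' (?W z')))" for k
      unfolding metric_op_polarization by (simp add: metric_op_diff inner_diff_right)
    then show ?thesis
      using E that by (simp only:) (intro convergent_mult convergent_add convergent_diff convergent_const)
  qed
  \<comment> \<open>Boundedness of the iterates allows passing to the closure of \<open>D\<close>.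
    This is done for \<open>z\<close> first and then, since the expression is antisymmetric, for
    \<open>z'\<close>.\<close>
  have closed: "closed {z. convergent (\<lambda>k. inner (?w k) (?W (z - z')))}" for z'
  proof -
    have "isCont (\<lambda>z. metric_op a0 b0 (z - z')) z" for z
      using continuous_metric_op[of a0 b0 z'] by (simp only: continuous_on_eq_continuous_at[OF open_UNIV] UNIV_I ball_UNIV)
    from continuous_closed_vimage[OF closed_convergent_inner[OF bdd_w] this] show ?thesis
      by (simp only: vimage_def mem_Collect_eq)
  qed
  have conv_CD: "convergent (\<lambda>k. inner (?w k) (?W (z - z')))" if "z \<in> C" "z' \<in> D" for z z'
    using closure_minimal[OF _ closed[of z'], of D] conv_D that D(2) by blast
  have conv_C: "convergent (\<lambda>k. inner (?w k) (?W (z - z')))" if "z \<in> C" "z' \<in> C" for z z'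
  proof -
    have "convergent (\<lambda>k. inner (?w k) (?W (u - z)))" if "u \<in> D" for u
      using convergent_minus_iff[of "\<lambda>k. inner (?w k) (?W (z - u))"] conv_CD[OF \<open>z \<in> C\<close> that]
      by (simp add: metric_op_diff inner_diff_right)
    then have "convergent (\<lambda>k. inner (?w k) (?W (z' - z)))"
      using closure_minimal[OF _ closed[of z], of D] \<open>z' \<in> C\<close> D(2) by blast
    then show ?thesis
      using convergent_minus_iff[of "\<lambda>k. inner (?w k) (?W (z' - z))"]
      by (simp add: metric_op_diff inner_diff_right)
  qed
  have cluster: "l \<in> C" if r: "strict_mono r" and weak: "weakly_convergent_to (?w \<circ> r) l" for r l
  proof -
    have yb_y: "(\<lambda>k. yb k - y k) \<longlonglongrightarrow> 0"
    proof (rule vec_tendstoI)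
      fix i
      have "(\<lambda>k. (1 / p i) *\<^sub>R d k $ i) \<longlonglongrightarrow> (1 / p i) *\<^sub>R 0" by (intro tendsto_intros d_i)
      then show "(\<lambda>k. (yb k - y k) $ i) \<longlonglongrightarrow> 0 $ i" by (simp add: yb)
    qed
    have "(fst l, snd l) \<in> C"
    proof (rule weak_cluster_point_is_saddle)
      show "x (Suc (r k)) = primal_step (\<tau> (Suc (r k))) (x (r k)) (yb (r k))" for k by (rule x)
      show "v (r k) $ i = dual_step (\<sigma> (Suc (r k)) i) i (x (Suc (r k))) (y (r k) $ i)" for k i by (rule v)
      show "y (r k) $ i \<in> Y i" for k i by (rule y)
      show "0 < \<tau> (Suc (r k))" "0 < \<sigma> (Suc (r k)) i" for k i using pos by auto
      show "Bseq (\<lambda>k. 1 / \<tau> (Suc (r k)))" using inv(1) unfolding Bseq_def by blast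
      show "Bseq (\<lambda>k. 1 / \<sigma> (Suc (r k)) i)" for i using inv(2)[of i] unfolding Bseq_def by blast
      show "(\<lambda>k. x (Suc (r k)) - x (r k)) \<longlonglongrightarrow> 0" using LIMSEQ_subseq_LIMSEQ[OF dx r] by (simp add: o_def)
      show "(\<lambda>k. v (r k) - y (r k)) \<longlonglongrightarrow> 0" using LIMSEQ_subseq_LIMSEQ[OF dv r] by (simp add: o_def)
      show "(\<lambda>k. yb (r k) - y (r k)) \<longlonglongrightarrow> 0" using LIMSEQ_subseq_LIMSEQ[OF yb_y r] by (simp add: o_def)
      show "bounded (range (\<lambda>k. x (r k)))" using bdd_x by (rule bounded_subset) auto
      show "bounded (range (\<lambda>k. y (r k)))" using bdd_y by (rule bounded_subset) auto
      show "weakly_convergent_to (\<lambda>k. x (r k)) (fst l)"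
        using weakly_convergent_to_fst[OF weak] by simp
      show "weakly_convergent_to (\<lambda>k. y (r k)) (snd l)"
        using weakly_convergent_to_snd[OF weak] by simp
    qed
    then show ?thesis by simp
  qed
  obtain z where "z \<in> C" "weakly_convergent_to ?w z"
    by (rule opial[OF bdd_w cluster metric_op_definite[OF lim(2,4)] conv_C])
  then show thesis by (rule that)
qed

end

section \<open>The random iteration\<close>

text \<open>The new step-sizes and the primal iterate are computed before an index is drawn. They
  depend on one index less than the dual iterate of the same time, which makes them usable as frozen
  quantities in the averaging.\<close>

lemma aspdhg_run_step_deterministic:
  assumes run: "aspdhg_run Y A f g p rule x0 y0 \<tau>0 \<sigma>0 pick \<tau> \<sigma> x y ybar"
    and run': "aspdhg_run Y A f g p rule x0 y0 \<tau>0 \<sigma>0 pick' \<tau>' \<sigma>' x' y' ybar'"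
    and past: "\<And>j. j \<le> k \<Longrightarrow> \<tau> j = \<tau>' j \<and> \<sigma> j = \<sigma>' j \<and> x j = x' j \<and> y j = y' j \<and> ybar j = ybar' j"
  shows "\<tau> (Suc k) = \<tau>' (Suc k) \<and> \<sigma> (Suc k) = \<sigma>' (Suc k) \<and> x (Suc k) = x' (Suc k)"
proof -
  have "restrict \<tau> {..k} = restrict \<tau>' {..k}" "restrict \<sigma> {..k} = restrict \<sigma>' {..k}"
    "restrict x {..k} = restrict x' {..k}" "restrict y {..k} = restrict y' {..k}"
    using past by (auto simp: restrict_def)
  moreover have "(\<tau> (Suc k), \<sigma> (Suc k)) = rule k (restrict \<tau> {..k}) (restrict \<sigma> {..k}) (restrict x {..k}) (restrict y {..k})"
    "(\<tau>' (Suc k), \<sigma>' (Suc k)) = rule k (restrict \<tau>' {..k}) (restrict \<sigma>' {..k}) (restrict x' {..k}) (restrict y' {..k})"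
    using run run' unfolding aspdhg_run_def by blast+
  ultimately have "(\<tau> (Suc k), \<sigma> (Suc k)) = (\<tau>' (Suc k), \<sigma>' (Suc k))"
    by (simp only:)
  then have steps: "\<tau> (Suc k) = \<tau>' (Suc k)" "\<sigma> (Suc k) = \<sigma>' (Suc k)"
    by simp_all
  have "x (Suc k) = prox UNIV (\<lambda>u. ereal (\<tau> (Suc k)) * g u) (x k - \<tau> (Suc k) *\<^sub>R stacked_adjoint A (ybar k))"
    "x' (Suc k) = prox UNIV (\<lambda>u. ereal (\<tau>' (Suc k)) * g u) (x' k - \<tau>' (Suc k) *\<^sub>R stacked_adjoint A (ybar' k))"
    using run run' unfolding aspdhg_run_def by blast+
  then have "x (Suc k) = x' (Suc k)" using steps past[of k] by simp
  with steps show ?thesis by simp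
qed

text \<open>The rule receives the past through restrictions, so runs that agree up to a time hand it
  equal arguments there, even if they differ later.\<close>

lemma aspdhg_run_deterministic:
  assumes run: "aspdhg_run Y A f g p rule x0 y0 \<tau>0 \<sigma>0 pick \<tau> \<sigma> x y ybar"
    and run': "aspdhg_run Y A f g p rule x0 y0 \<tau>0 \<sigma>0 pick' \<tau>' \<sigma>' x' y' ybar'"
    and pick: "\<And>j. j < k \<Longrightarrow> pick j = pick' j"
  shows "j \<le> k \<Longrightarrow> \<tau> j = \<tau>' j \<and> \<sigma> j = \<sigma>' j \<and> x j = x' j \<and> y j = y' j \<and> ybar j = ybar' j"
proof (induction j rule: less_induct)
  case (less j)
  show ?case
  proof (cases j)
    case 0
    then show ?thesis using run run' unfolding aspdhg_run_def by simp
  next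
    case (Suc m)
    have past: "\<tau> i = \<tau>' i \<and> \<sigma> i = \<sigma>' i \<and> x i = x' i \<and> y i = y' i \<and> ybar i = ybar' i" if "i \<le> m" for i
      using less that Suc by simp
    note step = aspdhg_run_step_deterministic[OF run run' past]
    have pm: "pick m = pick' m" using pick Suc less.prems by simp
    have "y (Suc m) $ i = y' (Suc m) $ i" for i
      using run run' step past[of m] pm unfolding aspdhg_run_def by simp
    then have y: "y (Suc m) = y' (Suc m)" by (simp add: vec_eq_iff)
    have "ybar (Suc m) $ i = ybar' (Suc m) $ i" for i
      using run run' y past[of m] pm unfolding aspdhg_run_def by simp
    then have "ybar (Suc m) = ybar' (Suc m)" by (simp add: vec_eq_iff)
    with step y show ?thesis unfolding Suc by simp
  qed
qed

text \<open>Taking reciprocals turns \<open>1 - \<eta> k\<close> into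
  \<open>1 / (1 - \<eta> k)\<close>, which is \<open>1 + \<epsilon> k\<close>. Once
  \<open>\<eta> k\<close> is below 1/2, \<open>\<epsilon> k\<close> is at most
  \<open>2 * \<eta> k\<close>, whence summability.\<close>

lemma as_quasi_increasing_inverse:
  assumes "as_quasi_increasing M u"
  obtains \<epsilon> where "\<And>k. 0 \<le> \<epsilon> k" "summable \<epsilon>"
    "AE \<omega> in M. \<forall>k. 0 < u k \<omega> \<and> 1 / u (Suc k) \<omega> \<le> (1 + \<epsilon> k) * (1 / u k \<omega>)"
proof -
  obtain \<eta> :: "nat \<Rightarrow> real" where \<eta>: "\<And>k. 0 \<le> \<eta> k" "\<And>k. \<eta> k < 1" "summable \<eta>"
    and ae: "AE \<omega> in M. \<forall>k. (1 - \<eta> k) * u k \<omega> \<le> u (Suc k) \<omega>"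
    and pos: "AE \<omega> in M. \<forall>k. 0 < u k \<omega>"
    using assms unfolding as_quasi_increasing_def by auto
  define \<epsilon> where "\<epsilon> k = \<eta> k / (1 - \<eta> k)" for k
  have \<epsilon>: "0 \<le> \<epsilon> k" "1 + \<epsilon> k = 1 / (1 - \<eta> k)" for k
    using \<eta>(1,2)[of k] by (auto simp: \<epsilon>_def field_simps)
  have "\<forall>\<^sub>F k in sequentially. \<eta> k < 1 / 2"
    using order_tendstoD(2)[OF summable_LIMSEQ_zero[OF \<eta>(3)], of "1 / 2"] by simp
  then have "\<forall>\<^sub>F k in sequentially. norm (\<epsilon> k) \<le> 2 * \<eta> k"
  proof eventually_elim
    case (elim k)
    have "\<eta> k * (2 * \<eta> k) \<le> \<eta> k * 1" using elim \<eta>(1)[of k] by (intro mult_left_mono) auto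
    then have "\<epsilon> k \<le> 2 * \<eta> k"
      using \<eta>(2)[of k] by (simp add: \<epsilon>_def pos_divide_le_eq algebra_simps)
    then show ?case using \<epsilon>(1)[of k] by simp
  qed
  then have sum: "summable \<epsilon>"
    using summable_mult[OF \<eta>(3), of 2] by (rule summable_comparison_test_ev)
  show thesis
  proof (rule that[OF \<epsilon>(1) sum])
    show "AE \<omega> in M. \<forall>k. 0 < u k \<omega> \<and> 1 / u (Suc k) \<omega> \<le> (1 + \<epsilon> k) * (1 / u k \<omega>)"
      using ae pos
    proof eventually_elim
      case (elim \<omega>)
      show ?case
      proof (intro allI conjI)
        fix k
        show "0 < u k \<omega>" using elim by simp
        have "0 < (1 - \<eta> k) * u k \<omega>" using elim \<eta>(2)[of k] by simp
        then have "1 / u (Suc k) \<omega> \<le> 1 / ((1 - \<eta> k) * u k \<omega>)"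
          by (rule frac_le[rotated 2]) (use elim in auto)
        also have "\<dots> = (1 + \<epsilon> k) * (1 / u k \<omega>)" unfolding \<epsilon>(2) by simp
        finally show "1 / u (Suc k) \<omega> \<le> (1 + \<epsilon> k) * (1 / u k \<omega>)" .
      qed
    qed
  qed
qed

section \<open>Almost sure behaviour of the random iterates\<close>

locale aspdhg = serial_sampling_space M p pick + saddle_problem Y A f g p \<beta>
  for M :: "'w measure" and p :: "'n::finite \<Rightarrow> real" and pick :: "nat \<Rightarrow> 'w \<Rightarrow> 'n"
    and Y :: "'n \<Rightarrow> 'y::{real_inner, banach, second_countable_topology} set"
    and A :: "'n \<Rightarrow> 'x::{real_inner, banach, second_countable_topology} \<Rightarrow> 'y"
    and f :: "'n \<Rightarrow> 'y \<Rightarrow> ereal" and g :: "'x \<Rightarrow> ereal" and \<beta> :: real +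
  fixes rule :: "nat \<Rightarrow> (nat \<Rightarrow> real) \<Rightarrow> (nat \<Rightarrow> 'n \<Rightarrow> real) \<Rightarrow> (nat \<Rightarrow> 'x) \<Rightarrow>
                  (nat \<Rightarrow> 'y ^ 'n) \<Rightarrow> real \<times> ('n \<Rightarrow> real)"
    and x0 :: 'x and y0 :: "'y ^ 'n" and \<tau>0 :: real and \<sigma>0 :: "'n \<Rightarrow> real"
    and \<tau> :: "nat \<Rightarrow> 'w \<Rightarrow> real" and \<sigma> :: "nat \<Rightarrow> 'w \<Rightarrow> 'n \<Rightarrow> real"
    and x :: "nat \<Rightarrow> 'w \<Rightarrow> 'x" and y ybar :: "nat \<Rightarrow> 'w \<Rightarrow> 'y ^ 'n"
    and \<epsilon> :: "nat \<Rightarrow> real"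
  assumes y0: "\<And>i. y0 $ i \<in> Y i"
    and run: "\<And>\<omega>. \<omega> \<in> space M \<Longrightarrow>
      aspdhg_run Y A f g p rule x0 y0 \<tau>0 \<sigma>0 (\<lambda>k. pick k \<omega>)
        (\<lambda>k. \<tau> k \<omega>) (\<lambda>k. \<sigma> k \<omega>) (\<lambda>k. x k \<omega>) (\<lambda>k. y k \<omega>) (\<lambda>k. ybar k \<omega>)"
    and step_bound: "AE \<omega> in M. \<forall>k i. \<tau> k \<omega> * \<sigma> k \<omega> i * ((onorm (A i))\<^sup>2 / p i) \<le> \<beta>"
    and \<epsilon>: "\<And>k. 0 \<le> \<epsilon> k" "summable \<epsilon>"
    and AE_\<tau>: "AE \<omega> in M. \<forall>k. 0 < \<tau> k \<omega> \<and> 1 / \<tau> (Suc k) \<omega> \<le> (1 + \<epsilon> k) * (1 / \<tau> k \<omega>)"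
    and AE_\<sigma>: "AE \<omega> in M. \<forall>k i. 0 < \<sigma> k \<omega> i \<and> 1 / \<sigma> (Suc k) \<omega> i \<le> (1 + \<epsilon> k) * (1 / \<sigma> k \<omega> i)"
begin

text \<open>All almost sure hypotheses, for all times and blocks, are collected outside a single
  null set; the deterministic lemmas are applied at good outcomes.\<close>

definition good :: "'w \<Rightarrow> bool" where
  "good \<omega> \<longleftrightarrow> \<omega> \<in> space M \<and>
    (\<forall>k i. \<tau> k \<omega> * \<sigma> k \<omega> i * ((onorm (A i))\<^sup>2 / p i) \<le> \<beta>) \<and>
    (\<forall>k. 0 < \<tau> k \<omega> \<and> 1 / \<tau> (Suc k) \<omega> \<le> (1 + \<epsilon> k) * (1 / \<tau> k \<omega>)) \<and>
    (\<forall>k i. 0 < \<sigma> k \<omega> i \<and> 1 / \<sigma> (Suc k) \<omega> i \<le> (1 + \<epsilon> k) * (1 / \<sigma> k \<omega> i))"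

lemma AE_good: "AE \<omega> in M. good \<omega>"
  using AE_space step_bound AE_\<tau> AE_\<sigma> unfolding good_def by eventually_elim blast

text \<open>The candidates for all blocks, whether picked or not, so that they do not depend on the
  index about to be drawn.\<close>

definition dual_prox :: "nat \<Rightarrow> 'w \<Rightarrow> 'y ^ 'n" where
  "dual_prox k \<omega> = (\<chi> i. dual_step (\<sigma> (Suc k) \<omega> i) i (x (Suc k) \<omega>) (y k \<omega> $ i))"

text \<open>The value 0 at time 0 matches the start \<open>ybar 0 = y0\<close>, where nothing is
  extrapolated.\<close>

definition increment :: "nat \<Rightarrow> 'w \<Rightarrow> 'y ^ 'n" where
  "increment k \<omega> = (case k of 0 \<Rightarrow> 0 | Suc m \<Rightarrow> y (Suc m) \<omega> - y m \<omega>)"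

text \<open>The weight at time \<open>k\<close> uses the step-size of the step from \<open>k\<close>
  to \<open>Suc k\<close>, which is fixed before the index of that step is drawn.\<close>

definition weight_x :: "nat \<Rightarrow> 'w \<Rightarrow> real" where
  "weight_x k \<omega> = (if \<forall>i u. A i u = 0 then 1 else 1 / \<tau> (Suc k) \<omega>)"

definition weight_y :: "nat \<Rightarrow> 'w \<Rightarrow> 'n \<Rightarrow> real" where
  "weight_y k \<omega> i = (if \<forall>u. A i u = 0 then 1 else 1 / \<sigma> (Suc k) \<omega> i)"

lemma
  assumes \<omega>: "\<omega> \<in> space M"
  shows y_0: "y 0 \<omega> = y0"
    and x_Suc: "x (Suc k) \<omega> = primal_step (\<tau> (Suc k) \<omega>) (x k \<omega>) (ybar k \<omega>)"
    and y_Suc: "y (Suc k) \<omega> = replace (pick k \<omega>) (dual_prox k \<omega>) (y k \<omega>)"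
    and increment_Suc: "increment (Suc k) \<omega> = replace (pick k \<omega>) (dual_prox k \<omega> - y k \<omega>) 0"
    and ybar_eq: "ybar k \<omega> $ i = y k \<omega> $ i + (1 / p i) *\<^sub>R increment k \<omega> $ i"
proof -
  note R = run[OF \<omega>, unfolded aspdhg_run_def]
  show "y 0 \<omega> = y0" using R by blast
  show "x (Suc k) \<omega> = primal_step (\<tau> (Suc k) \<omega>) (x k \<omega>) (ybar k \<omega>)"
    unfolding primal_step_def using R by blast
  have y_comp: "y (Suc k) \<omega> $ i = (if i = pick k \<omega> then dual_prox k \<omega> $ i else y k \<omega> $ i)" for i k
    unfolding dual_prox_def dual_step_def vec_lambda_beta using R by blast
  then show "y (Suc k) \<omega> = replace (pick k \<omega>) (dual_prox k \<omega>) (y k \<omega>)"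
    by (simp add: replace_def vec_eq_iff)
  show "increment (Suc k) \<omega> = replace (pick k \<omega>) (dual_prox k \<omega> - y k \<omega>) 0"
    using y_comp by (simp add: increment_def replace_def vec_eq_iff)
  show "ybar k \<omega> $ i = y k \<omega> $ i + (1 / p i) *\<^sub>R increment k \<omega> $ i"
  proof (cases k)
    case 0
    then show ?thesis using R by (simp add: increment_def)
  next
    case (Suc m)
    have bar: "ybar (Suc m) \<omega> $ i = (if i = pick m \<omega>
      then y (Suc m) \<omega> $ i + (1 / p i) *\<^sub>R (y (Suc m) \<omega> $ i - y m \<omega> $ i) else y m \<omega> $ i)"
      using R by blast
    show ?thesis
    proof (cases "i = pick m \<omega>")
      case True
      then have "ybar (Suc m) \<omega> $ i = y (Suc m) \<omega> $ i + (1 / p i) *\<^sub>R (y (Suc m) \<omega> $ i - y m \<omega> $ i)"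
        using bar by meson
      then show ?thesis by (simp add: Suc increment_def)
    next
      case False
      \<comment> \<open>In a block that was not picked, \<open>ybar\<close> takes the previous
        \<open>y\<close>, which is also the current one, in accordance with a zero
        increment.\<close>
      then have "ybar (Suc m) \<omega> $ i = y m \<omega> $ i" "y (Suc m) \<omega> $ i = y m \<omega> $ i"
        using bar y_comp[of m i] by presburger+
      then show ?thesis by (simp add: Suc increment_def)
    qed
  qed
qed

lemma increment_single: "\<omega> \<in> space M \<Longrightarrow> \<exists>j. \<forall>i. i \<noteq> j \<longrightarrow> increment k \<omega> $ i = 0"
  by (cases k) (auto simp: increment_Suc replace_def, simp add: increment_def)

lemma y_in_Y:
  assumes "good \<omega>"
  shows "y k \<omega> $ i \<in> Y i"
proof (induction k)
  case 0
  then show ?case using assms y0 by (simp add: good_def y_0)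
next
  case (Suc k)
  have \<omega>: "\<omega> \<in> space M" and "0 < \<sigma> (Suc k) \<omega> i" using assms unfolding good_def by blast+
  from dual_step_mono(1)[OF this(2) Suc] have "dual_prox k \<omega> $ i \<in> Y i"
    by (simp add: dual_prox_def)
  then show ?case using Suc by (cases "i = pick k \<omega>") (auto simp: y_Suc[OF \<omega>] replace_def)
qed

lemma coupled_weights_good:
  assumes "good \<omega>"
  shows "coupled_weights (weight_x k \<omega>) (weight_y k \<omega>)"
  unfolding coupled_weights_def
proof (intro conjI allI)
  have pos: "0 < \<tau> (Suc k) \<omega>" "\<And>i. 0 < \<sigma> (Suc k) \<omega> i"
    and bound: "\<And>i. \<tau> (Suc k) \<omega> * \<sigma> (Suc k) \<omega> i * ((onorm (A i))\<^sup>2 / p i) \<le> \<beta>"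
    using assms unfolding good_def by blast+
  show x: "0 < weight_x k \<omega>" using pos by (simp add: weight_x_def)
  fix i
  show y: "0 < weight_y k \<omega> i" using pos by (simp add: weight_y_def)
  show "(onorm (A i))\<^sup>2 / p i \<le> \<beta> * (weight_x k \<omega> * weight_y k \<omega> i)"
  proof (cases "\<forall>u. A i u = 0")
    case True
    then have "onorm (A i) = 0" using onorm_eq_0[OF A(1)] by blast
    then show ?thesis using x y \<beta> by simp
  next
    \<comment> \<open>A nonzero \<open>A i\<close> also makes \<open>weight_x\<close> a true
      reciprocal, so the step-size bound applies to both factors.\<close>
    case False
    then have "weight_x k \<omega> = 1 / \<tau> (Suc k) \<omega>" "weight_y k \<omega> i = 1 / \<sigma> (Suc k) \<omega> i"
      by (auto simp: weight_x_def weight_y_def)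
    then show ?thesis using bound[of i] pos(1) pos(2)[of i]
      by (simp add: pos_le_divide_eq mult_ac)
  qed
qed

text \<open>The index of \<open>\<epsilon>\<close> is \<open>Suc k\<close> because the weights at
  \<open>k\<close> come from the step-sizes at \<open>Suc k\<close>; a weight that is constantly 1
  complies since \<open>\<epsilon>\<close> is nonnegative.\<close>

lemma weights_quasi_decreasing:
  assumes "good \<omega>"
  shows "weight_x (Suc k) \<omega> \<le> (1 + \<epsilon> (Suc k)) * weight_x k \<omega>"
    "weight_y (Suc k) \<omega> i \<le> (1 + \<epsilon> (Suc k)) * weight_y k \<omega> i"
  using assms \<epsilon>(1)[of "Suc k"] unfolding good_def weight_x_def weight_y_def by auto

text \<open>These are all the ingredients of the Lyapunov function, its branches and the dissipation
  at time \<open>k\<close>; each is computed before the index at time \<open>k\<close> is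
  drawn.\<close>

lemma same_past:
  assumes \<omega>: "\<omega> \<in> space M" "\<omega>' \<in> space M" and past: "\<forall>j<k. pick j \<omega> = pick j \<omega>'"
  shows "x k \<omega> = x k \<omega>'" "y k \<omega> = y k \<omega>'" "increment k \<omega> = increment k \<omega>'"
    "x (Suc k) \<omega> = x (Suc k) \<omega>'" "dual_prox k \<omega> = dual_prox k \<omega>'"
    "weight_x k \<omega> = weight_x k \<omega>'" "weight_y k \<omega> = weight_y k \<omega>'"
proof -
  note runs = run[OF \<omega>(1)] run[OF \<omega>(2)]
  have eq: "\<tau> j \<omega> = \<tau> j \<omega>' \<and> \<sigma> j \<omega> = \<sigma> j \<omega>' \<and> x j \<omega> = x j \<omega>' \<and> y j \<omega> = y j \<omega>' \<and> ybar j \<omega> = ybar j \<omega>'"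
    if "j \<le> k" for j
    using aspdhg_run_deterministic[OF runs _ that] past by blast
  note step = aspdhg_run_step_deterministic[OF runs eq]
  show "x k \<omega> = x k \<omega>'" "y k \<omega> = y k \<omega>'" using eq[of k] by auto
  show "increment k \<omega> = increment k \<omega>'"
    using eq by (cases k) (simp_all add: increment_def)
  show "x (Suc k) \<omega> = x (Suc k) \<omega>'" using step by blast
  show "dual_prox k \<omega> = dual_prox k \<omega>'" using step eq[of k] by (simp add: dual_prox_def)
  show "weight_x k \<omega> = weight_x k \<omega>'" using step by (simp add: weight_x_def)
  show "weight_y k \<omega> = weight_y k \<omega>'" using step by (simp add: weight_y_def fun_eq_iff)
qed

definition Lyap :: "'x \<times> ('y ^ 'n) \<Rightarrow> nat \<Rightarrow> 'w \<Rightarrow> real" where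
  "Lyap z k \<omega> = lyapunov (weight_x k \<omega>) (weight_y k \<omega>) z (x k \<omega>) (y k \<omega>) (increment k \<omega>)"

definition dissipation :: "nat \<Rightarrow> 'w \<Rightarrow> real" where
  "dissipation k \<omega> = weight_x k \<omega> * (norm (x (Suc k) \<omega> - x k \<omega>))\<^sup>2
    + (\<Sum>i\<in>UNIV. weight_y k \<omega> i * (norm (dual_prox k \<omega> $ i - y k \<omega> $ i))\<^sup>2)"

text \<open>The Lyapunov function after the step if block \<open>i\<close> were picked, still in the
  weights of time \<open>k\<close>. Keeping these weights separates the averaging over
  \<open>i\<close> from the change of step-sizes.\<close>

definition branch :: "'x \<times> ('y ^ 'n) \<Rightarrow> nat \<Rightarrow> 'n \<Rightarrow> 'w \<Rightarrow> real" where
  "branch z k i \<omega> = lyapunov (weight_x k \<omega>) (weight_y k \<omega>) z (x (Suc k) \<omega>)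
    (replace i (dual_prox k \<omega>) (y k \<omega>)) (replace i (dual_prox k \<omega> - y k \<omega>) 0)"

lemma past_determined_Lyap: "past_determined k (Lyap z k)"
  unfolding past_determined_def
proof (intro ballI impI)
  fix \<omega> \<omega>' assume "\<omega> \<in> space M" "\<omega>' \<in> space M" "\<forall>j<k. pick j \<omega> = pick j \<omega>'"
  note same_past[OF this]
  then show "Lyap z k \<omega> = Lyap z k \<omega>'"
    by (simp only: Lyap_def)
qed

lemma past_determined_scaled_dissipation: "past_determined k (\<lambda>\<omega>. \<delta> * dissipation k \<omega>)"
  unfolding past_determined_def
proof (intro ballI impI)
  fix \<omega> \<omega>' assume "\<omega> \<in> space M" "\<omega>' \<in> space M" "\<forall>j<k. pick j \<omega> = pick j \<omega>'"
  note same_past[OF this]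
  then show "\<delta> * dissipation k \<omega> = \<delta> * dissipation k \<omega>'"
    by (simp only: dissipation_def)
qed

lemma past_determined_branch: "past_determined k (branch z k i)"
  unfolding past_determined_def
proof (intro ballI impI)
  fix \<omega> \<omega>' assume "\<omega> \<in> space M" "\<omega>' \<in> space M" "\<forall>j<k. pick j \<omega> = pick j \<omega>'"
  note same_past[OF this]
  then show "branch z k i \<omega> = branch z k i \<omega>'"
    by (simp only: branch_def)
qed

lemma dissipation_nonneg: "good \<omega> \<Longrightarrow> 0 \<le> dissipation k \<omega>"
  using coupled_weights_good[of \<omega> k] unfolding dissipation_def coupled_weights_def
  by (intro add_nonneg_nonneg sum_nonneg mult_nonneg_nonneg) (auto simp: less_imp_le)

lemma Lyap_nonneg:
  assumes "good \<omega>"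
  shows "0 \<le> Lyap z k \<omega>"
proof -
  have "\<omega> \<in> space M" using assms by (simp add: good_def)
  then obtain j where j: "\<And>i. i \<noteq> j \<Longrightarrow> increment k \<omega> $ i = 0" using increment_single by blast
  note w = coupled_weights_good[OF assms, of k]
  have "\<delta> * energy (weight_x k \<omega>) (weight_y k \<omega>) z (x k \<omega>) (y k \<omega>) (increment k \<omega>) \<le> Lyap z k \<omega>"
    unfolding Lyap_def by (rule energy_le_lyapunov[OF w j])
  moreover note mult_nonneg_nonneg[OF less_imp_le[OF \<delta>(1)] energy_nonneg[OF w, of z "x k \<omega>" "y k \<omega>" "increment k \<omega>"]]
  ultimately show ?thesis by linarith
qed

text \<open>The iterates at \<open>Suc k\<close> are those of the branch that was picked; only the
  weights differ.\<close>

lemma Lyap_Suc_le: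
  assumes "good \<omega>"
  shows "Lyap z (Suc k) \<omega> \<le> (1 + \<epsilon> (Suc k) / \<delta>) * branch z k (pick k \<omega>) \<omega>"
proof -
  have \<omega>: "\<omega> \<in> space M" using assms by (simp add: good_def)
  show ?thesis
    unfolding Lyap_def branch_def y_Suc[OF \<omega>] increment_Suc[OF \<omega>]
    by (rule lyapunov_weights_mono[OF coupled_weights_good[OF assms] _ \<epsilon>(1)
          weights_quasi_decreasing[OF assms], where j = "pick k \<omega>"]) (simp add: replace_def)
qed

lemma branch_mean_le:
  assumes z: "z \<in> C" and good: "good \<omega>"
  shows "(\<Sum>i\<in>UNIV. p i * branch z k i \<omega>) \<le> Lyap z k \<omega> - \<delta> * dissipation k \<omega>"
proof -
  have \<omega>: "\<omega> \<in> space M" using good by (simp add: good_def)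
  have pos: "0 < \<tau> (Suc k) \<omega>" "\<And>i. 0 < \<sigma> (Suc k) \<omega> i" using good unfolding good_def by blast+
  obtain j where j: "\<And>i. i \<noteq> j \<Longrightarrow> increment k \<omega> $ i = 0" using increment_single[OF \<omega>] by blast
  show ?thesis
    unfolding Lyap_def branch_def dissipation_def x_Suc[OF \<omega>] dual_prox_def
  proof (rule lyapunov_step[where j = j, OF z y_in_Y[OF good] pos coupled_weights_good[OF good]])
    show "increment k \<omega> $ i = 0" if "i \<noteq> j" for i using that by (rule j)
    show "weight_x k \<omega> * \<tau> (Suc k) \<omega> = 1 \<or> (\<forall>i u. A i u = 0)"
      using pos(1) by (simp add: weight_x_def)
    show "weight_y k \<omega> i * \<sigma> (Suc k) \<omega> i = 1 \<or> (\<forall>u. A i u = 0)" for i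
      using pos(2)[of i] by (simp add: weight_y_def)
  qed (rule ybar_eq[OF \<omega>])
qed

lemma past_determined_indicator:
  fixes h :: "'w \<Rightarrow> real"
  assumes B: "B \<in> sets (past_algebra k)" and h: "past_determined k h"
  shows "past_determined k (\<lambda>\<omega>. indicator B \<omega> * h \<omega>)"
  unfolding past_determined_def
proof (intro ballI impI)
  fix \<omega> \<omega>' assume "\<omega> \<in> space M" "\<omega>' \<in> space M" "\<forall>j<k. pick j \<omega> = pick j \<omega>'"
  then have "h \<omega> = h \<omega>'" "\<omega> \<in> B \<longleftrightarrow> \<omega>' \<in> B"
    using B h unfolding sets_past_algebra past_determined_def by blast+
  then show "indicator B \<omega> * h \<omega> = indicator B \<omega>' * h \<omega>'" by (simp add: indicator_def)
qed

text \<open>\<open>Lyap_Suc_le\<close> pays for the new weights, \<open>expectation_pick\<close>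
  averages the branches over the index, and \<open>branch_mean_le\<close> bounds the average. An
  event of the past may be inserted, as it is frozen in the averaging.\<close>

lemma Lyap_supermartingale_step:
  assumes z: "z \<in> C" and B: "B \<in> sets (past_algebra k)"
  shows "(\<integral>\<omega>. indicator B \<omega> * Lyap z (Suc k) \<omega> \<partial>M)
    \<le> (1 + \<epsilon> (Suc k) / \<delta>) * (\<integral>\<omega>. indicator B \<omega> * Lyap z k \<omega> \<partial>M) - (\<integral>\<omega>. indicator B \<omega> * (\<delta> * dissipation k \<omega>) \<partial>M)"
proof -
  define c where "c = 1 + \<epsilon> (Suc k) / \<delta>"
  have c: "1 \<le> c" using \<epsilon>(1) \<delta>(1) by (simp add: c_def)
  note det = past_determined_indicator[OF B]
  note intL = past_determined_integrable[OF det[OF past_determined_Lyap[of k z]]]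
  note intD = past_determined_integrable[OF det[OF past_determined_scaled_dissipation]]
  note detB = det[OF past_determined_branch[of k z]]
  have B_Suc: "B \<in> sets (past_algebra (Suc k))" using past_algebra_mono B by blast
  have intS: "integrable M (\<lambda>\<omega>. indicator B \<omega> * Lyap z (Suc k) \<omega>)"
    by (rule past_determined_integrable[OF past_determined_indicator[OF B_Suc past_determined_Lyap]])
  \<comment> \<open>The picked branch needs the index drawn at time \<open>k\<close> as well, so it
    is determined by \<open>Suc k\<close> indices.\<close>
  have intP: "integrable M (\<lambda>\<omega>. indicator B \<omega> * branch z k (pick k \<omega>) \<omega>)"
  proof (rule past_determined_integrable[of "Suc k"], unfold past_determined_def, intro ballI impI)
    fix \<omega> \<omega>' assume *: "\<omega> \<in> space M" "\<omega>' \<in> space M" "\<forall>j<Suc k. pick j \<omega> = pick j \<omega>'"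
    then show "indicator B \<omega> * branch z k (pick k \<omega>) \<omega> = indicator B \<omega>' * branch z k (pick k \<omega>') \<omega>'"
      using detB[of "pick k \<omega>"] unfolding past_determined_def by (metis lessI less_SucI)
  qed
  have "(\<integral>\<omega>. indicator B \<omega> * Lyap z (Suc k) \<omega> \<partial>M) \<le> (\<integral>\<omega>. c * (indicator B \<omega> * branch z k (pick k \<omega>) \<omega>) \<partial>M)"
  proof (rule integral_mono_AE[OF intS integrable_mult_right[OF intP]])
    show "AE \<omega> in M. indicator B \<omega> * Lyap z (Suc k) \<omega> \<le> c * (indicator B \<omega> * branch z k (pick k \<omega>) \<omega>)"
      using AE_good by eventually_elim (use Lyap_Suc_le in \<open>auto simp: c_def indicator_def\<close>)
  qed
  also have "\<dots> = c * (\<integral>\<omega>. (\<Sum>i\<in>UNIV. p i * (indicator B \<omega> * branch z k i \<omega>)) \<partial>M)"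
    using expectation_pick[of k "\<lambda>i \<omega>. indicator B \<omega> * branch z k i \<omega>", OF detB] by simp
  also have "(\<integral>\<omega>. (\<Sum>i\<in>UNIV. p i * (indicator B \<omega> * branch z k i \<omega>)) \<partial>M)
      \<le> (\<integral>\<omega>. indicator B \<omega> * Lyap z k \<omega> - indicator B \<omega> * (\<delta> * dissipation k \<omega>) \<partial>M)"
  proof (rule integral_mono_AE)
    show "integrable M (\<lambda>\<omega>. \<Sum>i\<in>UNIV. p i * (indicator B \<omega> * branch z k i \<omega>))"
      by (intro Bochner_Integration.integrable_sum integrable_mult_right past_determined_integrable[OF detB])
    show "integrable M (\<lambda>\<omega>. indicator B \<omega> * Lyap z k \<omega> - indicator B \<omega> * (\<delta> * dissipation k \<omega>))"
      using intL intD by (rule Bochner_Integration.integrable_diff)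
    show "AE \<omega> in M. (\<Sum>i\<in>UNIV. p i * (indicator B \<omega> * branch z k i \<omega>))
        \<le> indicator B \<omega> * Lyap z k \<omega> - indicator B \<omega> * (\<delta> * dissipation k \<omega>)"
      using AE_good by eventually_elim (use branch_mean_le[OF z] in \<open>auto simp: indicator_def\<close>)
  qed
  also have "\<dots> = (\<integral>\<omega>. indicator B \<omega> * Lyap z k \<omega> \<partial>M) - (\<integral>\<omega>. indicator B \<omega> * (\<delta> * dissipation k \<omega>) \<partial>M)"
    by (rule Bochner_Integration.integral_diff[OF intL intD])
  finally have "(\<integral>\<omega>. indicator B \<omega> * Lyap z (Suc k) \<omega> \<partial>M)
    \<le> c * ((\<integral>\<omega>. indicator B \<omega> * Lyap z k \<omega> \<partial>M) - (\<integral>\<omega>. indicator B \<omega> * (\<delta> * dissipation k \<omega>) \<partial>M))"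
    using c by (simp add: mult_left_mono)
  moreover have "0 \<le> (\<integral>\<omega>. indicator B \<omega> * (\<delta> * dissipation k \<omega>) \<partial>M)"
    using AE_good by (intro integral_nonneg_AE, eventually_elim) (use dissipation_nonneg \<delta>(1) in auto)
  then have "1 * (\<integral>\<omega>. indicator B \<omega> * (\<delta> * dissipation k \<omega>) \<partial>M) \<le> c * (\<integral>\<omega>. indicator B \<omega> * (\<delta> * dissipation k \<omega>) \<partial>M)"
    using c by (intro mult_right_mono)
  ultimately show ?thesis unfolding c_def[symmetric] by (simp add: right_diff_distrib)
qed

lemma AE_Lyap_convergent:
  assumes z: "z \<in> C"
  shows "AE \<omega> in M. convergent (\<lambda>k. Lyap z k \<omega>)" "AE \<omega> in M. (\<lambda>k. dissipation k \<omega>) \<longlonglongrightarrow> 0"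
proof -
  have nn: "AE \<omega> in M. 0 \<le> Lyap z k \<omega>" for k
    using AE_good by eventually_elim (rule Lyap_nonneg)
  have nn': "AE \<omega> in M. 0 \<le> \<delta> * dissipation k \<omega>" for k
    using AE_good
    by eventually_elim (rule mult_nonneg_nonneg[OF less_imp_le[OF \<delta>(1)] dissipation_nonneg])
  have \<epsilon>': "0 \<le> \<epsilon> (Suc k) / \<delta>" "summable (\<lambda>k. \<epsilon> (Suc k) / \<delta>)" for k
    using \<epsilon>(1)[of "Suc k"] \<epsilon>(2) \<delta>(1) by (simp_all add: summable_Suc_iff summable_divide)
  note RS = robbins_siegmund[where F = past_algebra and V = "Lyap z" and \<theta> = "\<lambda>k \<omega>. \<delta> * dissipation k \<omega>"
      and \<epsilon> = "\<lambda>k. \<epsilon> (Suc k) / \<delta>",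
      OF subalgebra_past_algebra past_algebra_mono past_determined_measurable[OF past_determined_Lyap]
        past_determined_integrable[OF past_determined_Lyap] nn past_determined_integrable[OF past_determined_scaled_dissipation] nn'
        \<epsilon>']
  show "AE \<omega> in M. convergent (\<lambda>k. Lyap z k \<omega>)"
    by (rule RS(1)) (rule Lyap_supermartingale_step[OF z])
  have "AE \<omega> in M. (\<lambda>k. \<delta> * dissipation k \<omega>) \<longlonglongrightarrow> 0"
    by (rule RS(2)) (rule Lyap_supermartingale_step[OF z])
  then show "AE \<omega> in M. (\<lambda>k. dissipation k \<omega>) \<longlonglongrightarrow> 0"
  proof eventually_elim
    case (elim \<omega>)
    from tendsto_mult_left[OF this, of "1 / \<delta>"] show ?case using \<delta>(1) by simp
  qed
qed

text \<open>For nonzero \<open>A i\<close> the product of the two weights stays above a positive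
  constant given by the operator norm, so neither limit is 0. If \<open>A i\<close> vanishes, its
  dual weight is constantly 1, and so is the primal weight if all operators vanish.\<close>

lemma weight_limits:
  assumes good: "good \<omega>"
  obtains a0 b0 where "(\<lambda>k. weight_x k \<omega>) \<longlonglongrightarrow> a0" "0 < a0"
    "\<And>i. (\<lambda>k. weight_y k \<omega> i) \<longlonglongrightarrow> b0 i" "\<And>i. 0 < b0 i"
proof -
  have w: "0 < weight_x k \<omega>" "0 < weight_y k \<omega> i"
      "(onorm (A i))\<^sup>2 / p i \<le> \<beta> * (weight_x k \<omega> * weight_y k \<omega> i)" for k i
    using coupled_weights_good[OF good, of k] unfolding coupled_weights_def by blast+
  have \<epsilon>': "\<And>k. 0 \<le> \<epsilon> (Suc k)" "summable (\<lambda>k. \<epsilon> (Suc k))"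
    using \<epsilon> by (auto simp: summable_Suc_iff)
  have "convergent (\<lambda>k. weight_x k \<omega>)"
    using w(1) weights_quasi_decreasing(1)[OF good]
    by (intro quasi_decreasing_convergent[OF \<epsilon>']) (auto intro: less_imp_le)
  then obtain a0 where a0: "(\<lambda>k. weight_x k \<omega>) \<longlonglongrightarrow> a0" unfolding convergent_def by blast
  have "convergent (\<lambda>k. weight_y k \<omega> i)" for i
    using w(2) weights_quasi_decreasing(2)[OF good]
    by (intro quasi_decreasing_convergent[OF \<epsilon>']) (auto intro: less_imp_le)
  then obtain b0 where b0: "\<And>i. (\<lambda>k. weight_y k \<omega> i) \<longlonglongrightarrow> b0 i" unfolding convergent_def by metis
  have nn: "0 \<le> a0" "0 \<le> b0 i" for i
    by (rule LIMSEQ_le_const[OF a0], use w(1) less_imp_le in blast)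
      (rule LIMSEQ_le_const[OF b0], use w(2) less_imp_le in blast)
  have prod: "0 < a0 \<and> 0 < b0 i" if "\<not> (\<forall>u. A i u = 0)" for i
  proof -
    have "0 < onorm (A i)" using that onorm_pos_lt[OF A(1)] by blast
    then have "0 < (onorm (A i))\<^sup>2 / p i" using p_pos[of i] by simp
    also have "\<dots> \<le> \<beta> * (a0 * b0 i)"
      by (rule LIMSEQ_le_const[OF tendsto_mult_left[OF tendsto_mult[OF a0 b0]]]) (use w(3) in blast)
    finally show ?thesis using nn(1) nn(2)[of i] \<beta> by (auto simp: zero_less_mult_iff)
  qed
  have "0 < a0"
  proof (cases "\<forall>i u. A i u = 0")
    case True
    then show ?thesis using a0 by (simp add: weight_x_def LIMSEQ_const_iff)
  qed (use prod in blast)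
  moreover have "0 < b0 i" for i
  proof (cases "\<forall>u. A i u = 0")
    case True
    then show ?thesis using b0[of i] by (simp add: weight_y_def LIMSEQ_const_iff)
  qed (use prod in blast)
  ultimately show thesis using a0 b0 by (intro that)
qed

theorem AE_weakly_convergent:
  assumes saddle: "C \<noteq> {}"
  shows "AE \<omega> in M. \<exists>z\<in>C. weakly_convergent_to (\<lambda>k. (x k \<omega>, y k \<omega>)) z"
proof -
  obtain D where D: "countable D" "D \<subseteq> C" "C \<subseteq> closure D"
    using countable_dense_subset .
  then have D_ne: "D \<noteq> {}" using saddle by auto
  \<comment> \<open>The null set outside which \<open>Lyap z\<close> converges depends on
    \<open>z\<close>; countability of \<open>D\<close> allows a common one.\<close>
  have "AE \<omega> in M. \<forall>z\<in>D. convergent (\<lambda>k. Lyap z k \<omega>)"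
    using AE_Lyap_convergent(1) D(2) by (intro AE_ball_countable[THEN iffD2] D(1) ballI) blast
  moreover obtain z0 where "z0 \<in> C" using saddle by blast
  note AE_Lyap_convergent(2)[OF this]
  ultimately show ?thesis
    using AE_good
  proof eventually_elim
    case (elim \<omega>)
    have \<omega>: "\<omega> \<in> space M" using elim(3) by (simp add: good_def)
    have pos: "0 < \<tau> k \<omega>" "0 < \<sigma> k \<omega> i" for k i using elim(3) unfolding good_def by blast+
    \<comment> \<open>Minty's argument asks only that the true reciprocals be bounded; unlike the
      weights, they may tend to 0.\<close>
    have inv: "Bseq (\<lambda>k. 1 / \<tau> k \<omega>)" "Bseq (\<lambda>k. 1 / \<sigma> k \<omega> i)" for i
      using elim(3) unfolding good_def
      by (auto intro!: convergent_imp_Bseq quasi_decreasing_convergent[OF \<epsilon>] intro: less_imp_le simp del: times_divide_eq_right)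
    obtain a0 b0 where lim: "(\<lambda>k. weight_x k \<omega>) \<longlonglongrightarrow> a0" "0 < a0"
        "\<And>i. (\<lambda>k. weight_y k \<omega> i) \<longlonglongrightarrow> b0 i" "\<And>i. 0 < b0 i"
      using weight_limits[OF elim(3)] by blast
    have prox: "dual_prox k \<omega> $ i = dual_step (\<sigma> (Suc k) \<omega> i) i (x (Suc k) \<omega>) (y k \<omega> $ i)" for k i
      by (simp add: dual_prox_def)
    have inc0: "increment 0 \<omega> = 0" by (simp add: increment_def)
    have L: "convergent (\<lambda>k. lyapunov (weight_x k \<omega>) (weight_y k \<omega>) z (x k \<omega>) (y k \<omega>) (increment k \<omega>))"
      if "z \<in> D" for z
      using elim(1) that unfolding Lyap_def by blast
    obtain z where "z \<in> C" "weakly_convergent_to (\<lambda>k. (x k \<omega>, y k \<omega>)) z"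
      by (rule pathwise_convergence[where x = "\<lambda>k. x k \<omega>" and y = "\<lambda>k. y k \<omega>" and yb = "\<lambda>k. ybar k \<omega>"
        and v = "\<lambda>k. dual_prox k \<omega>" and d = "\<lambda>k. increment k \<omega>" and pick = "\<lambda>k. pick k \<omega>"
        and \<tau> = "\<lambda>k. \<tau> k \<omega>" and \<sigma> = "\<lambda>k. \<sigma> k \<omega>" and a = "\<lambda>k. weight_x k \<omega>" and b = "\<lambda>k. weight_y k \<omega>",
        OF x_Suc[OF \<omega>] prox y_in_Y[OF elim(3)] increment_Suc[OF \<omega>] inc0 ybar_eq[OF \<omega>] pos inv
          coupled_weights_good[OF elim(3)] lim D(2,3) D_ne L elim(2)[unfolded dissipation_def]])
    then show ?case by blast
  qed
qed

end

theorem theorem2p1: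
  fixes M :: "'w measure"
    and Y :: "'n::finite \<Rightarrow> 'y::{real_inner, banach, second_countable_topology} set"
    and A :: "'n \<Rightarrow> 'x::{real_inner, banach, second_countable_topology} \<Rightarrow> 'y"
    and f :: "'n \<Rightarrow> 'y \<Rightarrow> ereal"
    and g :: "'x \<Rightarrow> ereal"
    and p :: "'n \<Rightarrow> real"
    and rule :: "nat \<Rightarrow> (nat \<Rightarrow> real) \<Rightarrow> (nat \<Rightarrow> 'n \<Rightarrow> real) \<Rightarrow> (nat \<Rightarrow> 'x) \<Rightarrow>
                  (nat \<Rightarrow> 'y ^ 'n) \<Rightarrow> real \<times> ('n \<Rightarrow> real)"
    and x0 :: 'x and y0 :: "'y ^ 'n" and \<tau>0 :: real and \<sigma>0 :: "'n \<Rightarrow> real"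
    and pick :: "nat \<Rightarrow> 'w \<Rightarrow> 'n"
    and \<tau> :: "nat \<Rightarrow> 'w \<Rightarrow> real" and \<sigma> :: "nat \<Rightarrow> 'w \<Rightarrow> 'n \<Rightarrow> real"
    and x :: "nat \<Rightarrow> 'w \<Rightarrow> 'x" and y ybar :: "nat \<Rightarrow> 'w \<Rightarrow> 'y ^ 'n"
    and \<beta> :: real
  assumes prob: "prob_space M"
    and Y: "\<And>i. subspace (Y i)" "\<And>i. closed (Y i)"
    and A: "\<And>i. bounded_linear (A i)" "\<And>i. range (A i) \<subseteq> Y i"
    and f: "\<And>i. proper_on (Y i) (f i)" "\<And>i. ereal_convex_on (Y i) (f i)"
           "\<And>i. lsc_on (Y i) (f i)"
    and g: "proper_on UNIV g" "ereal_convex_on UNIV g" "lsc_on UNIV g"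
    and saddle: "saddle_points Y A f g \<noteq> {}"
    and proper_sampling: "\<And>i. 0 < p i"
    and sampling: "serial_sampling M p pick"
    and y0: "\<And>i. y0 $ i \<in> Y i"
    and run: "\<And>\<omega>. \<omega> \<in> space M \<Longrightarrow>
      aspdhg_run Y A f g p rule x0 y0 \<tau>0 \<sigma>0 (\<lambda>k. pick k \<omega>)
        (\<lambda>k. \<tau> k \<omega>) (\<lambda>k. \<sigma> k \<omega>) (\<lambda>k. x k \<omega>) (\<lambda>k. y k \<omega>) (\<lambda>k. ybar k \<omega>)"
    and adapted_\<tau>:
      "adapted_seq (natural_filtration M (\<lambda>k \<omega>. (x k \<omega>, y k \<omega>))) (\<lambda>k. \<tau> (Suc k))"
    and adapted_\<sigma>:
      "\<And>i. adapted_seq (natural_filtration M (\<lambda>k \<omega>. (x k \<omega>, y k \<omega>))) (\<lambda>k \<omega>. \<sigma> (Suc k) \<omega> i)"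
    and \<beta>: "0 < \<beta>" "\<beta> < 1"
    and step_bound: "AE \<omega> in M. \<forall>k i. \<tau> k \<omega> * \<sigma> k \<omega> i * ((onorm (A i))\<^sup>2 / p i) \<le> \<beta>"
    and initial_pos: "0 < \<tau>0" "\<And>i. 0 < \<sigma>0 i"
    and quasi_inc_\<tau>: "as_quasi_increasing M \<tau>"
    and quasi_inc_\<sigma>: "\<And>i. as_quasi_increasing M (\<lambda>k \<omega>. \<sigma> k \<omega> i)"
  shows "AE \<omega> in M. \<exists>z \<in> saddle_points Y A f g.
           weakly_convergent_to (\<lambda>k. (x k \<omega>, y k \<omega>)) z"
proof -
  interpret prob_space M by (rule prob)
  interpret serial_sampling_space M p pick by unfold_locales (rule sampling)
  obtain \<epsilon>\<tau> where \<epsilon>\<tau>: "\<And>k. 0 \<le> \<epsilon>\<tau> k" "summable \<epsilon>\<tau>"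
    "AE \<omega> in M. \<forall>k. 0 < \<tau> k \<omega> \<and> 1 / \<tau> (Suc k) \<omega> \<le> (1 + \<epsilon>\<tau> k) * (1 / \<tau> k \<omega>)"
    using as_quasi_increasing_inverse[OF quasi_inc_\<tau>] by blast
  have "\<forall>i. \<exists>e. (\<forall>k. 0 \<le> e k) \<and> summable e \<and>
    (AE \<omega> in M. \<forall>k. 0 < \<sigma> k \<omega> i \<and> 1 / \<sigma> (Suc k) \<omega> i \<le> (1 + e k) * (1 / \<sigma> k \<omega> i))"
    by (rule allI, rule as_quasi_increasing_inverse[OF quasi_inc_\<sigma>]) blast
  from choice[OF this] obtain \<epsilon>\<sigma> where "\<forall>i. (\<forall>k. 0 \<le> \<epsilon>\<sigma> i k) \<and> summable (\<epsilon>\<sigma> i) \<and>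
    (AE \<omega> in M. \<forall>k. 0 < \<sigma> k \<omega> i \<and> 1 / \<sigma> (Suc k) \<omega> i \<le> (1 + \<epsilon>\<sigma> i k) * (1 / \<sigma> k \<omega> i))" ..
  then have \<epsilon>\<sigma>: "\<And>i k. 0 \<le> \<epsilon>\<sigma> i k" "\<And>i. summable (\<epsilon>\<sigma> i)"
    "\<And>i. AE \<omega> in M. \<forall>k. 0 < \<sigma> k \<omega> i \<and> 1 / \<sigma> (Suc k) \<omega> i \<le> (1 + \<epsilon>\<sigma> i k) * (1 / \<sigma> k \<omega> i)"
    by blast+
  \<comment> \<open>A single sequence dominating all the individual ones; it remains summable
    because there are finitely many blocks.\<close>
  define \<epsilon> where "\<epsilon> k = \<epsilon>\<tau> k + (\<Sum>i\<in>UNIV. \<epsilon>\<sigma> i k)" for k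
  have le: "\<epsilon>\<tau> k \<le> \<epsilon> k" "\<epsilon>\<sigma> i k \<le> \<epsilon> k" for i k
  proof -
    show "\<epsilon>\<tau> k \<le> \<epsilon> k" using \<epsilon>\<sigma>(1) by (simp add: \<epsilon>_def sum_nonneg)
    have "\<epsilon>\<sigma> i k \<le> (\<Sum>i\<in>UNIV. \<epsilon>\<sigma> i k)" using \<epsilon>\<sigma>(1) by (intro member_le_sum) auto
    then show "\<epsilon>\<sigma> i k \<le> \<epsilon> k" using \<epsilon>\<tau>(1)[of k] by (simp add: \<epsilon>_def)
  qed
  interpret aspdhg M p pick Y A f g \<beta> rule x0 y0 \<tau>0 \<sigma>0 \<tau> \<sigma> x y ybar \<epsilon>
  proof (intro aspdhg.intro aspdhg_axioms.intro saddle_problem.intro)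
    show "(\<Sum>i\<in>UNIV. p i) = 1" by (rule sum_p)
    show "0 \<le> \<epsilon> k" for k using le(1)[of k] \<epsilon>\<tau>(1)[of k] by linarith
    show "summable \<epsilon>" unfolding \<epsilon>_def using \<epsilon>\<tau>(2) \<epsilon>\<sigma>(2) by (intro summable_add summable_sum)
    show "AE \<omega> in M. \<forall>k. 0 < \<tau> k \<omega> \<and> 1 / \<tau> (Suc k) \<omega> \<le> (1 + \<epsilon> k) * (1 / \<tau> k \<omega>)"
      using \<epsilon>\<tau>(3)
    proof eventually_elim
      case (elim \<omega>)
      then have "(1 + \<epsilon>\<tau> k) * (1 / \<tau> k \<omega>) \<le> (1 + \<epsilon> k) * (1 / \<tau> k \<omega>)" for k
        using le(1)[of k] by (intro mult_right_mono) (auto simp: less_imp_le)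
      then show ?case using elim order.trans by blast
    qed
    have "AE \<omega> in M. \<forall>i k. 0 < \<sigma> k \<omega> i \<and> 1 / \<sigma> (Suc k) \<omega> i \<le> (1 + \<epsilon>\<sigma> i k) * (1 / \<sigma> k \<omega> i)"
      by (rule AE_all_countable[THEN iffD2, OF allI[OF \<epsilon>\<sigma>(3)]])
    then show "AE \<omega> in M. \<forall>k i. 0 < \<sigma> k \<omega> i \<and> 1 / \<sigma> (Suc k) \<omega> i \<le> (1 + \<epsilon> k) * (1 / \<sigma> k \<omega> i)"
    proof eventually_elim
      case (elim \<omega>)
      then have "(1 + \<epsilon>\<sigma> i k) * (1 / \<sigma> k \<omega> i) \<le> (1 + \<epsilon> k) * (1 / \<sigma> k \<omega> i)" for i k
        using le(2)[of i k] by (intro mult_right_mono) (auto simp: less_imp_le)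
      then show ?case using elim order.trans by blast
    qed
  qed (fact serial_sampling_space_axioms Y A f g proper_sampling \<beta> y0 run step_bound)+
  show ?thesis using saddle by (rule AE_weakly_convergent)
qed

end
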